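(* Let $A$ be a C*-algebra and $I$ a $\sigma$-unital closed two-sided ideal of $A$. Let $M$ and $N$ be countably generated right Hilbert C*-modules over $A$, and suppose $\phi\colon M/MI\to N/NI$ is an isomorphism of Hilbert $A/I$-modules (a unitary adjointable operator). Then there is an isomorphism of Hilbert $A$-modules (unitary) $\Phi\colon M\oplus l_2(I)\to N\oplus l_2(I)$ that induces $\phi$ on the quotients, i.e. $\Phi$ maps $MI\oplus l_2(I)$ onto $NI\oplus l_2(I)$, and under the canonical identifications $(M\oplus l_2(I))/(MI\oplus l_2(I))\cong M/MI$ and $(N\oplus l_2(I))/(NI\oplus l_2(I))\cong N/NI$, the induced map equals $\phi$.
   Context: All Hilbert C*-modules are right Hilbert modules. For a Hilbert $A$-module $M$ and a closed two-sided ideal $I$ of $A$, $MI$ is the closed submodule spanned by $\{mi:m\in M,i\in I\}$ (equivalently $\{z\in M:\langle z,z\rangle\in I\}$), and $M/MI$ is a Hilbert $A/I$-module with inner product $\langle x+MI,y+MI\rangle=\langle x,y\rangle+I$. $l_2(I)$ is the Hilbert module of sequences $(x_k)$ in $I$ such that $\sum_k x_k^*x_k$ converges in norm, with inner product $\langle (x_k),(y_k)\rangle=\sum_k x_k^*y_k$; note $l_2(I)I=l_2(I)$. Every adjointable operator $T\colon M\to N$ satisfies $T(MI)\subseteq NI$ and so induces an adjointable operator $M/MI\to N/NI$. *)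

theory Defs
  imports "HOL-Analysis.Analysis"
begin

definition cstar_alg :: "(complex \<Rightarrow> 'a::{real_normed_algebra,banach} \<Rightarrow> 'a) \<Rightarrow> ('a \<Rightarrow> 'a) \<Rightarrow> bool"
  where "cstar_alg cs st \<longleftrightarrow>
    (\<forall>r a. cs (complex_of_real r) a = r *\<^sub>R a) \<and>
    (\<forall>c d a. cs (c + d) a = cs c a + cs d a) \<and>
    (\<forall>c a b. cs c (a + b) = cs c a + cs c b) \<and>
    (\<forall>c d a. cs (c * d) a = cs c (cs d a)) \<and>
    (\<forall>c a b. cs c (a * b) = cs c a * b \<and> cs c (a * b) = a * cs c b) \<and>
    (\<forall>c a. norm (cs c a) = cmod c * norm a) \<and>
    (\<forall>a. st (st a) = a) \<and>
    (\<forall>a b. st (a + b) = st a + st b) \<and>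
    (\<forall>c a. st (cs c a) = cs (cnj c) (st a)) \<and>
    (\<forall>a b. st (a * b) = st b * st a) \<and>
    (\<forall>a. norm (st a * a) = (norm a)\<^sup>2)"

definition positive_el :: "('a::times \<Rightarrow> 'a) \<Rightarrow> 'a \<Rightarrow> bool"
  where "positive_el st a \<longleftrightarrow> (\<exists>b. a = st b * b)"

definition closed_ideal :: "(complex \<Rightarrow> 'a \<Rightarrow> 'a) \<Rightarrow> 'a::real_normed_algebra set \<Rightarrow> bool"
  where "closed_ideal cs I \<longleftrightarrow> closed I \<and> 0 \<in> I \<and>
    (\<forall>x\<in>I. \<forall>y\<in>I. x + y \<in> I) \<and> (\<forall>c. \<forall>x\<in>I. cs c x \<in> I) \<and>
    (\<forall>a. \<forall>x\<in>I. a * x \<in> I \<and> x * a \<in> I)"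

definition sigma_unital :: "('a \<Rightarrow> 'a) \<Rightarrow> 'a::real_normed_algebra set \<Rightarrow> bool"
  where "sigma_unital st I \<longleftrightarrow> (\<exists>e::nat \<Rightarrow> 'a.
    (\<forall>n. e n \<in> I \<and> positive_el st (e n) \<and> norm (e n) \<le> 1 \<and>
         positive_el st (e (Suc n) - e n)) \<and>
    (\<forall>x\<in>I. (\<lambda>n. e n * x) \<longlonglongrightarrow> x \<and> (\<lambda>n. x * e n) \<longlonglongrightarrow> x))"

(* right Hilbert C*-module over the C*-algebra (cs, st) on the type 'm
   (the whole type is the module); cm: complex scalars, act: right action,
   ip: A-valued inner product (linear in the second variable).
   The norm of 'm is the one induced by the inner product; completeness
   comes from the banach class. *)
definition hilbert_module ::
  "(complex \<Rightarrow> 'a::{real_normed_algebra,banach} \<Rightarrow> 'a) \<Rightarrow> ('a \<Rightarrow> 'a) \<Rightarrow> (complex \<Rightarrow> 'm::{real_normed_vector,banach} \<Rightarrow> 'm) \<Rightarrow>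
   ('m \<Rightarrow> 'a \<Rightarrow> 'm) \<Rightarrow> ('m \<Rightarrow> 'm \<Rightarrow> 'a) \<Rightarrow> bool"
  where "hilbert_module cs st cm act ip \<longleftrightarrow>
    (\<forall>r x. cm (complex_of_real r) x = r *\<^sub>R x) \<and>
    (\<forall>c d x. cm (c + d) x = cm c x + cm d x) \<and>
    (\<forall>c x y. cm c (x + y) = cm c x + cm c y) \<and>
    (\<forall>c d x. cm (c * d) x = cm c (cm d x)) \<and>
    (\<forall>x y a. act (x + y) a = act x a + act y a) \<and>
    (\<forall>x a b. act x (a + b) = act x a + act x b) \<and>
    (\<forall>x a b. act x (a * b) = act (act x a) b) \<and>
    (\<forall>c x a. act (cm c x) a = cm c (act x a)) \<and>
    (\<forall>c x a. act x (cs c a) = cm c (act x a)) \<and>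
    (\<forall>x y z. ip x (y + z) = ip x y + ip x z) \<and>
    (\<forall>c x y. ip x (cm c y) = cs c (ip x y)) \<and>
    (\<forall>x y a. ip x (act y a) = ip x y * a) \<and>
    (\<forall>x y. st (ip x y) = ip y x) \<and>
    (\<forall>x. positive_el st (ip x x)) \<and>
    (\<forall>x. ip x x = 0 \<longrightarrow> x = 0) \<and>
    (\<forall>x. norm x = sqrt (norm (ip x x)))"

(* countably generated: the closed span of G A is the whole module for a countable G.
   (span is the real span; the set {g a} is closed under complex scalars.) *)
definition countably_generated :: "('m::real_normed_vector \<Rightarrow> 'a \<Rightarrow> 'm) \<Rightarrow> bool"
  where "countably_generated act \<longleftrightarrow>
    (\<exists>G. countable G \<and> closure (span {act g a | g a. g \<in> G}) = UNIV)"

definition submod_ideal :: "('m::real_normed_vector \<Rightarrow> 'a \<Rightarrow> 'm) \<Rightarrow> 'a set \<Rightarrow> 'm set"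
  where "submod_ideal act I = closure (span {act m i | m i. i \<in> I})"

definition l2 :: "('a \<Rightarrow> 'a) \<Rightarrow> 'a::{real_normed_algebra,banach} set \<Rightarrow> (nat \<Rightarrow> 'a) set"
  where "l2 st I = {x. (\<forall>k. x k \<in> I) \<and> summable (\<lambda>k. st (x k) * x k)}"

definition l2_ip :: "('a \<Rightarrow> 'a) \<Rightarrow> (nat \<Rightarrow> 'a) \<Rightarrow> (nat \<Rightarrow> 'a) \<Rightarrow> 'a::{real_normed_algebra,banach}"
  where "l2_ip st x y = (\<Sum>k. st (x k) * y k)"

definition sum_ip :: "('m \<Rightarrow> 'm \<Rightarrow> 'a) \<Rightarrow> ('a \<Rightarrow> 'a) \<Rightarrow>
    'm \<times> (nat \<Rightarrow> 'a) \<Rightarrow> 'm \<times> (nat \<Rightarrow> 'a) \<Rightarrow> 'a::{real_normed_algebra,banach}"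
  where "sum_ip ip st p q = ip (fst p) (fst q) + l2_ip st (snd p) (snd q)"

definition unitary_op :: "'x set \<Rightarrow> ('x \<Rightarrow> 'x \<Rightarrow> 'b) \<Rightarrow> 'y set \<Rightarrow> ('y \<Rightarrow> 'y \<Rightarrow> 'b) \<Rightarrow>
    ('x \<Rightarrow> 'y) \<Rightarrow> bool"
  where "unitary_op X ipX Y ipY U \<longleftrightarrow> (\<forall>x\<in>X. U x \<in> Y) \<and>
    (\<exists>V. (\<forall>y\<in>Y. V y \<in> X) \<and> (\<forall>x\<in>X. \<forall>y\<in>Y. ipY (U x) y = ipX x (V y)) \<and>
         (\<forall>x\<in>X. V (U x) = x) \<and> (\<forall>y\<in>Y. U (V y) = y))"

definition qcoset :: "'m::plus set \<Rightarrow> 'm \<Rightarrow> 'm set"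
  where "qcoset S x = (\<lambda>y. x + y) ` S"

definition quot_carrier :: "'m::plus set \<Rightarrow> 'm set set"
  where "quot_carrier S = range (qcoset S)"

definition quot_ip :: "('m \<Rightarrow> 'm \<Rightarrow> 'a::plus) \<Rightarrow> 'a set \<Rightarrow> 'm set \<Rightarrow> 'm set \<Rightarrow> 'a set"
  where "quot_ip ip I u v = qcoset I (ip (SOME x. x \<in> u) (SOME y. y \<in> v))"

end

theory Submission
  imports Defs "HOL-Library.Function_Algebras"
begin

text \<open>
  The unitary is built by a back-and-forth construction. Two sequences \<open>u\<^sub>i\<close> in \<open>M \<oplus> l\<^sub>2(I)\<close> and
  \<open>v\<^sub>i\<close> in \<open>N \<oplus> l\<^sub>2(I)\<close> with equal Gram matrices \<open>\<langle>u\<^sub>i, u\<^sub>j\<rangle> = \<langle>v\<^sub>i, v\<^sub>j\<rangle>\<close>, matching under \<open>\<phi>\<close>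
  modulo \<open>I\<close> and each generating a dense submodule, determine a unitary inducing \<open>\<phi>\<close>. Given finitely many
  such pairs, one more is adjoined as follows, where \<open>e\<^sub>k\<close> is the approximate unit of \<open>I\<close>.
  A pair of generators \<open>m\<close>, \<open>n\<close> matching under \<open>\<phi>\<close> is replaced by \<open>m - m e\<^sub>k\<close>, \<open>n - n e\<^sub>k\<close>: the defects of
  the Gram matrices lie in \<open>I\<close>, hence become small for large \<open>k\<close>. A vector \<open>t\<close> with \<open>\<langle>t, t\<rangle> \<in> I\<close> is
  approximately projected to \<open>t' = \<Sum>\<^sub>i u\<^sub>i c\<^sub>i\<close>, so that \<open>\<langle>u\<^sub>i, t - t'\<rangle>\<close> is small and \<open>\<langle>t', t'\<rangle> \<le> \<langle>t, t\<rangle>\<close>, and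
  is matched with \<open>\<Sum>\<^sub>i v\<^sub>i c\<^sub>i\<close> plus a square root of \<open>\<langle>t, t\<rangle> - \<langle>t', t'\<rangle>\<close> in an unused coordinate of
  \<open>l\<^sub>2(I)\<close>. The remaining small defects are removed exactly by small perturbations in unused coordinates,
  and the perturbations of each vector are summable over the stages.
\<close>

text \<open>Everything is therefore done with inner products of finitely many vectors. Passing to
  \<open>m - m e_k\<close>, \<open>n - n e_k\<close> helps because a defect \<open>d\<close> in
  \<open>I\<close> turns into \<open>d (1 - e_k)\<close> or \<open>(1 - e_k) d (1 - e_k)\<close>,
  and both tend to 0. The part \<open>m e_k\<close> cut off in this way lies in \<open>M I\<close>
  and is asked for separately as a vector \<open>t\<close>. For such \<open>t\<close> the relation
  demands of the partner only that it lie in the ideal part, so the partner may be built freely; the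
  inequality between \<open>t'\<close> and \<open>t\<close> makes the remaining defect positive,
  which allows a square root. Gram matrices agree exactly at every stage because corrections lie in
  coordinates orthogonal to all vectors used before. A defect of norm
  \<open>\<epsilon>\<^sup>2\<close> costs vectors of norm at most \<open>2 * \<epsilon>\<close>: it
  is factored as an inner product of two small vectors.\<close>

section \<open>Positivity in unital C*-algebras\<close>

text \<open>The limit \<open>k\<close> satisfies \<open>(1 - k)\<^sup>2 = 1 - h\<close>; for \<open>\<parallel>h\<parallel> \<le> 1\<close> convergence follows by comparison with
  the scalar iteration at \<open>h = 1\<close>.\<close>
primrec sqrt_iter :: "'c::real_normed_algebra \<Rightarrow> nat \<Rightarrow> 'c" where
  "sqrt_iter h 0 = 0"
| "sqrt_iter h (Suc n) = (1/2) *\<^sub>R (h + sqrt_iter h n * sqrt_iter h n)"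

lemma sqrt_iter_one_bounds: "0 \<le> sqrt_iter (1::real) n \<and> sqrt_iter (1::real) n \<le> 1"
proof (induction n)
  case (Suc n)
  then have "sqrt_iter (1::real) n * sqrt_iter 1 n \<le> 1 * 1" by (intro mult_mono) auto
  then show ?case using Suc by auto
qed simp

lemma sqrt_iter_one_mono: "sqrt_iter (1::real) n \<le> sqrt_iter 1 (Suc n)"
proof -
  have "0 \<le> (1 - sqrt_iter (1::real) n)^2" by simp
  then show ?thesis by (simp add: power2_eq_square algebra_simps)
qed

lemma sqrt_iter_one_tendsto: "sqrt_iter (1::real) \<longlonglongrightarrow> 1"
proof -
  have "incseq (sqrt_iter (1::real))"
    by (rule incseq_SucI) (rule sqrt_iter_one_mono)
  then obtain l where l: "sqrt_iter (1::real) \<longlonglongrightarrow> l"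
    using incseq_convergent[of "sqrt_iter (1::real)" 1] sqrt_iter_one_bounds by blast
  have "(\<lambda>n. sqrt_iter (1::real) (Suc n)) \<longlonglongrightarrow> (1/2) * (1 + l * l)"
    by (simp del: distrib_left_numeral) (intro tendsto_intros l, simp)
  moreover have "(\<lambda>n. sqrt_iter (1::real) (Suc n)) \<longlonglongrightarrow> l" using l by (rule LIMSEQ_Suc)
  ultimately have "(1/2) * (1 + l * l) = l" by (rule LIMSEQ_unique)
  then have "(l - 1)^2 = 0" by (simp add: power2_eq_square algebra_simps)
  then show ?thesis using l by simp
qed

lemma norm_sqrt_iter:
  fixes h :: "'c::real_normed_algebra"
  assumes "norm h \<le> 1"
  shows "norm (sqrt_iter h n) \<le> sqrt_iter 1 n"
proof (induction n)
  case (Suc n)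
  have "norm (h + sqrt_iter h n * sqrt_iter h n) \<le> norm h + norm (sqrt_iter h n * sqrt_iter h n)"
    by (rule norm_triangle_ineq)
  also have "\<dots> \<le> 1 + norm (sqrt_iter h n) * norm (sqrt_iter h n)"
    using assms norm_mult_ineq by (rule add_mono)
  also have "\<dots> \<le> 1 + sqrt_iter 1 n * sqrt_iter 1 n"
    using Suc sqrt_iter_one_bounds[of n] by (intro add_mono mult_mono) auto
  finally show ?case by simp
qed simp

lemma norm_sqrt_iter_diff:
  fixes h :: "'c::real_normed_algebra"
  assumes "norm h \<le> 1"
  shows "norm (sqrt_iter h (Suc n) - sqrt_iter h n) \<le> sqrt_iter 1 (Suc n) - sqrt_iter 1 n"
proof (induction n)
  case 0
  then show ?case using assms by simp
next
  case (Suc n)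
  let ?k = "sqrt_iter h" and ?t = "sqrt_iter (1::real)"
  \<comment> \<open>Without commutativity, \<open>x * x - y * y = x * (x - y) + (x - y) * y\<close>;
    each factor is bounded by its scalar counterpart.\<close>
  have "?k (Suc (Suc n)) - ?k (Suc n)
      = (1/2) *\<^sub>R (?k (Suc n) * (?k (Suc n) - ?k n) + (?k (Suc n) - ?k n) * ?k n)"
    by (subst (1 3) sqrt_iter.simps(2)) (simp only: algebra_simps scaleR_diff_right[symmetric], simp add: algebra_simps)
  also have "norm \<dots> \<le> (1/2) * (norm (?k (Suc n)) * norm (?k (Suc n) - ?k n)
        + norm (?k (Suc n) - ?k n) * norm (?k n))"
    unfolding norm_scaleR
    by (rule mult_mono[OF _ norm_triangle_mono[OF norm_mult_ineq norm_mult_ineq]]) simp_all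
  also have "\<dots> \<le> (1/2) * (?t (Suc n) * (?t (Suc n) - ?t n) + (?t (Suc n) - ?t n) * ?t n)"
  proof -
    have "norm (?k (Suc n)) * norm (?k (Suc n) - ?k n) \<le> ?t (Suc n) * (?t (Suc n) - ?t n)"
      by (rule mult_mono[OF norm_sqrt_iter[OF assms] Suc])
         (use sqrt_iter_one_bounds[of "Suc n"] in simp_all)
    moreover have "norm (?k (Suc n) - ?k n) * norm (?k n) \<le> (?t (Suc n) - ?t n) * ?t n"
      by (rule mult_mono[OF Suc norm_sqrt_iter[OF assms]])
         (use sqrt_iter_one_mono[of n] in simp_all)
    ultimately show ?thesis by (intro mult_left_mono add_mono) simp_all
  qed
  also have "\<dots> = ?t (Suc (Suc n)) - ?t (Suc n)"
    unfolding sqrt_iter.simps(2)[of 1 "Suc n"] by (simp add: field_simps)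
  finally show ?case .
qed

text \<open>The increments are dominated by those of the convergent scalar sequence, hence summable.
  The iterates are polynomials in \<open>h\<close>, so whatever commutes with \<open>h\<close>
  commutes with \<open>k\<close>.\<close>

lemma sqrt_iter_limit:
  fixes h :: "'c::{real_normed_algebra,banach}"
  assumes "norm h \<le> 1"
  obtains k where "sqrt_iter h \<longlonglongrightarrow> k" "k + k - k * k = h" "norm k \<le> 1"
    "\<And>z. z * h = h * z \<Longrightarrow> z * k = k * z"
proof -
  have "summable (\<lambda>n. sqrt_iter (1::real) (Suc n) - sqrt_iter 1 n)"
    by (rule telescope_summable[OF sqrt_iter_one_tendsto])
  then have "summable (\<lambda>n. sqrt_iter h (Suc n) - sqrt_iter h n)"
    by (rule summable_comparison_test'[where N=0]) (rule norm_sqrt_iter_diff[OF assms])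
  then obtain k where "(\<lambda>n. sqrt_iter h (Suc n) - sqrt_iter h n) sums k"
    by (auto simp: summable_def)
  then have k: "sqrt_iter h \<longlonglongrightarrow> k"
    by (simp add: sums_def sum_lessThan_telescope del: sqrt_iter.simps(2))
  have "(\<lambda>n. sqrt_iter h (Suc n)) \<longlonglongrightarrow> (1/2) *\<^sub>R (h + k * k)"
    by simp (intro tendsto_intros k)
  with LIMSEQ_Suc[OF k] have "(1/2) *\<^sub>R (h + k * k) = k"
    using LIMSEQ_unique by blast
  then have "2 *\<^sub>R ((1/2) *\<^sub>R (h + k * k)) = 2 *\<^sub>R k" by simp
  then have "h + k * k = k + k" by (simp add: scaleR_2)
  then have *: "k + k - k * k = h" by (simp add: algebra_simps)
  have "norm k \<le> 1"
    using k norm_sqrt_iter[OF assms] sqrt_iter_one_bounds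
    by (intro Lim_bounded[OF tendsto_norm[OF k], of 0]) (metis order_trans)
  moreover have "z * k = k * z" if z: "z * h = h * z" for z
  proof -
    have "z * sqrt_iter h n = sqrt_iter h n * z" for n
      by (induction n) (use z in \<open>simp_all add: algebra_simps\<close>, metis mult.assoc)
    moreover have "(\<lambda>n. z * sqrt_iter h n) \<longlonglongrightarrow> z * k" "(\<lambda>n. sqrt_iter h n * z) \<longlonglongrightarrow> k * z"
      by (intro tendsto_intros k)+
    ultimately show ?thesis using LIMSEQ_unique by auto
  qed
  ultimately show ?thesis using that k * by blast
qed

locale unital_cstar =
  fixes L :: "'b::{real_normed_algebra,monoid_mult,banach} set"
    and star :: "'b \<Rightarrow> 'b" and im :: 'b
  assumes closed_L: "closed L" and one_L: "1 \<in> L" and im_L: "im \<in> L"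
    and add_L: "\<And>a b. a \<in> L \<Longrightarrow> b \<in> L \<Longrightarrow> a + b \<in> L"
    and mult_L: "\<And>a b. a \<in> L \<Longrightarrow> b \<in> L \<Longrightarrow> a * b \<in> L"
    and scale_L: "\<And>r a. a \<in> L \<Longrightarrow> r *\<^sub>R a \<in> L"
    and star_L: "\<And>a. a \<in> L \<Longrightarrow> star a \<in> L"
    and star_star: "\<And>a. a \<in> L \<Longrightarrow> star (star a) = a"
    and star_add: "\<And>a b. a \<in> L \<Longrightarrow> b \<in> L \<Longrightarrow> star (a + b) = star a + star b"
    and star_mult: "\<And>a b. a \<in> L \<Longrightarrow> b \<in> L \<Longrightarrow> star (a * b) = star b * star a"
    and star_scale: "\<And>r a. a \<in> L \<Longrightarrow> star (r *\<^sub>R a) = r *\<^sub>R star a"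
    and im_sq: "im * im = - 1" and star_im: "star im = - im"
    and im_comm: "\<And>a. a \<in> L \<Longrightarrow> im * a = a * im"
    and cstar_id: "\<And>a. a \<in> L \<Longrightarrow> norm (star a * a) = (norm a)\<^sup>2"
begin

lemma minus_L: "a \<in> L \<Longrightarrow> - a \<in> L"
  using scale_L[of a "-1"] by simp

lemma diff_L: "a \<in> L \<Longrightarrow> b \<in> L \<Longrightarrow> a - b \<in> L"
  using add_L[OF _ minus_L, of a b] by simp

lemma star_minus: "a \<in> L \<Longrightarrow> star (- a) = - star a"
  using star_scale[of a "-1"] by simp

lemma star_diff: "a \<in> L \<Longrightarrow> b \<in> L \<Longrightarrow> star (a - b) = star a - star b"
  using star_add[OF _ minus_L, of a b] by (simp add: star_minus)

lemma star_one: "star 1 = 1"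
  by (metis mult_1_left mult_1_right one_L star_L star_mult star_star)

lemma norm_one_le: "norm (1::'b) \<le> 1"
  using cstar_id[OF one_L] by (auto simp: star_one power2_eq_square)

lemma norm_star: assumes "a \<in> L" shows "norm (star a) = norm a"
proof -
  have *: "norm a \<le> norm (star a)" if "a \<in> L" for a
  proof (cases "norm a = 0")
    case False
    have "norm a * norm a \<le> norm (star a) * norm a"
      using cstar_id[OF that] norm_mult_ineq[of "star a" a] by (simp add: power2_eq_square)
    then show ?thesis using False by simp
  qed simp
  show ?thesis using *[OF assms] *[OF star_L[OF assms]] star_star[OF assms] by simp
qed

lemma tendsto_star:
  assumes "\<And>n. f n \<in> L" "f \<longlonglongrightarrow> a"
  shows "(\<lambda>n. star (f n)) \<longlonglongrightarrow> star a"
proof -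
  have a: "a \<in> L" using closed_L assms closed_sequentially by blast
  have "(\<lambda>n. norm (f n - a)) \<longlonglongrightarrow> 0" using assms(2) by (simp add: LIM_zero tendsto_norm_zero)
  moreover have "norm (f n - a) = norm (star (f n) - star a)" for n
    using norm_star[OF diff_L[OF assms(1) a]] star_diff[OF assms(1) a] by simp
  ultimately show ?thesis by (simp add: LIM_zero_iff tendsto_norm_zero_iff)
qed

lemma sqrt_iter_L: assumes "h \<in> L" "star h = h"
  shows "sqrt_iter h n \<in> L \<and> star (sqrt_iter h n) = sqrt_iter h n"
  by (induction n)
     (use assms scale_L[of 0 0] star_scale[of 1 0] one_L scale_L[of 1 0] in
       \<open>auto simp: scale_L add_L mult_L star_scale star_add star_mult\<close>)

text \<open>The root is \<open>1 - k\<close>. The bound on \<open>1 - q\<close> certifies its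
  positivity in the sense of \<open>Pos\<close> below, and the explicit sequence later locates the
  root in a subalgebra without unit.\<close>

lemma sa_sqrt_one_minus:
  assumes "h \<in> L" "star h = h" "norm h \<le> 1"
  obtains q where "q \<in> L" "star q = q" "q * q = 1 - h" "norm (1 - q) \<le> 1"
    "\<And>z. z * h = h * z \<Longrightarrow> z * q = q * z"
    "(\<lambda>n. 1 - sqrt_iter h n) \<longlonglongrightarrow> q"
proof -
  obtain k where k: "sqrt_iter h \<longlonglongrightarrow> k" "k + k - k * k = h" "norm k \<le> 1"
    "\<And>z. z * h = h * z \<Longrightarrow> z * k = k * z" using sqrt_iter_limit[OF assms(3)] by blast
  note it = sqrt_iter_L[OF assms(1,2)]
  have kL: "k \<in> L" using closed_L it k(1) closed_sequentially by blast
  have "sqrt_iter h \<longlonglongrightarrow> star k"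
    using tendsto_star[OF conjunct1[OF it] k(1)] it by simp
  then have "star k = k" using k(1) LIMSEQ_unique by blast
  then show ?thesis
  proof (intro that[of "1 - k"])
    show "(1 - k) * (1 - k) = 1 - h" using k(2) by (simp add: algebra_simps)
    show "(\<lambda>n. 1 - sqrt_iter h n) \<longlonglongrightarrow> 1 - k" by (intro tendsto_intros k)
    show "z * (1 - k) = (1 - k) * z" if "z * h = h * z" for z
      using k(4)[OF that] by (simp add: algebra_simps)
  qed (use k(3) kL one_L in \<open>auto simp: diff_L star_diff star_one\<close>)
qed

text \<open>Set \<open>u = p + im * q\<close>. Commutation gives
  \<open>star u * u = p * p + q * q\<close>, so the C*-identity bounds \<open>u\<close>, and
  \<open>p\<close> is the real part of \<open>u\<close>. This does the work of a functional calculus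
  for commuting elements.\<close>

lemma commuting_squares_norm:
  assumes "p \<in> L" "star p = p" "q \<in> L" "star q = q" "p * q = q * p"
    and "p * p + q * q = c *\<^sub>R 1" "c \<ge> 0"
  shows "(norm p)\<^sup>2 \<le> c"
proof -
  define u where "u = p + im * q"
  have iq: "im * q \<in> L" "im * q = q * im" using assms im_L im_comm mult_L by auto
  have ip: "im * p = p * im" using assms im_comm by auto
  have uL: "u \<in> L" using assms iq add_L unfolding u_def by blast
  have su: "star u = p - im * q"
    unfolding u_def using assms iq by (simp add: star_add star_mult im_L star_im)
  have "im * q * (im * q) = im * im * (q * q)" using iq by (metis mult.assoc)
  then have e: "im * q * (im * q) = - (q * q)" using im_sq by simp
  have "p * (im * q) = im * (p * q)" "im * q * p = im * (p * q)"
    using ip assms(5) by (metis mult.assoc)+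
  then have "star u * u = p * p + q * q"
    unfolding su unfolding u_def using e by (simp add: algebra_simps)
  then have "(norm u)\<^sup>2 = norm (c *\<^sub>R (1::'b))" using cstar_id[OF uL] assms by simp
  also have "\<dots> \<le> c" using norm_one_le assms(7) mult_left_mono[of "norm (1::'b)" 1 c] by simp
  finally have u: "(norm u)\<^sup>2 \<le> c" .
  have "2 *\<^sub>R p = u + star u" unfolding su by (simp add: u_def scaleR_2)
  then have "2 * norm p \<le> norm u + norm (star u)" 
    by (metis norm_scaleR norm_triangle_ineq abs_numeral)
  then have "norm p \<le> norm u" using norm_star[OF uL] by simp
  then show ?thesis using u by (meson norm_ge_zero order_trans power_mono)
qed

text \<open>Positivity without a spectrum: for selfadjoint \<open>a\<close> the norm condition says
  that the spectrum lies between 0 and \<open>2 * t\<close>. In this form sums of positive elements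
  are positive by the triangle inequality.\<close>

definition Pos :: "'b \<Rightarrow> bool" where
  "Pos a \<longleftrightarrow> a \<in> L \<and> star a = a \<and> (\<exists>t\<ge>0. norm (t *\<^sub>R 1 - a) \<le> t)"

lemma PosD: "Pos a \<Longrightarrow> a \<in> L" "Pos a \<Longrightarrow> star a = a"
  unfolding Pos_def by auto

lemma Pos_add: assumes "Pos a" "Pos b" shows "Pos (a + b)"
proof -
  obtain s t where st: "s \<ge> 0" "norm (s *\<^sub>R 1 - a) \<le> s" "t \<ge> 0" "norm (t *\<^sub>R 1 - b) \<le> t"
    using assms unfolding Pos_def by blast
  have "(s + t) *\<^sub>R 1 - (a + b) = (s *\<^sub>R 1 - a) + (t *\<^sub>R 1 - b)" by (simp add: algebra_simps)
  then have "norm ((s + t) *\<^sub>R 1 - (a + b)) \<le> s + t" using st norm_triangle_mono by metis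
  then show ?thesis using assms st unfolding Pos_def by (auto simp: add_L star_add intro!: exI[of _ "s + t"])
qed

lemma Pos_sqrt:
  assumes "Pos a"
  obtains p where "Pos p" "p * p = a" "\<And>z. z * a = a * z \<Longrightarrow> z * p = p * z"
proof -
  have aL: "a \<in> L" "star a = a" using assms unfolding Pos_def by auto
  obtain t where t: "t \<ge> 0" "norm (t *\<^sub>R 1 - a) \<le> t" using assms unfolding Pos_def by blast
  show ?thesis
  proof (cases "t = 0")
    case True
    then have "a = 0" using t by simp
    then show ?thesis using that[of 0] assms by auto
  next
    case False
    then have tp: "t > 0" using t by simp
    define h where "h = 1 - (1/t) *\<^sub>R a"
    have "h = (1/t) *\<^sub>R (t *\<^sub>R 1 - a)" using False unfolding h_def by (simp add: scaleR_diff_right)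
    then have "norm h \<le> 1" using t tp by (simp add: divide_le_eq)
    moreover have "h \<in> L" "star h = h"
      unfolding h_def using aL one_L by (auto simp: diff_L scale_L star_diff star_scale star_one)
    ultimately obtain q where q: "q \<in> L" "star q = q" "q * q = 1 - h" "norm (1 - q) \<le> 1"
      "\<And>z. z * h = h * z \<Longrightarrow> z * q = q * z" using sa_sqrt_one_minus by metis
    show ?thesis
    proof (rule that[of "sqrt t *\<^sub>R q"])
      have "sqrt t *\<^sub>R 1 - sqrt t *\<^sub>R q = sqrt t *\<^sub>R (1 - q)" by (simp add: scaleR_diff_right)
      then have "norm (sqrt t *\<^sub>R 1 - sqrt t *\<^sub>R q) \<le> sqrt t" using q(4) tp by simp
      then show "Pos (sqrt t *\<^sub>R q)" using q(1,2) tp unfolding Pos_def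
        by (auto simp: scale_L star_scale intro!: exI[of _ "sqrt t"])
      show "sqrt t *\<^sub>R q * sqrt t *\<^sub>R q = a" using q(3) tp unfolding h_def by simp
      fix z assume "z * a = a * z"
      then have "z * h = h * z" unfolding h_def by (simp add: algebra_simps)
      then show "z * (sqrt t *\<^sub>R q) = sqrt t *\<^sub>R q * z" using q(5) by simp
    qed
  qed
qed

text \<open>The root \<open>r\<close> of \<open>t - p * p\<close> commutes with \<open>p\<close>,
  and \<open>r * r + p * p = t\<close>; \<open>commuting_squares_norm\<close> then bounds
  \<open>r\<close>.\<close>

lemma sa_square_bound:
  assumes "p \<in> L" "star p = p" "t > 0" "(norm p)\<^sup>2 \<le> t"
  shows "norm (t *\<^sub>R 1 - p * p) \<le> t"
proof -
  define h where "h = (1/t) *\<^sub>R (p * p)"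
  have "norm (p * p) \<le> t" using assms norm_mult_ineq[of p p] by (simp add: power2_eq_square)
  then have "norm h \<le> 1" unfolding h_def using assms by (simp add: divide_le_eq)
  moreover have "h \<in> L" "star h = h" unfolding h_def using assms
    by (auto simp: scale_L mult_L star_scale star_mult)
  ultimately obtain q where q: "q \<in> L" "star q = q" "q * q = 1 - h"
      "\<And>z. z * h = h * z \<Longrightarrow> z * q = q * z" using sa_sqrt_one_minus by metis
  define r where "r = sqrt t *\<^sub>R q"
  have ph: "p * h = h * p" unfolding h_def by (simp add: mult.assoc)
  have rr: "r * r = t *\<^sub>R 1 - p * p" unfolding r_def using q(3) assms(3)
    by (simp add: h_def scaleR_diff_right)
  have "(norm r)\<^sup>2 \<le> t"
    by (rule commuting_squares_norm[of r p])
       (use q(1,2) assms rr q(4)[OF ph] in \<open>auto simp: r_def scale_L star_scale\<close>)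
  then show ?thesis using rr norm_mult_ineq[of r r] by (simp add: power2_eq_square)
qed

lemma Pos_square: assumes "p \<in> L" "star p = p" shows "Pos (p * p)"
  unfolding Pos_def
\<comment> \<open>The summand 1 provides the strict positivity that \<open>sa_square_bound\<close>
  requires when \<open>p = 0\<close>.\<close>
proof (intro conjI exI[of _ "(norm p)\<^sup>2 + 1"])
  show "norm (((norm p)\<^sup>2 + 1) *\<^sub>R 1 - p * p) \<le> (norm p)\<^sup>2 + 1"
    by (rule sa_square_bound) (use assms in \<open>auto intro: add_nonneg_pos\<close>)
qed (use assms in \<open>auto simp: mult_L star_mult\<close>)

lemma Pos_scale: assumes "Pos a" "c \<ge> 0" shows "Pos (c *\<^sub>R a)"
proof -
  obtain t where t: "t \<ge> 0" "norm (t *\<^sub>R 1 - a) \<le> t" using assms unfolding Pos_def by blast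
  have "(c * t) *\<^sub>R 1 - c *\<^sub>R a = c *\<^sub>R (t *\<^sub>R 1 - a)" by (simp add: scaleR_diff_right)
  then have "norm ((c * t) *\<^sub>R 1 - c *\<^sub>R a) \<le> c * t" using t assms mult_left_mono by auto
  then show ?thesis using assms t unfolding Pos_def by (auto simp: scale_L star_scale intro!: exI[of _ "c * t"])
qed

text \<open>A positive \<open>a\<close> is a square \<open>p * p\<close>, so the condition in
  \<open>Pos\<close> holds for every positive \<open>t\<close> from the norm of \<open>a\<close>
  upwards. Such a uniform \<open>t\<close> is what survives a limit in
  \<open>Pos_limit\<close>.\<close>

lemma Pos_imp_bound: assumes "Pos a" "norm a \<le> t" "t > 0" shows "norm (t *\<^sub>R 1 - a) \<le> t"
proof -
  obtain p where p: "Pos p" "p * p = a" using Pos_sqrt[OF assms(1)] by metis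
  then have "(norm p)\<^sup>2 = norm a" using cstar_id[of p] unfolding Pos_def by auto
  then show ?thesis using sa_square_bound[of p t] p assms unfolding Pos_def by auto
qed

lemma Pos_limit:
  assumes "\<And>n. Pos (f n)" "f \<longlonglongrightarrow> a" shows "Pos a"
proof -
  have fL: "\<And>n. f n \<in> L" "\<And>n. star (f n) = f n" using assms(1) PosD by auto
  have "a \<in> L" using closed_L assms fL closed_sequentially by blast
  moreover have "star a = a" using tendsto_star[OF fL(1) assms(2)] LIMSEQ_unique[OF _ assms(2)] unfolding fL(2) by blast
  moreover have "norm ((norm a + 1) *\<^sub>R 1 - a) \<le> norm a + 1"
  proof -
    have "\<forall>\<^sub>F n in sequentially. norm (f n) < norm a + 1"
      by (rule order_tendstoD(2)[OF tendsto_norm[OF assms(2)]]) simp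
    then have "\<forall>\<^sub>F n in sequentially. norm ((norm a + 1) *\<^sub>R 1 - f n) \<le> norm a + 1"
      by (rule eventually_mono)
         (rule Pos_imp_bound[OF assms(1)], auto intro: add_nonneg_pos)
    moreover have "(\<lambda>n. norm ((norm a + 1) *\<^sub>R 1 - f n)) \<longlonglongrightarrow> norm ((norm a + 1) *\<^sub>R 1 - a)"
      by (intro tendsto_intros assms)
    ultimately show ?thesis using tendsto_upperbound by (metis trivial_limit_sequentially)
  qed
  ultimately show ?thesis unfolding Pos_def by (auto intro!: exI[of _ "norm a + 1"])
qed

lemma Pos_norm_minus: assumes "a \<in> L" "star a = a" "norm a \<le> c" shows "Pos (c *\<^sub>R 1 - a)"
  unfolding Pos_def using assms one_L order_trans[OF norm_ge_zero assms(3)]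
  by (auto simp: diff_L scale_L star_diff star_scale star_one intro!: exI[of _ c])

text \<open>With \<open>c = norm (a + b)\<close> both \<open>a\<close> and \<open>c - a\<close> are
  positive. Their roots commute and the squares of the roots add up to \<open>c\<close>, so
  \<open>commuting_squares_norm\<close> applies.\<close>

lemma Pos_norm_mono: assumes "Pos a" "Pos b" shows "norm a \<le> norm (a + b)"
proof -
  define c where "c = norm (a + b)"
  have "Pos (c *\<^sub>R 1 - (a + b))"
    using Pos_add[OF assms] unfolding c_def by (intro Pos_norm_minus) (auto simp: Pos_def)
  then have "Pos ((c *\<^sub>R 1 - (a + b)) + b)" using assms Pos_add by blast
  then have "Pos (c *\<^sub>R 1 - a)" by (simp add: algebra_simps)
  then obtain q where q: "Pos q" "q * q = c *\<^sub>R 1 - a"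
    "\<And>z. z * (c *\<^sub>R 1 - a) = (c *\<^sub>R 1 - a) * z \<Longrightarrow> z * q = q * z" using Pos_sqrt by metis
  obtain p where p: "Pos p" "p * p = a" using Pos_sqrt[OF assms(1)] by metis
  have "p * (c *\<^sub>R 1 - a) = (c *\<^sub>R 1 - a) * p" using p(2) by (simp add: algebra_simps flip: p(2))
  then have "(norm p)\<^sup>2 \<le> c"
    using p(2) q(2) q(3)[of p] PosD[OF p(1)] PosD[OF q(1)]
    by (intro commuting_squares_norm[of p q]) (auto simp: c_def)
  then show ?thesis using p(2) norm_mult_ineq[of p p] unfolding c_def by (simp add: power2_eq_square)
qed

section \<open>Positivity of \<open>star b * b\<close>\<close>

lemma sa_power: assumes "a \<in> L" "star a = a" shows "a ^ n \<in> L \<and> star (a ^ n) = a ^ n"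
  by (induction n) (use assms one_L star_one in \<open>auto simp: mult_L star_mult power_commutes\<close>)

lemma norm_power_two: assumes "a \<in> L" "star a = a" shows "norm (a ^ (2 ^ k)) = norm a ^ (2 ^ k)"
proof (induction k)
  case (Suc k)
  let ?b = "a ^ (2 ^ k)"
  have "norm (?b * ?b) = (norm ?b)\<^sup>2" using cstar_id[of ?b] sa_power[OF assms] by simp
  then show ?case using Suc by (simp add: power_mult mult.commute power2_eq_square flip: power_add mult_2)
qed simp

text \<open>Up to zero, \<open>d\<^sup>* d\<close> and \<open>d d\<^sup>*\<close> have the same spectrum; here this is read off the growth of powers.\<close>
lemma norm_minus_star_mult_swap:
  assumes "d \<in> L" "T > 0" and le: "norm (T *\<^sub>R 1 - d * star d) \<le> T"
  shows "norm (T *\<^sub>R 1 - star d * d) \<le> T"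
proof (rule ccontr)
  define y where "y = T *\<^sub>R 1 - star d * d"
  define z where "z = T *\<^sub>R 1 - d * star d"
  define C where "C = norm d * norm d"
  assume "\<not> ?thesis"
  then have gt: "norm y > T" unfolding y_def by simp
  have sd: "star d \<in> L" "norm (star d) = norm d" using assms star_L norm_star by auto
  have ysa: "y \<in> L" "star y = y" unfolding y_def using assms one_L sd
    by (auto simp: diff_L scale_L mult_L star_diff star_scale star_one star_mult star_star)
  \<comment> \<open>\<open>star d\<close> intertwines \<open>y\<close> and \<open>z\<close>, which
    transfers the growth of \<open>z ^ n\<close> to \<open>y ^ n\<close> up to a linear
    factor.\<close>
  have comm: "y ^ n * star d = star d * z ^ n" for n
  proof (induction n)
    case (Suc n)
    have "y * star d = star d * z" unfolding y_def z_def by (simp add: algebra_simps mult.assoc)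
    then show ?case using Suc by (simp add: mult.assoc) (metis mult.assoc power_commutes)
  qed simp
  have zn: "norm (z ^ n) \<le> T ^ n" for n
  proof (induction n)
    case 0 then show ?case using norm_one_le by simp
  next
    case (Suc n)
    have "norm (z ^ Suc n) \<le> norm z * norm (z ^ n)" by (simp add: norm_mult_ineq)
    also have "\<dots> \<le> T * T ^ n" using Suc le assms(2) unfolding z_def by (intro mult_mono) auto
    finally show ?case by simp
  qed
  have yd: "norm (y ^ n * (star d * d)) \<le> C * T ^ n" for n
  proof -
    have "norm (y ^ n * (star d * d)) = norm (star d * z ^ n * d)" using comm by (metis mult.assoc)
    also have "\<dots> \<le> norm (star d * z ^ n) * norm d" by (rule norm_mult_ineq)
    also have "\<dots> \<le> (norm (star d) * norm (z ^ n)) * norm d"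
      by (intro mult_right_mono norm_mult_ineq) simp
    also have "\<dots> \<le> (norm d * T ^ n) * norm d"
      unfolding sd(2) by (intro mult_right_mono mult_left_mono zn) auto
    finally show ?thesis unfolding C_def by (simp add: mult_ac)
  qed
  have yn: "norm (y ^ n) \<le> T ^ n * (1 + n * (C / T))" for n
  proof (induction n)
    case 0 then show ?case using norm_one_le by simp
  next
    case (Suc n)
    have "y ^ Suc n = T *\<^sub>R y ^ n - y ^ n * (star d * d)"
      by (subst power_Suc2, subst (2) y_def) (simp add: algebra_simps)
    then have "norm (y ^ Suc n) \<le> norm (T *\<^sub>R y ^ n) + norm (y ^ n * (star d * d))"
      by (metis norm_triangle_ineq4)
    also have "\<dots> \<le> T * (T ^ n * (1 + n * (C / T))) + C * T ^ n"
      using Suc yd[of n] assms(2) by (intro add_mono) auto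
    also have "\<dots> = T ^ Suc n * (1 + Suc n * (C / T))"
      using assms(2) by (simp add: field_simps)
    finally show ?case .
  qed
  \<comment> \<open>If \<open>\<rho> > 1\<close>, the powers \<open>\<rho> ^ (2 ^ k)\<close> outgrow
    every linear function of \<open>2 ^ k\<close>. At the exponents \<open>2 ^ k\<close> the norm of
    a power of a selfadjoint element equals the power of its norm.\<close>
  define \<rho> where "\<rho> = norm y / T"
  have \<rho>: "\<rho> > 1" unfolding \<rho>_def using gt assms(2) by simp
  have bd: "\<rho> ^ (2 ^ k) \<le> 1 + 2 ^ k * (C / T)" for k
  proof -
    have "norm y ^ (2 ^ k) \<le> T ^ (2 ^ k) * (1 + 2 ^ k * (C / T))"
      using yn[of "2 ^ k"] norm_power_two[OF ysa] by simp
    then show ?thesis unfolding \<rho>_def using assms(2) by (simp add: power_divide divide_le_eq mult.commute)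
  qed
  have "(\<lambda>n. real n / \<rho> ^ n) \<longlonglongrightarrow> 0"
  proof -
    have "(\<lambda>n. of_nat n * (1 / \<rho>) ^ n) \<longlonglongrightarrow> (0::real)"
      by (rule powser_times_n_limit_0) (use \<rho> in simp)
    then show ?thesis by (simp add: power_divide)
  qed
  moreover have "(\<lambda>n. 1 / \<rho> ^ n) \<longlonglongrightarrow> 0"
    using LIMSEQ_inverse_realpow_zero[OF \<rho>] by (simp add: inverse_eq_divide)
  ultimately have "(\<lambda>n. 1 / \<rho> ^ n + (C / T) * (real n / \<rho> ^ n)) \<longlonglongrightarrow> 0 + (C / T) * 0"
    by (intro tendsto_intros)
  then have "\<forall>\<^sub>F n in sequentially. 1 / \<rho> ^ n + (C / T) * (real n / \<rho> ^ n) < 1"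
    by (intro order_tendstoD(2)) auto
  then obtain N where N: "\<And>n. n \<ge> N \<Longrightarrow> 1 / \<rho> ^ n + (C / T) * (real n / \<rho> ^ n) < 1"
    unfolding eventually_sequentially by blast
  have "(N::nat) \<le> 2 ^ N" using less_exp[of N] by simp
  from N[OF this] have "1 + 2 ^ N * (C / T) < \<rho> ^ (2 ^ N)"
    using \<rho> by (simp add: field_simps)
  then show False using bd[of N] by simp
qed

lemma sa_square_zero: assumes "a \<in> L" "star a = a" "a * a = 0" shows "a = 0"
  using cstar_id[of a] assms by simp

text \<open>Split \<open>d\<close> into selfadjoint parts, \<open>d = x - im * y\<close>; the cross
  terms cancel when the two orders of the product are added.\<close>

lemma star_add_self: 
  assumes "d \<in> L"
  obtains x y where "x \<in> L" "star x = x" "y \<in> L" "star y = y"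
    "star d * d + d * star d = 2 *\<^sub>R (x * x + y * y)"
proof -
  define x y where "x = (1/2) *\<^sub>R (d + star d)" and "y = (1/2) *\<^sub>R (im * (d - star d))"
  have sd: "star d \<in> L" "star (star d) = d" using assms star_L star_star by auto
  have c: "im * (d - star d) = (d - star d) * im" using im_comm diff_L assms sd by blast
  have dd: "d - star d \<in> L" "star (d - star d) = star d - d" using sd assms by (auto simp: diff_L star_diff)
  have "star (im * (d - star d)) = (star d - d) * (- im)"
    using dd im_L by (simp add: star_mult star_im)
  also have "\<dots> = im * (d - star d)" using c by (simp add: algebra_simps)
  finally have sy: "star (im * (d - star d)) = im * (d - star d)" .
  have yL: "im * (d - star d) \<in> L" using dd im_L mult_L by blast
  show ?thesis
  proof (rule that[of x y])
    show "x \<in> L" "star x = x" "y \<in> L" "star y = y"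
      unfolding x_def y_def using assms sd sy yL
      by (auto simp: scale_L add_L star_scale star_add add.commute)
    have "im * (d - star d) * (im * (d - star d)) = im * im * ((d - star d) * (d - star d))"
      using c by (metis mult.assoc)
    then have "y * y = - (1/4) *\<^sub>R ((d - star d) * (d - star d))" unfolding y_def using im_sq by simp
    moreover have "x * x = (1/4) *\<^sub>R ((d + star d) * (d + star d))" unfolding x_def by simp
    ultimately have "2 *\<^sub>R (x * x + y * y)
        = (1/2) *\<^sub>R ((d + star d) * (d + star d) - (d - star d) * (d - star d))"
      by (simp add: scaleR_add_right scaleR_diff_right)
    also have "(d + star d) * (d + star d) - (d - star d) * (d - star d)
        = 2 *\<^sub>R (star d * d + d * star d)" by (simp add: algebra_simps scaleR_2)
    finally show "star d * d + d * star d = 2 *\<^sub>R (x * x + y * y)" by simp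
  qed
qed

text \<open>By \<open>star_add_self\<close>, \<open>d * star d\<close> is a sum of squares, hence
  positive, and \<open>norm_minus_star_mult_swap\<close> carries this over to
  \<open>star d * d\<close>. Then \<open>v * v\<close> and its negative are both positive, which
  forces them to vanish.\<close>

lemma star_mult_self_neg_square:
  assumes "d \<in> L" "v \<in> L" "star v = v" "star d * d = - (v * v)"
  shows "d = 0"
proof -
  obtain x y where xy: "x \<in> L" "star x = x" "y \<in> L" "star y = y"
    "star d * d + d * star d = 2 *\<^sub>R (x * x + y * y)" using star_add_self[OF assms(1)] by metis
  have "d * star d = 2 *\<^sub>R (x * x + y * y) + v * v"
    using xy(5) assms(4) by (simp add: algebra_simps eq_diff_eq)
  then have P: "Pos (d * star d)"
    using Pos_add[OF Pos_scale[OF Pos_add[OF Pos_square Pos_square]] Pos_square] xy assms by simp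
  define T where "T = norm (d * star d) + 1"
  have T: "T > 0" unfolding T_def by (auto intro: add_nonneg_pos)
  have "norm (T *\<^sub>R 1 - star d * d) \<le> T"
    using norm_minus_star_mult_swap[OF assms(1) T Pos_imp_bound[OF P _ T]] unfolding T_def by simp
  then have "Pos (- (v * v))"
    unfolding Pos_def using assms T by (auto simp: minus_L mult_L star_minus star_mult intro!: exI[of _ T])
  from Pos_norm_mono[OF Pos_square[OF assms(2,3)] this] have "v * v = 0" by simp
  then show ?thesis using cstar_id[OF assms(1)] assms(4) by simp
qed

text \<open>Kaplansky's argument, with \<open>g\<close> twice the negative part of \<open>b\<^sup>* b\<close>: \<open>(b g)\<^sup>* (b g)\<close> is
  the negative of a square, which forces \<open>b g = 0\<close>.\<close>
theorem Pos_star_mult_self: assumes "b \<in> L" shows "Pos (star b * b)"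
proof -
  define c where "c = star b * b"
  have c: "c \<in> L" "star c = c" unfolding c_def using assms by (auto simp: star_L mult_L star_mult star_star)
  obtain r where r: "Pos r" "r * r = c * c" "\<And>z. z * (c * c) = c * c * z \<Longrightarrow> z * r = r * z"
    using Pos_sqrt[OF Pos_square[OF c]] by metis
  have rL: "r \<in> L" "star r = r" using PosD[OF r(1)] by auto
  have cr: "c * r = r * c" using r(3) by (simp add: mult.assoc)
  \<comment> \<open>The root \<open>w\<close> of \<open>r\<close> turns \<open>g * r * g\<close>
    into the square of the selfadjoint element \<open>g * w\<close>.\<close>
  obtain w where w: "Pos w" "w * w = r" "\<And>z. z * r = r * z \<Longrightarrow> z * w = w * z"
    using Pos_sqrt[OF r(1)] by metis
  have wL: "w \<in> L" "star w = w" using PosD[OF w(1)] by auto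
  define g where "g = r - c"
  have g: "g \<in> L" "star g = g" unfolding g_def using rL c by (auto simp: diff_L star_diff)
  have "g * r = r * g" unfolding g_def using cr by (simp add: algebra_simps)
  then have gw: "g * w = w * g" using w(3) by blast
  have cg: "c * g = - (r * g)" unfolding g_def using cr r(2) by (simp add: algebra_simps)
  have "star (b * g) * (b * g) = g * (c * g)"
    unfolding c_def using assms g by (simp add: star_mult mult.assoc)
  also have "\<dots> = - (g * w * (g * w))" using cg gw w(2) by (metis mult.assoc mult_minus_right)
  finally have *: "star (b * g) * (b * g) = - (g * w * (g * w))" .
  have "star (g * w) = g * w" using g wL gw by (simp add: star_mult)
  then have "b * g = 0"
    using star_mult_self_neg_square[OF _ _ _ *] assms g wL mult_L by blast
  then have "c * g = 0" unfolding c_def by (simp add: mult.assoc)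
  then have "g * g = 0" using cg unfolding g_def by (simp add: algebra_simps)
  then have "g = 0" using sa_square_zero g by blast
  then show ?thesis using r(1) unfolding g_def c_def by simp
qed

text \<open>\<open>B\<close> may lack the unit, while \<open>1 - sqrt_iter h n\<close> involves it.
  Replacing the 1 by the scalar iterate \<open>sqrt_iter 1 n\<close> gives elements of
  \<open>B\<close>, and the limit is the same since the scalar iterates tend to 1.\<close>

lemma Pos_imp_star_mult_self_subalgebra:
  assumes "Pos a" "a \<in> B" "closed B" "subspace B" "\<And>x y. x \<in> B \<Longrightarrow> y \<in> B \<Longrightarrow> x * y \<in> B"
  obtains p where "p \<in> B" "p \<in> L" "star p = p" "p * p = a"
proof -
  have aL: "a \<in> L" "star a = a" using assms unfolding Pos_def by auto
  define t where "t = norm a + 1"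
  have tp: "t > 0" unfolding t_def by (auto intro: add_nonneg_pos)
  define h where "h = 1 - (1/t) *\<^sub>R a"
  have "h = (1/t) *\<^sub>R (t *\<^sub>R 1 - a)" using tp unfolding h_def by (simp add: scaleR_diff_right)
  then have "norm h \<le> 1" using Pos_imp_bound[OF assms(1) _ tp] tp unfolding t_def
    by (simp add: divide_le_eq)
  moreover have "h \<in> L" "star h = h"
    unfolding h_def using aL one_L by (auto simp: diff_L scale_L star_diff star_scale star_one)
  ultimately obtain q where q: "q \<in> L" "star q = q" "q * q = 1 - h"
      "(\<lambda>n. 1 - sqrt_iter h n) \<longlonglongrightarrow> q" using sa_sqrt_one_minus by metis
  let ?t = "sqrt_iter (1::real)"
  have "?t n *\<^sub>R 1 - sqrt_iter h n \<in> B" for n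
  proof (induction n)
    case 0 then show ?case using assms(4) by (simp add: subspace_0)
  next
    case (Suc n)
    define e where "e = ?t n *\<^sub>R 1 - sqrt_iter h n"
    have k: "sqrt_iter h n = ?t n *\<^sub>R 1 - e" unfolding e_def by simp
    have "?t (Suc n) *\<^sub>R 1 - sqrt_iter h (Suc n) = (1/2) *\<^sub>R ((1/t) *\<^sub>R a + (2 * ?t n) *\<^sub>R e - e * e)"
      unfolding sqrt_iter.simps k by (simp add: h_def algebra_simps flip: scaleR_add_left)
    moreover have "e \<in> B" using Suc unfolding e_def .
    ultimately show ?case using assms by (simp add: subspace_scale subspace_add subspace_diff)
  qed
  moreover have "(\<lambda>n. ?t n *\<^sub>R 1 - sqrt_iter h n) \<longlonglongrightarrow> q"
  proof -
    have "(\<lambda>n. (1 - sqrt_iter h n) - (1 - ?t n) *\<^sub>R 1) \<longlonglongrightarrow> q - (1 - 1) *\<^sub>R 1"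
      by (intro tendsto_intros q sqrt_iter_one_tendsto)
    then show ?thesis by (simp add: algebra_simps)
  qed
  ultimately have "q \<in> B" by (rule closed_sequentially[OF assms(3)])
  then show ?thesis using q tp assms(4)
    by (intro that[of "sqrt t *\<^sub>R q"]) (auto simp: subspace_scale scale_L star_scale h_def)
qed

end

section \<open>The order of a C*-algebra without unit\<close>

text \<open>The type of bounded operators, with composition as multiplication, makes
  the unital theory applicable to the adjointable operators on a possibly non-unital algebra.\<close>

typedef (overloaded) 'a bop = "UNIV :: ('a::real_normed_vector \<Rightarrow>\<^sub>L 'a) set"
  morphisms bop_fun Bop ..

setup_lifting type_definition_bop

instantiation bop :: (real_normed_vector) real_normed_algebra
begin

lift_definition zero_bop :: "'a bop" is 0 .
lift_definition plus_bop :: "'a bop \<Rightarrow> 'a bop \<Rightarrow> 'a bop" is "(+)" .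
lift_definition minus_bop :: "'a bop \<Rightarrow> 'a bop \<Rightarrow> 'a bop" is "(-)" .
lift_definition uminus_bop :: "'a bop \<Rightarrow> 'a bop" is uminus .
lift_definition scaleR_bop :: "real \<Rightarrow> 'a bop \<Rightarrow> 'a bop" is scaleR .
lift_definition times_bop :: "'a bop \<Rightarrow> 'a bop \<Rightarrow> 'a bop" is blinfun_compose .
lift_definition norm_bop :: "'a bop \<Rightarrow> real" is norm .

definition "dist_bop (x::'a bop) y = norm (x - y)"
definition "sgn_bop (x::'a bop) = scaleR (inverse (norm x)) x"
definition "(uniformity :: ('a bop \<times> 'a bop) filter) = (INF e\<in>{0<..}. principal {(x, y). dist x y < e})"
definition "open (U :: 'a bop set) \<longleftrightarrow> (\<forall>x\<in>U. \<forall>\<^sub>F (x', y) in uniformity. x' = x \<longrightarrow> y \<in> U)"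

instance
proof
  fix a b c :: "'a bop" and r s :: real
  show "a + b + c = a + (b + c)" "a + b = b + a" "0 + a = a" "- a + a = 0" "a - b = a + - b"
    by (transfer; simp)+
  show "r *\<^sub>R (a + b) = r *\<^sub>R a + r *\<^sub>R b" "(r + s) *\<^sub>R a = r *\<^sub>R a + s *\<^sub>R a"
    "r *\<^sub>R s *\<^sub>R a = (r * s) *\<^sub>R a" "1 *\<^sub>R a = a"
    by (transfer; simp add: algebra_simps)+
  show "a * b * c = a * (b * c)" by transfer (rule blinfun_eqI, simp)
  show "(a + b) * c = a * c + b * c" "a * (b + c) = a * b + a * c"
    by (transfer; rule blinfun_eqI; simp add: blinfun.bilinear_simps)+
  show "r *\<^sub>R a * b = r *\<^sub>R (a * b)" "a * r *\<^sub>R b = r *\<^sub>R (a * b)"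
    by (transfer; rule blinfun_eqI; simp add: blinfun.bilinear_simps)+
  show "norm a = 0 \<longleftrightarrow> a = 0" "norm (a + b) \<le> norm a + norm b" "norm (r *\<^sub>R a) = \<bar>r\<bar> * norm a"
    by (transfer; simp add: norm_triangle_ineq)+
  show "norm (a * b) \<le> norm a * norm b" by transfer (rule norm_blinfun_compose)
qed (rule dist_bop_def sgn_bop_def uniformity_bop_def open_bop_def)+

end

instantiation bop :: (real_normed_vector) monoid_mult
begin
lift_definition one_bop :: "'a bop" is id_blinfun .
instance by standard (transfer; rule blinfun_eqI; simp)+
end

instance bop :: (banach) banach
proof
  fix X :: "nat \<Rightarrow> 'a bop"
  assume X: "Cauchy X"
  have d: "dist (bop_fun a) (bop_fun b) = dist a b" for a b :: "'a bop"
    unfolding dist_norm by transfer simp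
  have "Cauchy (\<lambda>n. bop_fun (X n))" using X unfolding Cauchy_def d .
  then obtain l where "(\<lambda>n. bop_fun (X n)) \<longlonglongrightarrow> l" using Cauchy_convergent convergent_def by blast
  then have "(\<lambda>n. bop_fun (X n)) \<longlonglongrightarrow> bop_fun (Bop l)" by (simp add: Bop_inverse)
  then have "X \<longlonglongrightarrow> Bop l" unfolding tendsto_iff d .
  then show "convergent X" by (auto simp: convergent_def)
qed

lift_definition bop_app :: "'a bop \<Rightarrow> 'a::real_normed_vector \<Rightarrow> 'a" is blinfun_apply .

lemma bop_app_simps [simp]:
  "bop_app 0 x = 0" "bop_app (S + T) x = bop_app S x + bop_app T x"
  "bop_app (S - T) x = bop_app S x - bop_app T x" "bop_app (- T) x = - bop_app T x"
  "bop_app (r *\<^sub>R T) x = r *\<^sub>R bop_app T x" "bop_app (S * T) x = bop_app S (bop_app T x)"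
  "bop_app 1 x = x" "bop_app T (r *\<^sub>R x) = r *\<^sub>R bop_app T x" "bop_app T (x + y) = bop_app T x + bop_app T y"
  "bop_app T (- x) = - bop_app T x"
  by (transfer; simp add: blinfun.bilinear_simps)+

lemma bop_eqI: "(\<And>x. bop_app S x = bop_app T x) \<Longrightarrow> S = T"
  by transfer (rule blinfun_eqI)

lemma norm_bop_app: "norm (bop_app T x) \<le> norm T * norm x"
  by transfer (rule norm_blinfun)

lemma norm_bop_bound: "0 \<le> b \<Longrightarrow> (\<And>x. norm (bop_app T x) \<le> b * norm x) \<Longrightarrow> norm T \<le> b"
  by transfer (rule norm_blinfun_bound)

lemma bop_exists: assumes "bounded_linear f" obtains T where "\<And>x. bop_app T x = f x"
  using bounded_linear_Blinfun_apply[OF assms] that[of "Bop (Blinfun f)"]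
  by (simp add: bop_app.rep_eq Bop_inverse)

lemma tendsto_bop_app:
  assumes "T \<longlonglongrightarrow> T0" shows "(\<lambda>n. bop_app (T n) x) \<longlonglongrightarrow> bop_app T0 x"
proof (rule Lim_null_comparison[where g = "\<lambda>n. norm (T n - T0) * norm x", THEN LIM_zero_cancel])
  show "\<forall>\<^sub>F n in sequentially. norm (bop_app (T n) x - bop_app T0 x) \<le> norm (T n - T0) * norm x"
    using norm_bop_app[of "_ - T0" x] by simp
  have "(\<lambda>n. norm (T n - T0)) \<longlonglongrightarrow> 0" using assms by (simp add: LIM_zero tendsto_norm_zero)
  then show "(\<lambda>n. norm (T n - T0) * norm x) \<longlonglongrightarrow> 0" by (rule tendsto_mult_left_zero)
qed

lift_definition left_mult :: "'a::real_normed_algebra \<Rightarrow> 'a bop" is "\<lambda>a. Blinfun (\<lambda>x. a * x)" .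

lemma left_mult_app [simp]: "bop_app (left_mult a) x = a * x"
  by transfer (simp add: bounded_linear_Blinfun_apply bounded_linear_mult_right)

lemma left_mult_simps:
  "left_mult (a + b) = left_mult a + left_mult b" "left_mult (a * b) = left_mult a * left_mult b"
  "left_mult (a - b) = left_mult a - left_mult b"
  "left_mult (r *\<^sub>R a) = r *\<^sub>R left_mult a" "left_mult 0 = 0"
  by (auto intro!: bop_eqI simp: algebra_simps)

locale cstar =
  fixes cs :: "complex \<Rightarrow> 'a::{real_normed_algebra,banach} \<Rightarrow> 'a" and st :: "'a \<Rightarrow> 'a"
  assumes cstar_alg: "cstar_alg cs st"
begin

lemma cs_of_real: "cs (complex_of_real r) a = r *\<^sub>R a"
  and cs_add: "cs (c + d) a = cs c a + cs d a" and cs_add_right: "cs c (a + b) = cs c a + cs c b"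
  and cs_mult: "cs (c * d) a = cs c (cs d a)"
  and cs_mult_left: "cs c a * b = cs c (a * b)" and cs_mult_right: "a * cs c b = cs c (a * b)"
  and norm_cs: "norm (cs c a) = cmod c * norm a"
  and st_st [simp]: "st (st a) = a" and st_add [simp]: "st (a + b) = st a + st b"
  and st_cs: "st (cs c a) = cs (cnj c) (st a)" and st_mult [simp]: "st (a * b) = st b * st a"
  and cstar_identity: "norm (st a * a) = (norm a)\<^sup>2"
  using cstar_alg unfolding cstar_alg_def by metis+

lemma st_scaleR [simp]: "st (r *\<^sub>R a) = r *\<^sub>R st a"
  using st_cs[of "complex_of_real r" a] by (simp add: cs_of_real)

lemma st_zero [simp]: "st 0 = 0"
  using st_scaleR[of 0 0] by simp

lemma st_minus [simp]: "st (- a) = - st a"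
  using st_scaleR[of "-1" a] by simp

lemma st_diff [simp]: "st (a - b) = st a - st b"
  using st_add[of a "- b"] by simp

lemma st_sum: "st (\<Sum>i\<in>S. f i) = (\<Sum>i\<in>S. st (f i))"
  by (induction S rule: infinite_finite_induct) auto

lemma norm_st [simp]: "norm (st a) = norm a"
proof -
  have *: "norm a \<le> norm (st a)" for a
  proof (cases "norm a = 0")
    case False
    have "norm a * norm a \<le> norm (st a) * norm a"
      using cstar_identity[of a] norm_mult_ineq[of "st a" a] by (simp add: power2_eq_square)
    then show ?thesis using False by simp
  qed simp
  show ?thesis using *[of a] *[of "st a"] by simp
qed

lemma st_mult_self_zero: "st a * a = 0 \<Longrightarrow> a = 0"
  using cstar_identity[of a] by simp

lemma tendsto_st: "(f \<longlongrightarrow> a) F \<Longrightarrow> ((\<lambda>x. st (f x)) \<longlongrightarrow> st a) F"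
proof -
  have "bounded_linear st" by (rule bounded_linear_intro[where K=1]) auto
  then show "(f \<longlongrightarrow> a) F \<Longrightarrow> ((\<lambda>x. st (f x)) \<longlongrightarrow> st a) F" by (rule bounded_linear.tendsto)
qed

text \<open>Adjoints for the algebra regarded as a right Hilbert module over itself, with inner
  product \<open>st x * y\<close>. This inner product is nondegenerate even without a unit, since
  \<open>st a * a = 0\<close> forces \<open>a = 0\<close>.\<close>

definition is_adj :: "'a bop \<Rightarrow> 'a bop \<Rightarrow> bool" where
  "is_adj S T \<longleftrightarrow> (\<forall>x y. st (bop_app S x) * y = st x * bop_app T y)"

definition adj :: "'a bop \<Rightarrow> 'a bop" where "adj S = (THE T. is_adj S T)"

lemma is_adj_unique: assumes "is_adj S T" "is_adj S T'" shows "T = T'"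
proof (rule bop_eqI)
  fix x
  have "st y * (bop_app T x - bop_app T' x) = 0" for y
    using assms unfolding is_adj_def by (simp add: algebra_simps)
  then show "bop_app T x = bop_app T' x" using st_mult_self_zero by (metis eq_iff_diff_eq_0)
qed

lemma adj_eq: "is_adj S T \<Longrightarrow> adj S = T"
  unfolding adj_def using is_adj_unique by blast

lemma is_adj_sym: "is_adj S T \<Longrightarrow> is_adj T S"
  unfolding is_adj_def by (metis st_mult st_st)

lemma norm_is_adj:
  assumes "is_adj S T" shows "(norm S)\<^sup>2 \<le> norm (T * S)"
proof -
  have "norm (bop_app S x) \<le> sqrt (norm (T * S)) * norm x" for x
  proof (rule power2_le_imp_le)
    have "(norm (bop_app S x))\<^sup>2 = norm (st (bop_app S x) * bop_app S x)" by (simp add: cstar_identity)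
    also have "\<dots> = norm (st x * bop_app (T * S) x)" using assms unfolding is_adj_def by simp
    also have "\<dots> \<le> norm (st x) * norm (bop_app (T * S) x)" by (rule norm_mult_ineq)
    also have "\<dots> \<le> norm x * (norm (T * S) * norm x)" using norm_bop_app[of "T * S" x] by (simp add: mult_left_mono)
    finally show "(norm (bop_app S x))\<^sup>2 \<le> (sqrt (norm (T * S)) * norm x)\<^sup>2"
      by (simp add: power_mult_distrib power2_eq_square mult_ac)
  qed simp
  then have "norm S \<le> sqrt (norm (T * S))" by (intro norm_bop_bound) auto
  then show ?thesis by (metis norm_ge_zero real_le_rsqrt real_sqrt_ge_zero real_sqrt_pow2 power_mono)
qed

lemma norm_adj_le: assumes "is_adj S T" shows "norm S \<le> norm T"
proof (cases "norm S = 0")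
  case False
  have "norm S * norm S \<le> norm T * norm S"
    using norm_is_adj[OF assms] norm_mult_ineq[of T S] by (simp add: power2_eq_square)
  then show ?thesis using False by simp
qed simp

lemma norm_adj_eq: "is_adj S T \<Longrightarrow> norm S = norm T"
  using norm_adj_le is_adj_sym by (metis order_antisym)

lemma is_adj_left_mult: "is_adj (left_mult a) (left_mult (st a))"
  unfolding is_adj_def by (simp add: mult.assoc)

lemma is_adj_diff: "is_adj S T \<Longrightarrow> is_adj S' T' \<Longrightarrow> is_adj (S - S') (T - T')"
  unfolding is_adj_def by (simp add: algebra_simps)

text \<open>Passing to the adjoint is isometric, so the adjoints of a convergent sequence are again
  Cauchy, and their limit is an adjoint of the limit.\<close>

lemma closed_adjointable: "closed {S. \<exists>T. is_adj S T}"
  unfolding closed_sequential_limits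
proof (intro allI impI, elim conjE)
  fix S l assume "\<forall>n. S n \<in> {S. \<exists>T. is_adj S T}" and l: "S \<longlonglongrightarrow> l"
  then have "\<forall>n. \<exists>T. is_adj (S n) T" by blast
  then obtain T where T: "\<And>n. is_adj (S n) (T n)" by metis
  have "dist (T m) (T n) = dist (S m) (S n)" for m n
    unfolding dist_norm using norm_adj_eq[OF is_adj_diff[OF T T]] by simp
  then have "Cauchy T" using LIMSEQ_imp_Cauchy[OF l] unfolding Cauchy_def by simp
  then obtain l' where l': "T \<longlonglongrightarrow> l'" using Cauchy_convergent convergent_def by blast
  have "st (bop_app l x) * y = st x * bop_app l' y" for x y
  proof (rule LIMSEQ_unique)
    show "(\<lambda>n. st (bop_app (S n) x) * y) \<longlonglongrightarrow> st (bop_app l x) * y"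
      by (intro tendsto_intros tendsto_st tendsto_bop_app l)
    have "(\<lambda>n. st x * bop_app (T n) y) \<longlonglongrightarrow> st x * bop_app l' y"
      by (intro tendsto_intros tendsto_bop_app l')
    then show "(\<lambda>n. st (bop_app (S n) x) * y) \<longlonglongrightarrow> st x * bop_app l' y"
      using T unfolding is_adj_def by simp
  qed
  then show "l \<in> {S. \<exists>T. is_adj S T}" unfolding is_adj_def by blast
qed

definition im_op :: "'a bop" where "im_op = (SOME T. \<forall>x. bop_app T x = cs \<i> x)"

lemma cs_scaleR: "cs c (r *\<^sub>R x) = r *\<^sub>R cs c x"
  by (metis cs_mult cs_of_real mult.commute)

lemma im_op_app [simp]: "bop_app im_op x = cs \<i> x"
proof -
  have "bounded_linear (cs \<i>)"
    by (rule bounded_linear_intro[where K=1]) (auto simp: cs_add_right norm_cs cs_scaleR)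
  then obtain T where "\<And>x. bop_app T x = cs \<i> x" using bop_exists by metis
  then have "\<exists>T. \<forall>x. bop_app T x = cs \<i> x" by blast
  then show ?thesis unfolding im_op_def by (rule someI_ex[THEN spec])
qed

lemma cs_minus: "cs (- c) x = - cs c x"
  by (metis add.right_inverse cs_add cs_of_real minus_unique of_real_0 scaleR_zero_left)

sublocale adjointable: unital_cstar "{S. \<exists>T. is_adj S T}" adj im_op
proof
  show "closed {S. \<exists>T. is_adj S T}" by (rule closed_adjointable)
  show "1 \<in> {S. \<exists>T. is_adj S T}" unfolding is_adj_def by (auto intro!: exI[of _ 1])
  have im: "is_adj im_op (- im_op)"
    unfolding is_adj_def by (simp add: st_cs cs_minus cs_mult_left cs_mult_right)
  then show "im_op \<in> {S. \<exists>T. is_adj S T}" "adj im_op = - im_op" using adj_eq by auto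
  show "im_op * im_op = - 1"
    using cs_of_real[of "-1"] by (auto intro!: bop_eqI simp flip: cs_mult)
next
  fix a b :: "'a bop" and r :: real
  assume "a \<in> {S. \<exists>T. is_adj S T}"
  then obtain a' where a: "is_adj a a'" by blast
  have r: "is_adj (r *\<^sub>R a) (r *\<^sub>R a')" using a unfolding is_adj_def by simp
  then show "r *\<^sub>R a \<in> {S. \<exists>T. is_adj S T}" "adj (r *\<^sub>R a) = r *\<^sub>R adj a"
    using adj_eq[OF a] adj_eq[OF r] by auto
  show "adj a \<in> {S. \<exists>T. is_adj S T}" "adj (adj a) = a"
    using adj_eq[OF a] adj_eq[OF is_adj_sym[OF a]] is_adj_sym[OF a] by auto
  show "norm (adj a * a) = (norm a)\<^sup>2"
    using norm_is_adj[OF a] norm_mult_ineq[of a' a] norm_adj_eq[OF a]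
    unfolding adj_eq[OF a] by (simp add: power2_eq_square)
  \<comment> \<open>Operators of type \<open>'a bop\<close> are only real-linear. Complex linearity
    of \<open>a\<close> comes from its adjoint, which moves \<open>a\<close> to the left factor in
    \<open>st y * bop_app a x\<close>.\<close>
  show "im_op * a = a * im_op"
  proof (rule bop_eqI)
    fix x
    have "st y * (cs \<i> (bop_app a x) - bop_app a (cs \<i> x)) = 0" for y
      using is_adj_sym[OF a] unfolding is_adj_def
      by (simp add: algebra_simps cs_mult_right) (metis cs_mult_right)
    then show "bop_app (im_op * a) x = bop_app (a * im_op) x"
      using st_mult_self_zero by (metis eq_iff_diff_eq_0 bop_app_simps(6) im_op_app)
  qed
  assume "b \<in> {S. \<exists>T. is_adj S T}"
  then obtain b' where b: "is_adj b b'" by blast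
  have p: "is_adj (a + b) (a' + b')" and m: "is_adj (a * b) (b' * a')"
    using a b unfolding is_adj_def by (simp_all add: algebra_simps)
  then show "a + b \<in> {S. \<exists>T. is_adj S T}" "a * b \<in> {S. \<exists>T. is_adj S T}"
    "adj (a + b) = adj a + adj b" "adj (a * b) = adj b * adj a"
    using adj_eq[OF a] adj_eq[OF b] adj_eq[OF p] adj_eq[OF m] by auto
qed

lemma adj_left_mult: "adj (left_mult a) = left_mult (st a)"
  by (rule adj_eq[OF is_adj_left_mult])

lemma left_mult_adjointable: "left_mult a \<in> {S. \<exists>T. is_adj S T}"
  using is_adj_left_mult by blast

lemma norm_left_mult: "norm (left_mult (a::'a)) = norm a"
proof (rule antisym)
  show "norm (left_mult a) \<le> norm a" by (rule norm_bop_bound) (auto simp: norm_mult_ineq)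
  show "norm a \<le> norm (left_mult a)"
  proof (cases "norm a = 0")
    case False
    have "norm a * norm a \<le> norm (left_mult a) * norm a"
      using norm_bop_app[of "left_mult a" "st a"] cstar_identity[of "st a"] by (simp add: power2_eq_square)
    then show ?thesis using False by simp
  qed simp
qed

lemma left_mult_inject: "left_mult (a::'a) = left_mult b \<longleftrightarrow> a = b"
  using norm_left_mult[of "a - b"] by (auto simp: left_mult_simps)

lemma closed_range_left_mult: "closed (range (left_mult :: 'a \<Rightarrow> _))"
  unfolding closed_sequential_limits
proof (intro allI impI, elim conjE)
  fix S :: "nat \<Rightarrow> 'a bop" and l assume "\<forall>n. S n \<in> range left_mult" and l: "S \<longlonglongrightarrow> l"
  then have "\<forall>n. \<exists>a. S n = left_mult a" by blast
  then obtain a where a: "\<And>n. S n = left_mult (a n)" by metis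
  have d: "dist (left_mult x) (left_mult y) = dist x y" for x y :: 'a
    unfolding dist_norm by (simp add: norm_left_mult flip: left_mult_simps)
  have "Cauchy a" using LIMSEQ_imp_Cauchy[OF l] unfolding Cauchy_def a d .
  then obtain b where b: "a \<longlonglongrightarrow> b" using Cauchy_convergent convergent_def by blast
  then have "S \<longlonglongrightarrow> left_mult b" unfolding tendsto_iff a d .
  then show "l \<in> range left_mult" using l LIMSEQ_unique by blast
qed

text \<open>Connects the order of \<open>A\<close> with that of the adjointable operators. One
  direction is \<open>Pos_star_mult_self\<close>; for the other the root is found inside the image
  of \<open>A\<close>, a closed subalgebra that may lack the unit. Sums, limits and norm
  monotonicity for \<open>positive_el\<close> are then inherited.\<close>

lemma positive_el_iff: "positive_el st a \<longleftrightarrow> adjointable.Pos (left_mult a)"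
proof
  assume "positive_el st a"
  then obtain b where "a = st b * b" unfolding positive_el_def by blast
  then show "adjointable.Pos (left_mult a)"
    using adjointable.Pos_star_mult_self[OF left_mult_adjointable[of b]]
    by (simp add: adj_left_mult left_mult_simps)
next
  assume "adjointable.Pos (left_mult a)"
  then obtain p where p: "p \<in> range left_mult" "adj p = p" "p * p = left_mult a"
  proof (rule adjointable.Pos_imp_star_mult_self_subalgebra[where B = "range left_mult"])
    show "subspace (range (left_mult :: 'a \<Rightarrow> 'a bop))"
      unfolding subspace_def by (auto simp flip: left_mult_simps)
  qed (auto simp: closed_range_left_mult simp flip: left_mult_simps)
  then obtain b where "p = left_mult b" by blast
  then have "st b = b" "b * b = a"
    using p by (auto simp: adj_left_mult left_mult_inject simp flip: left_mult_simps)
  then show "positive_el st a" unfolding positive_el_def by metis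
qed

abbreviation pos :: "'a \<Rightarrow> bool" where "pos \<equiv> positive_el st"

lemma pos_mult_self [simp, intro]: "pos (st b * b)"
  unfolding positive_el_def by blast

lemma pos_add: "pos a \<Longrightarrow> pos b \<Longrightarrow> pos (a + b)"
  unfolding positive_el_iff left_mult_simps by (rule adjointable.Pos_add)

lemma pos_scaleR: "pos a \<Longrightarrow> r \<ge> 0 \<Longrightarrow> pos (r *\<^sub>R a)"
  unfolding positive_el_iff left_mult_simps by (rule adjointable.Pos_scale)

lemma pos_zero [simp]: "pos 0"
  using pos_mult_self[of 0] by simp

lemma pos_sum: "(\<And>i. i \<in> S \<Longrightarrow> pos (f i)) \<Longrightarrow> pos (\<Sum>i\<in>S. f i)"
  by (induction S rule: infinite_finite_induct) (auto simp: pos_add)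

lemma pos_norm_mono: "pos a \<Longrightarrow> pos b \<Longrightarrow> norm a \<le> norm (a + b)"
  unfolding positive_el_iff
  using adjointable.Pos_norm_mono[of "left_mult a" "left_mult b"]
  by (simp add: norm_left_mult flip: left_mult_simps)

lemma pos_norm_le: "pos a \<Longrightarrow> pos (b - a) \<Longrightarrow> norm a \<le> norm b"
  using pos_norm_mono[of a "b - a"] by simp

lemma pos_limit: assumes "\<And>n. pos (f n)" "f \<longlonglongrightarrow> a" shows "pos a"
proof -
  have "(\<lambda>n. left_mult (f n)) \<longlonglongrightarrow> left_mult a"
    using assms(2) unfolding tendsto_iff dist_norm by (simp add: norm_left_mult flip: left_mult_simps)
  then show ?thesis using assms(1) unfolding positive_el_iff by (rule adjointable.Pos_limit[rotated])
qed

lemma pos_selfadjoint: "pos a \<Longrightarrow> st a = a"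
  unfolding positive_el_def by auto

text \<open>Among the operators \<open>r - c\<close> has a selfadjoint root \<open>q\<close>, and
  the difference is the image of \<open>(q a)^* (q a)\<close>. The unit in \<open>r - c\<close> is
  that of the operators, not of \<open>A\<close>.\<close>

lemma pos_norm_bound:
  assumes "pos c" "norm c \<le> r"
  shows "pos (r *\<^sub>R (st a * a) - st a * c * a)"
proof -
  have "adjointable.Pos (r *\<^sub>R 1 - left_mult c)"
    using assms by (intro adjointable.Pos_norm_minus left_mult_adjointable)
      (auto simp: adj_left_mult pos_selfadjoint norm_left_mult)
  then obtain q where q: "adjointable.Pos q" "q * q = r *\<^sub>R 1 - left_mult c"
    using adjointable.Pos_sqrt by metis
  have qa: "q \<in> {S. \<exists>T. is_adj S T}" "adj q = q" using adjointable.PosD[OF q(1)] by auto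
  have "adj (q * left_mult a) * (q * left_mult a) = left_mult (st a) * (q * q) * left_mult a"
    using qa left_mult_adjointable[of a] by (simp add: adjointable.star_mult adj_left_mult mult.assoc)
  also have "\<dots> = left_mult (r *\<^sub>R (st a * a) - st a * c * a)"
    unfolding q(2) by (simp add: left_mult_simps algebra_simps)
  finally show ?thesis
    unfolding positive_el_iff using adjointable.Pos_star_mult_self[OF adjointable.mult_L[OF qa(1) left_mult_adjointable[of a]]]
    by simp
qed

end

section \<open>Hilbert modules and approximate projections\<close>

text \<open>The norm is attached to an inner product rather than to a type, since the sum of
  \<open>M\<close> and \<open>l2(I)\<close> is a subset of a type that carries no such norm.\<close>

definition ipnorm :: "('x \<Rightarrow> 'x \<Rightarrow> 'a::real_normed_vector) \<Rightarrow> 'x \<Rightarrow> real" where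
  "ipnorm ip x = sqrt (norm (ip x x))"

lemma ipnorm_nonneg [simp]: "0 \<le> ipnorm ip x"
  unfolding ipnorm_def by simp

lemma ipnorm_sq: "(ipnorm ip x)\<^sup>2 = norm (ip x x)"
  unfolding ipnorm_def by simp

text \<open>Inner product modules on a subset, without completeness. Vectors are determined by their
  inner products (\<open>ip_eqI\<close>), so additivity of the action is derived from the axioms on
  \<open>ip\<close>.\<close>

locale pre_hmod = cstar cs st
  for cs :: "complex \<Rightarrow> 'a::{real_normed_algebra,banach} \<Rightarrow> 'a" and st :: "'a \<Rightarrow> 'a" +
  fixes X :: "'x::ab_group_add set" and act :: "'x \<Rightarrow> 'a \<Rightarrow> 'x" and ip :: "'x \<Rightarrow> 'x \<Rightarrow> 'a"
  assumes zero_X [simp]: "0 \<in> X"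
    and add_X [simp]: "\<And>x y. x \<in> X \<Longrightarrow> y \<in> X \<Longrightarrow> x + y \<in> X"
    and minus_X [simp]: "\<And>x. x \<in> X \<Longrightarrow> - x \<in> X"
    and act_X [simp]: "\<And>x a. x \<in> X \<Longrightarrow> act x a \<in> X"
    and ip_add: "\<And>x y z. x \<in> X \<Longrightarrow> y \<in> X \<Longrightarrow> z \<in> X \<Longrightarrow> ip x (y + z) = ip x y + ip x z"
    and ip_act: "\<And>x y a. x \<in> X \<Longrightarrow> y \<in> X \<Longrightarrow> ip x (act y a) = ip x y * a"
    and ip_sym: "\<And>x y. x \<in> X \<Longrightarrow> y \<in> X \<Longrightarrow> st (ip x y) = ip y x"
    and ip_pos: "\<And>x. x \<in> X \<Longrightarrow> pos (ip x x)"
    and ip_self_zero: "\<And>x. x \<in> X \<Longrightarrow> ip x x = 0 \<Longrightarrow> x = 0"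
begin

abbreviation nrm :: "'x \<Rightarrow> real" where "nrm \<equiv> ipnorm ip"

lemma diff_X [simp]: "x \<in> X \<Longrightarrow> y \<in> X \<Longrightarrow> x - y \<in> X"
  using add_X[of x "- y"] by simp

lemma sum_X [simp]: "(\<And>i. i \<in> S \<Longrightarrow> f i \<in> X) \<Longrightarrow> (\<Sum>i\<in>S. f i) \<in> X"
  by (induction S rule: infinite_finite_induct) auto

lemma sum_lessThan_X [simp]: "(\<And>i. i < n \<Longrightarrow> f i \<in> X) \<Longrightarrow> (\<Sum>i<n. f i) \<in> X" for n :: nat
  by (rule sum_X) simp

lemma ip_zero_right [simp]: "x \<in> X \<Longrightarrow> ip x 0 = 0"
  using ip_add[of x 0 0] by simp

lemma ip_zero_left [simp]: "x \<in> X \<Longrightarrow> ip 0 x = 0"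
  using ip_sym[of x 0] by simp

lemma ip_minus: "x \<in> X \<Longrightarrow> y \<in> X \<Longrightarrow> ip x (- y) = - ip x y"
  using ip_add[of x y "- y"] by (simp add: eq_neg_iff_add_eq_0 add.commute)

lemma ip_diff: "x \<in> X \<Longrightarrow> y \<in> X \<Longrightarrow> z \<in> X \<Longrightarrow> ip x (y - z) = ip x y - ip x z"
  using ip_add[of x y "- z"] by (simp add: ip_minus)

lemma ip_add_left: "x \<in> X \<Longrightarrow> y \<in> X \<Longrightarrow> z \<in> X \<Longrightarrow> ip (x + y) z = ip x z + ip y z"
  by (metis add_X ip_add ip_sym st_add)

lemma ip_diff_left: "x \<in> X \<Longrightarrow> y \<in> X \<Longrightarrow> z \<in> X \<Longrightarrow> ip (x - y) z = ip x z - ip y z"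
  by (metis diff_X ip_diff ip_sym st_diff)

lemma ip_minus_left: "x \<in> X \<Longrightarrow> y \<in> X \<Longrightarrow> ip (- x) y = - ip x y"
  by (metis minus_X ip_minus ip_sym st_minus)

lemma ip_act_left: "x \<in> X \<Longrightarrow> y \<in> X \<Longrightarrow> ip (act x a) y = st a * ip x y"
  by (metis act_X ip_act ip_sym st_mult)

lemma ip_sum: "x \<in> X \<Longrightarrow> (\<And>i. i \<in> S \<Longrightarrow> f i \<in> X) \<Longrightarrow> ip x (\<Sum>i\<in>S. f i) = (\<Sum>i\<in>S. ip x (f i))"
  by (induction S rule: infinite_finite_induct) (auto simp: ip_add)

lemma ip_sum_left: "x \<in> X \<Longrightarrow> (\<And>i. i \<in> S \<Longrightarrow> f i \<in> X) \<Longrightarrow> ip (\<Sum>i\<in>S. f i) x = (\<Sum>i\<in>S. ip (f i) x)"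
  by (induction S rule: infinite_finite_induct) (auto simp: ip_add_left)

lemma ip_sum_lessThan: "x \<in> X \<Longrightarrow> (\<And>i. i < n \<Longrightarrow> f i \<in> X) \<Longrightarrow> ip x (\<Sum>i<n. f i) = (\<Sum>i<n. ip x (f i))" for n :: nat
  by (rule ip_sum) simp_all

lemma ip_eqI: assumes "x \<in> X" "y \<in> X" "\<And>z. z \<in> X \<Longrightarrow> ip z x = ip z y" shows "x = y"
proof -
  have "ip (x - y) (x - y) = 0" using assms by (simp add: ip_diff)
  then show ?thesis using ip_self_zero[of "x - y"] assms by simp
qed

lemma act_add: "x \<in> X \<Longrightarrow> act x (a + b) = act x a + act x b"
  by (rule ip_eqI) (auto simp: ip_act ip_add algebra_simps)

lemma act_add_left: "x \<in> X \<Longrightarrow> y \<in> X \<Longrightarrow> act (x + y) a = act x a + act y a"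
  by (rule ip_eqI) (auto simp: ip_act ip_add algebra_simps)

lemma act_diff: "x \<in> X \<Longrightarrow> act x (a - b) = act x a - act x b"
  by (rule ip_eqI) (auto simp: ip_act ip_diff algebra_simps)

lemma act_diff_left: "x \<in> X \<Longrightarrow> y \<in> X \<Longrightarrow> act (x - y) a = act x a - act y a"
  by (rule ip_eqI) (auto simp: ip_act ip_diff algebra_simps)

lemma act_zero: "x \<in> X \<Longrightarrow> act x 0 = 0"
  by (rule ip_eqI) (auto simp: ip_act)

lemma pos_ip_act_bound:
  assumes "x \<in> X" "norm (ip x x) \<le> r"
  shows "pos (r *\<^sub>R (st a * a) - ip (act x a) (act x a))"
  using pos_norm_bound[OF ip_pos[OF assms(1)] assms(2), of a] assms(1)
  by (simp add: ip_act ip_act_left mult.assoc)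

lemma cauchy_schwarz_order:
  assumes "x \<in> X" "y \<in> X"
  shows "pos (norm (ip x x) *\<^sub>R ip y y - ip y x * ip x y)"
proof (cases "ip x x = 0")
  case True
  then have "x = 0" using ip_self_zero assms by blast
  then show ?thesis using assms by simp
next
  case False
  define r where "r = norm (ip x x)"
  have r: "r > 0" unfolding r_def using False by simp
  \<comment> \<open>This \<open>a\<close> would be the optimal coefficient if \<open>ip x x\<close>
    were the scalar \<open>r\<close>; fact \<open>2\<close> pays for the replacement.\<close>
  define a where "a = (1/r) *\<^sub>R ip x y"
  have sa: "st a = (1/r) *\<^sub>R ip y x" unfolding a_def using assms by (simp add: ip_sym)
  define z where "z = y - act x a"
  have zX: "z \<in> X" unfolding z_def using assms by simp
  have 1: "pos (ip z z)" using ip_pos zX .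
  have 2: "pos (r *\<^sub>R (st a * a) - ip (act x a) (act x a))"
    using pos_ip_act_bound[OF assms(1)] unfolding r_def by simp
  have "ip z z + (r *\<^sub>R (st a * a) - ip (act x a) (act x a)) = ip y y - (1/r) *\<^sub>R (ip y x * ip x y)"
  proof -
    have "ip z z = ip y y - ip y x * a - st a * ip x y + ip (act x a) (act x a)"
      unfolding z_def using assms by (simp add: ip_diff ip_diff_left ip_act ip_act_left algebra_simps)
    then show ?thesis unfolding sa unfolding a_def using r by (simp add: algebra_simps)
  qed
  then have "pos (r *\<^sub>R (ip y y - (1/r) *\<^sub>R (ip y x * ip x y)))"
    using pos_add[OF 1 2] pos_scaleR r by simp
  then show ?thesis using r unfolding r_def by (simp add: scaleR_diff_right)
qed

lemma norm_ip_le: assumes "x \<in> X" "y \<in> X" shows "norm (ip x y) \<le> nrm x * nrm y"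
proof (rule power2_le_imp_le)
  have *: "ip y x * ip x y = st (ip x y) * ip x y" using assms by (simp add: ip_sym)
  have "norm (ip y x * ip x y) \<le> norm (norm (ip x x) *\<^sub>R ip y y)"
    by (rule pos_norm_le[OF _ cauchy_schwarz_order[OF assms]]) (simp add: *)
  then show "(norm (ip x y))\<^sup>2 \<le> (nrm x * nrm y)\<^sup>2"
    unfolding * cstar_identity by (simp add: power_mult_distrib ipnorm_sq)
qed simp

lemma nrm_triangle: assumes "x \<in> X" "y \<in> X" shows "nrm (x + y) \<le> nrm x + nrm y"
proof (rule power2_le_imp_le)
  have "(nrm (x + y))\<^sup>2 = norm (ip x x + ip x y + (ip y x + ip y y))"
    unfolding ipnorm_sq using assms by (simp add: ip_add ip_add_left algebra_simps)
  also have "\<dots> \<le> (norm (ip x x) + norm (ip x y)) + (norm (ip y x) + norm (ip y y))"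
    by (intro norm_triangle_mono order_refl)
  also have "\<dots> \<le> ((nrm x)\<^sup>2 + nrm x * nrm y) + (nrm y * nrm x + (nrm y)\<^sup>2)"
    unfolding ipnorm_sq by (intro add_mono norm_ip_le assms order_refl)
  finally show "(nrm (x + y))\<^sup>2 \<le> (nrm x + nrm y)\<^sup>2" by (simp add: power2_eq_square algebra_simps)
qed simp

lemma nrm_zero [simp]: "nrm 0 = 0"
  unfolding ipnorm_def by simp

lemma nrm_minus: "x \<in> X \<Longrightarrow> nrm (- x) = nrm x"
  unfolding ipnorm_def by (simp add: ip_minus ip_minus_left)

lemma nrm_diff_commute: "x \<in> X \<Longrightarrow> y \<in> X \<Longrightarrow> nrm (x - y) = nrm (y - x)"
  using nrm_minus[of "x - y"] by simp

lemma nrm_diff_triangle: "x \<in> X \<Longrightarrow> y \<in> X \<Longrightarrow> z \<in> X \<Longrightarrow> nrm (x - z) \<le> nrm (x - y) + nrm (y - z)"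
  using nrm_triangle[of "x - y" "y - z"] by simp

lemma nrm_act: assumes "x \<in> X" shows "nrm (act x a) \<le> nrm x * norm a"
proof (rule power2_le_imp_le)
  have "norm (ip (act x a) (act x a)) \<le> norm (norm (ip x x) *\<^sub>R (st a * a))"
    by (rule pos_norm_le) (use assms in \<open>auto intro: ip_pos pos_ip_act_bound\<close>)
  then show "(nrm (act x a))\<^sup>2 \<le> (nrm x * norm a)\<^sup>2"
    by (simp add: ipnorm_sq power_mult_distrib cstar_identity)
qed simp

text \<open>Each further vector costs a factor 2 by the parallelogram identity, whose remaining term
  \<open>ip (W - w n) (W - w n)\<close> is positive. The resulting \<open>2 ^ n\<close> is absorbed
  by the step size \<tau> below.\<close>

lemma pos_sum_ip_bound:
  assumes "\<And>i. i < n \<Longrightarrow> w i \<in> X"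
  shows "pos ((2 ^ n) *\<^sub>R (\<Sum>i<n. ip (w i) (w i)) - ip (\<Sum>i<n. w i) (\<Sum>i<n. w i))"
  using assms
proof (induction n)
  case (Suc n)
  define W where "W = (\<Sum>i<n. w i)"
  define \<Sigma> where "\<Sigma> = (\<Sum>i<n. ip (w i) (w i))"
  have W: "W \<in> X" "w n \<in> X" unfolding W_def using Suc.prems by (auto intro!: sum_lessThan_X)
  have IH: "pos ((2 ^ n) *\<^sub>R \<Sigma> - ip W W)" unfolding W_def \<Sigma>_def using Suc by simp
  have "(2 ^ Suc n) *\<^sub>R (\<Sigma> + ip (w n) (w n)) - ip (W + w n) (W + w n)
     = 2 *\<^sub>R ((2 ^ n) *\<^sub>R \<Sigma> - ip W W) + ((2 ^ Suc n - 2) *\<^sub>R ip (w n) (w n) + ip (W - w n) (W - w n))"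
    using W by (simp add: ip_add ip_add_left ip_diff ip_diff_left scaleR_diff_right scaleR_add_right
        scaleR_diff_left scaleR_2 algebra_simps)
  moreover have "pos \<dots>"
    using W by (intro pos_add pos_scaleR IH ip_pos) (auto simp: self_le_power)
  ultimately show ?case by (simp add: W_def \<Sigma>_def)
qed simp

end

section \<open>Landweber iteration for a finite family of vectors\<close>

locale pre_hmod_family = pre_hmod cs st X act ip
  for cs :: "complex \<Rightarrow> 'a::{real_normed_algebra,banach} \<Rightarrow> 'a" and st :: "'a \<Rightarrow> 'a"
    and X :: "'x::ab_group_add set" and act :: "'x \<Rightarrow> 'a \<Rightarrow> 'x" and ip :: "'x \<Rightarrow> 'x \<Rightarrow> 'a" +
  fixes u :: "nat \<Rightarrow> 'x" and n :: nat and \<tau> :: real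
  assumes u_X: "\<And>i. i < n \<Longrightarrow> u i \<in> X"
    and tau_pos: "\<tau> > 0" and tau_le: "\<And>i. i < n \<Longrightarrow> 2 ^ n * \<tau> * norm (ip (u i) (u i)) \<le> 1"
begin

definition Q :: "'x \<Rightarrow> 'x" where "Q x = (\<Sum>i<n. act (u i) (\<tau> *\<^sub>R ip (u i) x))"
definition S :: "'x \<Rightarrow> 'x" where "S x = x - Q x"

lemma Q_X [simp]: "x \<in> X \<Longrightarrow> Q x \<in> X"
  unfolding Q_def using u_X by auto

lemma S_X [simp]: "x \<in> X \<Longrightarrow> S x \<in> X"
  unfolding S_def by simp

lemma S_pow_X [simp]: "x \<in> X \<Longrightarrow> (S ^^ k) x \<in> X"
  by (induction k) auto

lemma ip_Q: "x \<in> X \<Longrightarrow> y \<in> X \<Longrightarrow> ip x (Q y) = \<tau> *\<^sub>R (\<Sum>i<n. ip x (u i) * ip (u i) y)"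
  unfolding Q_def using u_X by (simp add: ip_sum_lessThan ip_act scaleR_right.sum)

lemma Q_selfadjoint: assumes "x \<in> X" "y \<in> X" shows "ip (Q x) y = ip x (Q y)"
proof -
  have "ip (Q x) y = st (ip y (Q x))" using assms by (simp add: ip_sym)
  also have "\<dots> = ip x (Q y)" using assms u_X by (simp add: ip_Q st_sum ip_sym)
  finally show ?thesis .
qed

lemma S_selfadjoint: "x \<in> X \<Longrightarrow> y \<in> X \<Longrightarrow> ip (S x) y = ip x (S y)"
  unfolding S_def by (simp add: ip_diff ip_diff_left Q_selfadjoint)

lemma S_pow_selfadjoint: "x \<in> X \<Longrightarrow> y \<in> X \<Longrightarrow> ip ((S ^^ k) x) y = ip x ((S ^^ k) y)"
  by (induction k arbitrary: x y) (simp_all add: S_selfadjoint flip: funpow_swap1)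

lemma pos_ip_Q: assumes "x \<in> X" shows "pos (ip x (Q x))"
proof -
  have "pos (ip x (u i) * ip (u i) x)" if "i < n" for i
    using pos_mult_self[of "ip (u i) x"] assms u_X[OF that] by (simp add: ip_sym)
  then show ?thesis using assms tau_pos by (auto simp: ip_Q intro!: pos_scaleR pos_sum)
qed

text \<open>In operator terms \<open>Q Q \<le> Q\<close>. This is what the step size is made for:
  \<open>pos_sum_ip_bound\<close> costs \<open>2 ^ n\<close>, each summand costs the norm of
  \<open>ip (u i) (u i)\<close>, and \<open>tau_le\<close> pays for both.\<close>

lemma pos_Q_minus_QQ: assumes "x \<in> X" shows "pos (ip x (Q x) - ip (Q x) (Q x))"
proof -
  let ?w = "\<lambda>i. act (u i) (\<tau> *\<^sub>R ip (u i) x)"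
  have w: "i < n \<Longrightarrow> ?w i \<in> X" for i using u_X by simp
  have 1: "pos ((2 ^ n) *\<^sub>R (\<Sum>i<n. ip (?w i) (?w i)) - ip (Q x) (Q x))"
    unfolding Q_def by (rule pos_sum_ip_bound) (use w in auto)
  have "pos (\<Sum>i<n. \<tau> *\<^sub>R (ip x (u i) * ip (u i) x) - (2 ^ n) *\<^sub>R ip (?w i) (?w i))"
  proof (rule pos_sum)
    fix i assume "i \<in> {..<n}"
    then have i: "i < n" by simp
    let ?a = "\<tau> *\<^sub>R ip (u i) x"
    have "norm (ip (u i) (u i)) \<le> 1 / (2 ^ n * \<tau>)" using tau_le[OF i] tau_pos by (simp add: field_simps)
    then have "pos ((1 / (2 ^ n * \<tau>)) *\<^sub>R (st ?a * ?a) - ip (?w i) (?w i))"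
      by (rule pos_ip_act_bound[OF u_X[OF i]])
    then have "pos ((2 ^ n) *\<^sub>R ((1 / (2 ^ n * \<tau>)) *\<^sub>R (st ?a * ?a) - ip (?w i) (?w i)))"
      by (rule pos_scaleR) simp
    moreover have "(2 ^ n) *\<^sub>R ((1 / (2 ^ n * \<tau>)) *\<^sub>R (st ?a * ?a) - ip (?w i) (?w i))
        = \<tau> *\<^sub>R (ip x (u i) * ip (u i) x) - (2 ^ n) *\<^sub>R ip (?w i) (?w i)"
      using tau_pos assms u_X[OF i] by (simp add: scaleR_diff_right ip_sym)
    ultimately show "pos (\<tau> *\<^sub>R (ip x (u i) * ip (u i) x) - (2 ^ n) *\<^sub>R ip (?w i) (?w i))" by simp
  qed
  then have "pos (ip x (Q x) - (2 ^ n) *\<^sub>R (\<Sum>i<n. ip (?w i) (?w i)))"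
    using assms by (simp add: ip_Q sum_subtractf scaleR_right.sum)
  from pos_add[OF this 1] show ?thesis by simp
qed

lemma pos_one_minus_Q: assumes "x \<in> X" shows "pos (ip x x - ip x (Q x))"
proof -
  have "ip x x - ip x (Q x) = ip (S x) (S x) + (ip x (Q x) - ip (Q x) (Q x))"
    unfolding S_def using assms by (simp add: ip_diff ip_diff_left Q_selfadjoint)
  then show ?thesis using pos_add[OF ip_pos[of "S x"] pos_Q_minus_QQ] assms by simp
qed

lemma pos_S_step: assumes "x \<in> X" shows "pos (ip x x - ip (S x) (S x) - ip x (Q x))"
proof -
  have "ip x x - ip (S x) (S x) - ip x (Q x) = ip x (Q x) - ip (Q x) (Q x)"
    unfolding S_def using assms by (simp add: ip_diff ip_diff_left Q_selfadjoint)
  then show ?thesis using pos_Q_minus_QQ[OF assms] by simp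
qed

lemma pos_Q_decreasing: assumes "x \<in> X" shows "pos (ip x (Q x) - ip (S x) (Q (S x)))"
proof -
  have "Q (S x) = Q x - Q (Q x)"
    by (rule ip_eqI) (use assms in \<open>auto simp: S_def ip_diff Q_selfadjoint[symmetric]\<close>)
  then have "ip x (Q x) - ip (S x) (Q (S x)) = ip (Q x) (Q x) + (ip (Q x) (Q x) - ip (Q x) (Q (Q x)))"
    unfolding S_def using assms by (simp add: ip_diff ip_diff_left Q_selfadjoint)
  then show ?thesis using pos_add[OF ip_pos[of "Q x"] pos_one_minus_Q[of "Q x"]] assms by simp
qed

text \<open>By \<open>pos_S_step\<close> one application of \<open>S\<close> to \<open>y\<close>
  lowers \<open>ip y y\<close> by at least \<open>ip y (Q y)\<close>, and by
  \<open>pos_Q_decreasing\<close> these amounts shrink along the iteration. The total loss over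
  \<open>k\<close> steps is therefore at least \<open>k\<close> times the amount at the end.\<close>

lemma pos_S_pow:
  assumes "x \<in> X"
  shows "pos (ip x x - ip ((S ^^ k) x) ((S ^^ k) x) - real k *\<^sub>R ip ((S ^^ k) x) (Q ((S ^^ k) x)))"
proof (induction k)
  case (Suc k)
  define y where "y = (S ^^ k) x"
  have y: "y \<in> X" unfolding y_def using assms by simp
  have "ip x x - ip (S y) (S y) - real (Suc k) *\<^sub>R ip (S y) (Q (S y))
      = (ip x x - ip y y - real k *\<^sub>R ip y (Q y)) + (ip y y - ip (S y) (S y) - ip y (Q y))
        + real (Suc k) *\<^sub>R (ip y (Q y) - ip (S y) (Q (S y)))"
    by (simp add: algebra_simps)
  moreover have "pos \<dots>"
    using Suc y by (intro pos_add pos_scaleR pos_S_step pos_Q_decreasing) (auto simp: y_def)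
  ultimately have "pos (ip x x - ip (S y) (S y) - real (Suc k) *\<^sub>R ip (S y) (Q (S y)))" by (simp only:)
  then show ?case by (simp add: y_def)
qed (use assms in simp)

lemma pos_S_pow_contractive:
  assumes "x \<in> X" shows "pos (ip x x - ip ((S ^^ k) x) ((S ^^ k) x))"
proof -
  have "pos (real k *\<^sub>R ip ((S ^^ k) x) (Q ((S ^^ k) x)))"
    using assms by (intro pos_scaleR pos_ip_Q) auto
  from pos_add[OF pos_S_pow[OF assms, of k] this] show ?thesis by simp
qed

text \<open>\<open>ip y (Q y)\<close> is \<tau> times a sum of positive terms, one for each
  \<open>u i\<close>, so the bound of \<open>pos_S_pow\<close> holds for every single term. The
  inner products with the family thus decay like \<open>1 / sqrt k\<close>.\<close>

lemma norm_ip_S_pow: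
  assumes "x \<in> X" "i < n"
  shows "real k * \<tau> * (norm (ip (u i) ((S ^^ k) x)))\<^sup>2 \<le> norm (ip x x)"
proof -
  let ?y = "(S ^^ k) x"
  have y: "?y \<in> X" using assms by simp
  have "pos (real k *\<^sub>R ip ?y (Q ?y))" using y by (intro pos_scaleR pos_ip_Q) auto
  moreover have "pos (ip x x - real k *\<^sub>R ip ?y (Q ?y))"
    using pos_add[OF pos_S_pow[OF assms(1)] ip_pos[OF y], of k] by simp
  ultimately have 1: "norm (real k *\<^sub>R ip ?y (Q ?y)) \<le> norm (ip x x)" by (rule pos_norm_le)
  have p: "pos (ip ?y (u j) * ip (u j) ?y)" if "j < n" for j
    using pos_mult_self[of "ip (u j) ?y"] y u_X[OF that] by (simp add: ip_sym)
  have "norm (ip ?y (u i) * ip (u i) ?y) \<le> norm (\<Sum>j<n. ip ?y (u j) * ip (u j) ?y)"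
  proof (rule pos_norm_le[OF p[OF assms(2)]])
    have "(\<Sum>j<n. ip ?y (u j) * ip (u j) ?y) - ip ?y (u i) * ip (u i) ?y
        = (\<Sum>j\<in>{..<n} - {i}. ip ?y (u j) * ip (u j) ?y)"
      using assms(2) by (simp add: sum_diff1)
    then show "pos ((\<Sum>j<n. ip ?y (u j) * ip (u j) ?y) - ip ?y (u i) * ip (u i) ?y)"
      using p by (auto intro: pos_sum)
  qed
  moreover have "norm (ip ?y (u i) * ip (u i) ?y) = (norm (ip (u i) ?y))\<^sup>2"
    using cstar_identity[of "ip (u i) ?y"] y u_X[OF assms(2)] by (simp add: ip_sym)
  ultimately have "real k * \<tau> * (norm (ip (u i) ?y))\<^sup>2 \<le> real k * \<tau> * norm (\<Sum>j<n. ip ?y (u j) * ip (u j) ?y)"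
    using tau_pos by (intro mult_left_mono) auto
  also have "\<dots> = norm (real k *\<^sub>R ip ?y (Q ?y))" using y tau_pos by (simp add: ip_Q)
  finally show ?thesis using 1 by simp
qed

text \<open>The residual at each stage has inner products in the left ideal \<open>J\<close>, and
  multiples of these are added to the coefficients. With \<open>J = I\<close> this keeps the
  combination in the ideal part of the module.\<close>

lemma S_pow_combination:
  assumes "t \<in> X" "subspace J" "\<And>a x. x \<in> J \<Longrightarrow> a * x \<in> J" "\<And>i. i < n \<Longrightarrow> ip (u i) t \<in> J"
  shows "\<exists>c. (\<forall>i<n. c i \<in> J) \<and> (S ^^ k) t = t - (\<Sum>i<n. act (u i) (c i))"
proof (induction k)
  case 0
  show ?case using assms(2) u_X by (intro exI[of _ "\<lambda>_. 0"]) (auto simp: subspace_0 act_zero)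
next
  case (Suc k)
  then obtain c where c: "\<And>i. i < n \<Longrightarrow> c i \<in> J" "(S ^^ k) t = t - (\<Sum>i<n. act (u i) (c i))" by blast
  define d where "d = (\<lambda>i. ip (u i) ((S ^^ k) t))"
  have dJ: "d i \<in> J" if "i < n" for i
  proof -
    have "d i = ip (u i) t - (\<Sum>j<n. ip (u i) (u j) * c j)"
      unfolding d_def c(2) using assms(1) u_X that by (simp add: ip_diff ip_sum_lessThan ip_act)
    then show ?thesis using assms c that by (auto intro!: subspace_diff subspace_sum)
  qed
  have "(S ^^ Suc k) t = t - (\<Sum>i<n. act (u i) (c i)) - (\<Sum>i<n. act (u i) (\<tau> *\<^sub>R d i))"
    by (simp add: S_def[of "(S ^^ k) t"] c(2)[symmetric] Q_def d_def)
  also have "\<dots> = t - (\<Sum>i<n. act (u i) (c i + \<tau> *\<^sub>R d i))"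
    using u_X by (simp add: act_add sum.distrib)
  finally show ?case using c dJ assms(2)
    by (intro exI[of _ "\<lambda>i. c i + \<tau> *\<^sub>R d i"]) (auto intro: subspace_add subspace_scale)
qed

end

context pre_hmod
begin

text \<open>Landweber iteration: with \<open>S = 1 - \<tau> \<Sum>\<^sub>i u\<^sub>i \<langle>u\<^sub>i, -\<rangle>\<close> the vector \<open>t - S\<^sup>2\<^sup>h t\<close> replaces the
  orthogonal projection of \<open>t\<close> onto the closed submodule generated by the \<open>u\<^sub>i\<close>, which need not exist.\<close>
lemma approximate_projection:
  fixes n :: nat
  assumes u: "\<And>i. i < n \<Longrightarrow> u i \<in> X" and t: "t \<in> X"
    and J: "subspace J" "\<And>a x. x \<in> J \<Longrightarrow> a * x \<in> J" "\<And>i. i < n \<Longrightarrow> ip (u i) t \<in> J" and e: "e > 0"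
  obtains c where "\<And>i. i < n \<Longrightarrow> c i \<in> J"
    "\<And>i. i < n \<Longrightarrow> norm (ip (u i) (t - (\<Sum>i<n. act (u i) (c i)))) \<le> e"
    "pos (ip t t - ip (\<Sum>i<n. act (u i) (c i)) (\<Sum>i<n. act (u i) (c i)))"
proof -
  \<comment> \<open>\<open>B\<close> dominates all the norms and is positive even for
    \<open>n = 0\<close>, so \<open>1 / (2 ^ n * B)\<close> is an admissible step size.\<close>
  define B where "B = 1 + (\<Sum>i<n. norm (ip (u i) (u i)))"
  have B: "B > 0" unfolding B_def by (intro add_pos_nonneg sum_nonneg) auto
  define \<tau> where "\<tau> = 1 / (2 ^ n * B)"
  interpret pre_hmod_family cs st X act ip u n \<tau>
  proof
    show "\<tau> > 0" unfolding \<tau>_def using B by simp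
    fix i assume i: "i < n"
    have "norm (ip (u i) (u i)) \<le> (\<Sum>i<n. norm (ip (u i) (u i)))"
      using i by (intro member_le_sum) auto
    then have "norm (ip (u i) (u i)) \<le> B" unfolding B_def by simp
    then show "2 ^ n * \<tau> * norm (ip (u i) (u i)) \<le> 1" unfolding \<tau>_def using B by simp
  qed (rule u)
  obtain h :: nat where "real h > norm (ip t t) / (2 * \<tau> * e\<^sup>2)" using reals_Archimedean2 by blast
  then have h: "norm (ip t t) \<le> real (2 * h) * \<tau> * e\<^sup>2"
    using tau_pos e by (simp add: field_simps less_imp_le)
  have hp: "norm (ip (u i) ((S ^^ (2 * h)) t)) \<le> e" if "i < n" for i
  \<comment> \<open>For \<open>h = 0\<close> the decay estimate says nothing, but then the bound on
    \<open>ip t t\<close> gives \<open>t = 0\<close>.\<close>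
  proof (cases "h = 0")
    case True
    then have "ip t t = 0" using h by simp
    then have "t = 0" using ip_self_zero t by blast
    then have "S t = t" unfolding S_def Q_def using u by (simp add: act_zero)
    then show ?thesis using True \<open>t = 0\<close> u[OF that] e by simp
  next
    case False
    have "real (2 * h) * \<tau> * (norm (ip (u i) ((S ^^ (2 * h)) t)))\<^sup>2 \<le> real (2 * h) * \<tau> * e\<^sup>2"
      using norm_ip_S_pow[OF t that, of "2 * h"] h by linarith
    moreover have "real (2 * h) * \<tau> > 0" using False tau_pos by simp
    ultimately have "(norm (ip (u i) ((S ^^ (2 * h)) t)))\<^sup>2 \<le> e\<^sup>2" by (simp only: mult_le_cancel_left_pos)
    then show ?thesis by (rule power2_le_imp_le) (use e in simp)
  qed
  obtain c where c: "\<And>i. i < n \<Longrightarrow> c i \<in> J" "(S ^^ (2 * h)) t = t - (\<Sum>i<n. act (u i) (c i))"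
    using S_pow_combination[OF t J, of "2 * h"] by auto
  define y z where "y = (S ^^ h) t" and "z = (S ^^ (2 * h)) t"
  have yz: "y \<in> X" "z \<in> X" "z = (S ^^ h) y" unfolding y_def z_def using t by (simp_all add: mult_2 funpow_add)
  have cz: "(\<Sum>i<n. act (u i) (c i)) = t - z" unfolding z_def c(2) by simp
  \<comment> \<open>This is why the number of steps is even: \<open>S\<close> is selfadjoint, so the
    inner product of \<open>t\<close> with \<open>(S ^^ (2 * h)) t\<close> is the positive element
    \<open>ip y y\<close> for the halfway vector \<open>y\<close>.\<close>
  have tz: "ip t z = ip y y" "ip z t = ip y y"
    unfolding yz(3) using S_pow_selfadjoint[of t y h] S_pow_selfadjoint[of y t h] t yz(1) by (simp_all add: y_def)
  have "ip t t - ip (t - z) (t - z) = ip y y + (ip y y - ip z z)"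
    using t yz tz by (simp add: ip_diff ip_diff_left)
  moreover have "pos \<dots>"
    unfolding yz(3) by (rule pos_add[OF ip_pos pos_S_pow_contractive]) (use yz in auto)
  ultimately have "pos (ip t t - ip (t - z) (t - z))" by simp
  then show ?thesis using hp c(1) by (intro that[of c]) (simp_all add: cz z_def)
qed

end

section \<open>The ideal and its sequence module\<close>

locale cstar_ideal = cstar cs st
  for cs :: "complex \<Rightarrow> 'a::{real_normed_algebra,banach} \<Rightarrow> 'a" and st :: "'a \<Rightarrow> 'a" +
  fixes I :: "'a set"
  assumes ideal: "closed_ideal cs I" and sigma_unital: "sigma_unital st I"
begin

lemma I_closed: "closed I" and I_zero [simp]: "0 \<in> I"
  and I_add: "x \<in> I \<Longrightarrow> y \<in> I \<Longrightarrow> x + y \<in> I"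
  and I_cs: "x \<in> I \<Longrightarrow> cs c x \<in> I"
  and I_mult_left: "x \<in> I \<Longrightarrow> a * x \<in> I" and I_mult_right: "x \<in> I \<Longrightarrow> x * a \<in> I"
  using ideal unfolding closed_ideal_def by auto

lemma I_scaleR: "x \<in> I \<Longrightarrow> r *\<^sub>R x \<in> I"
  using I_cs[of x "complex_of_real r"] by (simp add: cs_of_real)

lemma subspace_I: "subspace I"
  unfolding subspace_def using I_add I_scaleR by auto

lemma I_minus: "x \<in> I \<Longrightarrow> - x \<in> I" and I_diff: "x \<in> I \<Longrightarrow> y \<in> I \<Longrightarrow> x - y \<in> I"
  using subspace_I by (auto simp: subspace_neg subspace_diff)

definition eu :: "nat \<Rightarrow> 'a" where
  "eu = (SOME e. (\<forall>n. e n \<in> I \<and> pos (e n) \<and> norm (e n) \<le> 1 \<and> pos (e (Suc n) - e n)) \<and>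
    (\<forall>x\<in>I. (\<lambda>n. e n * x) \<longlonglongrightarrow> x \<and> (\<lambda>n. x * e n) \<longlonglongrightarrow> x))"

lemma eu_all: "(\<forall>n. eu n \<in> I \<and> pos (eu n) \<and> norm (eu n) \<le> 1 \<and> pos (eu (Suc n) - eu n)) \<and>
    (\<forall>x\<in>I. (\<lambda>n. eu n * x) \<longlonglongrightarrow> x \<and> (\<lambda>n. x * eu n) \<longlonglongrightarrow> x)"
  using sigma_unital unfolding sigma_unital_def eu_def by (rule someI_ex)

lemma eu_I: "eu n \<in> I" and eu_norm: "norm (eu n) \<le> 1" and eu_st [simp]: "st (eu n) = eu n"
  using eu_all pos_selfadjoint by auto

lemma eu_left: "x \<in> I \<Longrightarrow> (\<lambda>n. eu n * x) \<longlonglongrightarrow> x" and eu_right: "x \<in> I \<Longrightarrow> (\<lambda>n. x * eu n) \<longlonglongrightarrow> x"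
  using eu_all by auto

lemma eu_right_diff: "x \<in> I \<Longrightarrow> (\<lambda>n. x - x * eu n) \<longlonglongrightarrow> 0"
  using tendsto_diff[OF tendsto_const eu_right, of x x] by simp

text \<open>With a unit, the sequence would be \<open>(1 - eu n) * x * (1 - eu n)\<close>; this is
  how the diagonal defects of the construction shrink.\<close>

lemma eu_sandwich: assumes "x \<in> I" shows "(\<lambda>n. (x - x * eu n) - eu n * (x - x * eu n)) \<longlonglongrightarrow> 0"
proof (rule Lim_null_comparison)
  have "norm ((x - x * eu n) - eu n * (x - x * eu n)) \<le> 2 * norm (x - x * eu n)" for n
  proof -
    have "norm (eu n * (x - x * eu n)) \<le> norm (eu n) * norm (x - x * eu n)" by (rule norm_mult_ineq)
    also have "\<dots> \<le> 1 * norm (x - x * eu n)" by (intro mult_right_mono eu_norm) simp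
    finally show ?thesis using norm_triangle_ineq4[of "x - x * eu n" "eu n * (x - x * eu n)"] by simp
  qed
  then show "\<forall>\<^sub>F n in sequentially. norm ((x - x * eu n) - eu n * (x - x * eu n)) \<le> 2 * norm (x - x * eu n)"
    by simp
  show "(\<lambda>n. 2 * norm (x - x * eu n)) \<longlonglongrightarrow> 0"
    using tendsto_mult[OF tendsto_const tendsto_norm_zero[OF eu_right_diff[OF assms]], of 2] by simp
qed

lemma I_limit: "(\<And>n. f n \<in> I) \<Longrightarrow> f \<longlonglongrightarrow> x \<Longrightarrow> x \<in> I"
  using I_closed closed_sequentially by blast

text \<open>\<open>st (x * eu n)\<close> equals \<open>eu n * st x\<close>, which lies in
  \<open>I\<close> because \<open>eu n\<close> does, and \<open>I\<close> is closed.\<close>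

lemma I_st: assumes "x \<in> I" shows "st x \<in> I"
proof -
  have "(\<lambda>n. st (x * eu n)) \<longlonglongrightarrow> st x" by (intro tendsto_st eu_right assms)
  then have "(\<lambda>n. eu n * st x) \<longlonglongrightarrow> st x" by simp
  moreover have "eu n * st x \<in> I" for n using eu_I I_mult_right by blast
  ultimately show ?thesis by (rule I_limit[rotated])
qed

text \<open>The squared norm of \<open>b - b * eu n\<close> is the norm of the sandwich of
  \<open>st b * b\<close>, hence tends to 0, and \<open>b\<close> is a limit of the elements
  \<open>b * eu n\<close> of \<open>I\<close>.\<close>

lemma st_mult_self_I: assumes "st b * b \<in> I" shows "b \<in> I"
proof -
  have "(norm (b - b * eu n))\<^sup>2 = norm ((st b * b - st b * b * eu n) - eu n * (st b * b - st b * b * eu n))" for n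
    by (simp add: algebra_simps flip: cstar_identity)
  then have "(\<lambda>n. (norm (b - b * eu n))\<^sup>2) \<longlonglongrightarrow> 0"
    using tendsto_norm_zero[OF eu_sandwich[OF assms]] by simp
  then have "(\<lambda>n. sqrt ((norm (b - b * eu n))\<^sup>2)) \<longlonglongrightarrow> sqrt 0" by (rule tendsto_real_sqrt)
  then have "(\<lambda>n. b - b * eu n) \<longlonglongrightarrow> 0" by (simp add: tendsto_norm_zero_iff)
  then have "(\<lambda>n. b - (b - b * eu n)) \<longlonglongrightarrow> b - 0" by (intro tendsto_intros)
  then have "(\<lambda>n. b * eu n) \<longlonglongrightarrow> b" by simp
  moreover have "b * eu n \<in> I" for n using eu_I I_mult_left by blast
  ultimately show ?thesis by (rule I_limit[rotated])
qed

lemma pos_I_sqrt: assumes "pos e" "e \<in> I" obtains b where "b \<in> I" "st b * b = e"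
  using assms st_mult_self_I unfolding positive_el_def by metis

text \<open>Order domination controls the Cauchy sections. Comparing norms term by term would ask
  for absolute convergence, which the series defining \<open>l2\<close> need not have.\<close>

lemma summable_pos_comparison:
  assumes "\<And>k. pos (a k)" "\<And>k. pos (b k - a k)" "summable b" shows "summable a"
  unfolding summable_Cauchy
proof (intro allI impI)
  fix e :: real assume "e > 0"
  then obtain N where N: "\<And>m n. m \<ge> N \<Longrightarrow> norm (sum b {m..<n}) < e"
    using assms(3) unfolding summable_Cauchy by blast
  have "norm (sum a {m..<n}) \<le> norm (sum b {m..<n})" for m n
    by (rule pos_norm_le) (auto intro!: pos_sum assms simp flip: sum_subtractf)
  then show "\<exists>N. \<forall>m\<ge>N. \<forall>n. norm (sum a {m..<n}) < e" using N by (meson le_less_trans)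
qed

section \<open>The sequence module \<open>l2(I)\<close>\<close>

abbreviation L2 :: "(nat \<Rightarrow> 'a) set" where "L2 \<equiv> l2 st I"

lemma pos_mult_add_bound: "pos (2 *\<^sub>R (st x * x) + 2 *\<^sub>R (st y * y) - st (x + y) * (x + y))"
proof -
  have "2 *\<^sub>R (st x * x) + 2 *\<^sub>R (st y * y) - st (x + y) * (x + y) = st (x - y) * (x - y)"
    by (simp add: algebra_simps scaleR_2)
  then show ?thesis using pos_mult_self[of "x - y"] by (simp del: st_diff)
qed

lemma L2_add: assumes "x \<in> L2" "y \<in> L2" shows "(\<lambda>k. x k + y k) \<in> L2"
proof -
  have "summable (\<lambda>k. 2 *\<^sub>R (st (x k) * x k) + 2 *\<^sub>R (st (y k) * y k))"
    using assms unfolding l2_def by (auto intro!: summable_add summable_scaleR_right)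
  then have "summable (\<lambda>k. st (x k + y k) * (x k + y k))"
    by (rule summable_pos_comparison[OF pos_mult_self pos_mult_add_bound])
  then show ?thesis using assms unfolding l2_def by (auto simp: I_add)
qed

lemma L2_cs: assumes "x \<in> L2" shows "(\<lambda>k. cs \<i> (x k)) \<in> L2"
proof -
  have "st (cs \<i> z) * cs \<i> z = st z * z" for z
    using cs_of_real[of 1] by (simp add: st_cs cs_mult_left cs_mult_right flip: cs_mult)
  then show ?thesis using assms unfolding l2_def by (auto simp: I_cs)
qed

lemma L2_minus: assumes "x \<in> L2" shows "(\<lambda>k. - x k) \<in> L2"
  using assms unfolding l2_def by (auto simp: I_minus)

lemma L2_scaleR: assumes "x \<in> L2" shows "(\<lambda>k. r *\<^sub>R x k) \<in> L2"
  using assms unfolding l2_def by (auto simp: I_scaleR intro!: summable_scaleR_right)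

lemma L2_act: assumes "x \<in> L2" shows "(\<lambda>k. x k * a) \<in> L2"
proof -
  have "summable (\<lambda>k. st a * (st (x k) * x k) * a)"
    using assms unfolding l2_def by (auto intro!: summable_mult summable_mult2)
  then show ?thesis using assms unfolding l2_def by (auto simp: I_mult_right mult.assoc)
qed

lemma bounded_linear_cs: "bounded_linear (cs c)"
  by (rule bounded_linear_intro[where K = "cmod c"]) (auto simp: cs_add_right cs_scaleR norm_cs)

text \<open>Polarization writes \<open>st a * b\<close> through the squares of \<open>a + b\<close>,
  \<open>a - b\<close>, \<open>a + cs \<i> b\<close> and \<open>a - cs \<i> b\<close>, and each of
  these yields a summable series.\<close>

lemma L2_summable: assumes x: "x \<in> L2" and y: "y \<in> L2" shows "summable (\<lambda>k. st (x k) * y k)"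
proof -
  define q where "q = (\<lambda>z::'a. st z * z)"
  have s: "summable (\<lambda>k. q (x k + z k))" "summable (\<lambda>k. q (x k - z k))" if "z \<in> L2" for z
    using L2_add[OF x that] L2_add[OF x L2_minus[OF that]] unfolding l2_def q_def by auto
  have "st a * b = (1/4) *\<^sub>R ((q (a + b) - q (a - b)) - cs \<i> (q (a + cs \<i> b) - q (a - cs \<i> b)))" for a b
  proof -
    have 1: "q (a + b) - q (a - b) = 2 *\<^sub>R (st a * b + st b * a)"
      unfolding q_def by (simp add: algebra_simps scaleR_2)
    have 2: "q (a + cs \<i> b) - q (a - cs \<i> b) = 2 *\<^sub>R cs \<i> (st a * b - st b * a)"
    proof -
      have "cs \<i> (st a * b - st b * a) = st a * cs \<i> b + st (cs \<i> b) * a"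
        using linear_diff[OF bounded_linear.linear[OF bounded_linear_cs]]
        by (simp add: cs_mult_right st_cs cs_mult_left cs_minus)
      then show ?thesis unfolding q_def by (simp add: algebra_simps scaleR_2)
    qed
    have 3: "cs \<i> (2 *\<^sub>R cs \<i> z) = - 2 *\<^sub>R z" for z
      using cs_of_real[of "-1" z] by (simp add: cs_scaleR flip: cs_mult)
    have "2 *\<^sub>R (st a * b + st b * a) - - 2 *\<^sub>R (st a * b - st b * a) = 4 *\<^sub>R (st a * b)"
      by (simp add: scaleR_add_right scaleR_diff_right flip: scaleR_add_left)
    then show ?thesis unfolding 1 2 3 by simp
  qed
  then have "(\<lambda>k. st (x k) * y k) = (\<lambda>k. (1/4) *\<^sub>R ((q (x k + y k) - q (x k - y k))
      - cs \<i> (q (x k + cs \<i> (y k)) - q (x k - cs \<i> (y k)))))" by blast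
  moreover have "summable \<dots>"
    by (intro summable_scaleR_right summable_diff bounded_linear.summable[OF bounded_linear_cs] s y L2_cs[OF y])
  ultimately show ?thesis by simp
qed

lemma L2_zero: "0 \<in> L2"
  unfolding l2_def by simp

lemma l2_ip_self_zero: assumes "x \<in> L2" "l2_ip st x x = 0" shows "x = 0"
proof
  fix k
  have s: "summable (\<lambda>k. st (x k) * x k)" using assms unfolding l2_def by simp
  have "norm (st (x k) * x k) \<le> norm (\<Sum>i<n. st (x i) * x i)" if "n > k" for n
  proof (rule pos_norm_le)
    have "(\<Sum>i<n. st (x i) * x i) - st (x k) * x k = (\<Sum>i\<in>{..<n} - {k}. st (x i) * x i)"
      using that by (simp add: sum_diff1)
    then show "pos ((\<Sum>i<n. st (x i) * x i) - st (x k) * x k)" by (auto intro: pos_sum)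
  qed simp
  then have "\<forall>\<^sub>F n in sequentially. norm (st (x k) * x k) \<le> norm (\<Sum>i<n. st (x i) * x i)"
    unfolding eventually_sequentially by (auto intro!: exI[of _ "Suc k"])
  moreover have "(\<lambda>n. norm (\<Sum>i<n. st (x i) * x i)) \<longlonglongrightarrow> norm (0::'a)"
    using summable_LIMSEQ[OF s] assms(2) unfolding l2_ip_def by (intro tendsto_norm) simp
  ultimately have "norm (st (x k) * x k) \<le> norm (0::'a)" by (intro tendsto_lowerbound[where F = sequentially]) auto
  then have "st (x k) * x k = 0" by simp
  from st_mult_self_zero[OF this] show "x k = 0 k" by simp
qed

sublocale l2: pre_hmod cs st L2 "\<lambda>x a k. x k * a" "l2_ip st"
proof
  show "0 \<in> L2" by (rule L2_zero)
next
  fix x y z :: "nat \<Rightarrow> 'a" and a assume x: "x \<in> L2"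
  show "- x \<in> L2" using L2_minus[OF x] by (simp add: fun_Compl_def)
  show "(\<lambda>k. x k * a) \<in> L2" by (rule L2_act[OF x])
  show "l2_ip st x x = 0 \<Longrightarrow> x = 0" using l2_ip_self_zero[OF x] .
  show "pos (l2_ip st x x)"
    unfolding l2_ip_def by (rule pos_limit[OF _ summable_LIMSEQ[OF L2_summable[OF x x]]]) (auto intro: pos_sum)
  assume y: "y \<in> L2"
  show "x + y \<in> L2" using L2_add[OF x y] by (simp add: plus_fun_def)
  show "l2_ip st x (\<lambda>k. y k * a) = l2_ip st x y * a"
    unfolding l2_ip_def using suminf_mult2[OF L2_summable[OF x y], of a] by (simp add: mult.assoc)
  have "bounded_linear st" by (rule bounded_linear_intro[where K=1]) auto
  from bounded_linear.suminf[OF this L2_summable[OF x y]]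
  show "st (l2_ip st x y) = l2_ip st y x" unfolding l2_ip_def by simp
  assume z: "z \<in> L2"
  show "l2_ip st x (y + z) = l2_ip st x y + l2_ip st x z"
    unfolding l2_ip_def using suminf_add[OF L2_summable[OF x y] L2_summable[OF x z]]
    by (simp add: distrib_left)
qed

lemma norm_coord_le: assumes "x \<in> L2" shows "norm (x k) \<le> ipnorm (l2_ip st) x"
  and sum_le_l2_norm: "norm (\<Sum>i<n. st (x i) * x i) \<le> (ipnorm (l2_ip st) x)\<^sup>2"
proof -
  have s: "summable (\<lambda>k. st (x k) * x k)" using assms unfolding l2_def by simp
  have *: "norm (\<Sum>i<n. st (x i) * x i) \<le> norm (\<Sum>i<n + m. st (x i) * x i)" for n m
  proof (rule pos_norm_le)
    have "(\<Sum>i<n + m. st (x i) * x i) - (\<Sum>i<n. st (x i) * x i) = (\<Sum>i\<in>{n..<n + m}. st (x i) * x i)"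
      using sum_diff_nat_ivl[of 0 n "n + m" "\<lambda>i. st (x i) * x i"] by (simp add: atLeast0LessThan)
    then show "pos ((\<Sum>i<n + m. st (x i) * x i) - (\<Sum>i<n. st (x i) * x i))" by (auto intro: pos_sum)
  qed (auto intro: pos_sum)
  have lim: "(\<lambda>m. norm (\<Sum>i<m. st (x i) * x i)) \<longlonglongrightarrow> norm (l2_ip st x x)"
    using summable_LIMSEQ[OF s] unfolding l2_ip_def by (rule tendsto_norm)
  show 1: "norm (\<Sum>i<n. st (x i) * x i) \<le> (ipnorm (l2_ip st) x)\<^sup>2" for n
    unfolding ipnorm_sq
    by (rule tendsto_lowerbound[OF lim])
       (auto simp: eventually_sequentially intro!: exI[of _ n], metis * le_add_diff_inverse)
  have "norm (st (x k) * x k) \<le> norm (\<Sum>i<Suc k. st (x i) * x i)"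
    by (rule pos_norm_le) (auto intro: pos_sum)
  then have "(norm (x k))\<^sup>2 \<le> (ipnorm (l2_ip st) x)\<^sup>2"
    using 1[of "Suc k"] unfolding cstar_identity by linarith
  then show "norm (x k) \<le> ipnorm (l2_ip st) x" by (rule power2_le_imp_le) simp
qed

lemma l2_norm_diff_bound:
  assumes "\<And>n. norm (\<Sum>i<n. st (x i - y i) * (x i - y i)) \<le> r\<^sup>2" "y \<in> L2" "x \<in> L2" "r \<ge> 0"
  shows "ipnorm (l2_ip st) (x - y) \<le> r"
proof (rule power2_le_imp_le)
  have xy: "x - y \<in> L2" using assms by simp
  have "(\<lambda>m. norm (\<Sum>i<m. st (x i - y i) * (x i - y i))) \<longlonglongrightarrow> norm (l2_ip st (x - y) (x - y))"
    using summable_LIMSEQ[OF L2_summable[OF xy xy]] unfolding l2_ip_def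
    by (intro tendsto_norm) simp
  then show "(ipnorm (l2_ip st) (x - y))\<^sup>2 \<le> r\<^sup>2"
    unfolding ipnorm_sq by (rule tendsto_upperbound) (use assms in auto)
qed (rule assms)

text \<open>The candidate is the coordinatewise limit. The Cauchy bound passes to it on finite sets
  of coordinates, uniformly in the set (\<open>bd\<close>), and this gives both membership in
  \<open>L2\<close> and convergence in norm.\<close>

lemma L2_complete:
  assumes f: "\<And>n. f n \<in> L2" and C: "\<And>e. e > 0 \<Longrightarrow> \<exists>N. \<forall>m\<ge>N. \<forall>n\<ge>N. ipnorm (l2_ip st) (f m - f n) < e"
  obtains x where "x \<in> L2" "(\<lambda>n. ipnorm (l2_ip st) (f n - x)) \<longlonglongrightarrow> 0"
proof -
  have fd: "f m - f n \<in> L2" for m n using f by simp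
  have "Cauchy (\<lambda>n. f n k)" for k
  proof (rule CauchyI)
    fix e :: real assume "e > 0"
    then obtain N where "\<forall>m\<ge>N. \<forall>n\<ge>N. ipnorm (l2_ip st) (f m - f n) < e" using C by blast
    moreover have "norm (f m k - f n k) \<le> ipnorm (l2_ip st) (f m - f n)" for m n
      using norm_coord_le[OF fd, of m n k] by simp
    ultimately show "\<exists>M. \<forall>m\<ge>M. \<forall>n\<ge>M. norm (f m k - f n k) < e" by (meson le_less_trans)
  qed
  then have "\<forall>k. \<exists>l. (\<lambda>n. f n k) \<longlonglongrightarrow> l" using Cauchy_convergent convergent_def by blast
  then obtain x where x: "\<And>k. (\<lambda>n. f n k) \<longlonglongrightarrow> x k" by metis
  have xI: "x k \<in> I" for k by (rule I_limit[OF _ x]) (use f in \<open>auto simp: l2_def\<close>)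
  have bd: "norm (\<Sum>i\<in>S. st (f m i - x i) * (f m i - x i)) \<le> e\<^sup>2"
    if N: "\<forall>m\<ge>N. \<forall>n\<ge>N. ipnorm (l2_ip st) (f m - f n) < e" "m \<ge> N" and S: "finite S" for S e m N
  proof -
    obtain K where K: "S \<subseteq> {..<K}" using S finite_nat_iff_bounded by blast
    have "(\<lambda>n. norm (\<Sum>i\<in>S. st (f m i - f n i) * (f m i - f n i)))
        \<longlonglongrightarrow> norm (\<Sum>i\<in>S. st (f m i - x i) * (f m i - x i))"
      by (intro tendsto_intros tendsto_st x)
    moreover have "norm (\<Sum>i\<in>S. st (f m i - f n i) * (f m i - f n i)) \<le> e\<^sup>2" if "n \<ge> N" for n
    proof -
      have "norm (\<Sum>i\<in>S. st (f m i - f n i) * (f m i - f n i))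
          \<le> norm (\<Sum>i<K. st (f m i - f n i) * (f m i - f n i))"
      proof (rule pos_norm_le)
        have "(\<Sum>i<K. st (f m i - f n i) * (f m i - f n i)) - (\<Sum>i\<in>S. st (f m i - f n i) * (f m i - f n i))
            = (\<Sum>i\<in>{..<K} - S. st (f m i - f n i) * (f m i - f n i))"
          using K by (simp add: sum_diff del: st_diff)
        then show "pos ((\<Sum>i<K. st (f m i - f n i) * (f m i - f n i)) - (\<Sum>i\<in>S. st (f m i - f n i) * (f m i - f n i)))"
          by (auto intro: pos_sum simp del: st_diff)
      qed (auto intro!: pos_sum simp del: st_diff)
      also have "\<dots> \<le> (ipnorm (l2_ip st) (f m - f n))\<^sup>2"
        using sum_le_l2_norm[OF fd, of m n K] by (simp del: st_diff)
      also have "\<dots> \<le> e\<^sup>2" using N that by (intro power_mono) (auto intro: less_imp_le)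
      finally show ?thesis .
    qed
    ultimately show ?thesis
      by (intro tendsto_upperbound[where F = sequentially]) (auto simp: eventually_sequentially simp del: st_diff)
  qed
  have xL: "x \<in> L2"
  proof -
    have "summable (\<lambda>k. st (x k) * x k)" unfolding summable_Cauchy
    proof (intro allI impI)
      fix e :: real assume e: "e > 0"
      \<comment> \<open>\<open>pos_mult_add_bound\<close> doubles the contributions of
        \<open>f N\<close> and of \<open>f N - x\<close>, so each may be a quarter of
        \<open>e\<close>.\<close>
      define d where "d = sqrt (e / 4)"
      have d: "d > 0" "d\<^sup>2 = e / 4" unfolding d_def using e by auto
      obtain N where N: "\<forall>m\<ge>N. \<forall>n\<ge>N. ipnorm (l2_ip st) (f m - f n) < d" using C[OF d(1)] by blast
      have "summable (\<lambda>k. st (f N k) * f N k)" using f[of N] unfolding l2_def by simp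
      then obtain M where M: "\<And>m n. m \<ge> M \<Longrightarrow> norm (\<Sum>k\<in>{m..<n}. st (f N k) * f N k) < e / 4"
        using e unfolding summable_Cauchy by (metis divide_pos_pos zero_less_numeral)
      have "norm (\<Sum>k\<in>{m..<n}. st (x k) * x k) < e" if "m \<ge> M" for m n
      proof -
        let ?a = "\<Sum>k\<in>{m..<n}. st (f N k) * f N k" and ?b = "\<Sum>k\<in>{m..<n}. st (f N k - x k) * (f N k - x k)"
        have "norm (\<Sum>k\<in>{m..<n}. st (x k) * x k) \<le> norm (2 *\<^sub>R ?a + 2 *\<^sub>R ?b)"
        proof (rule pos_norm_le)
          have "pos (2 *\<^sub>R (st (f N k) * f N k) + 2 *\<^sub>R (st (f N k - x k) * (f N k - x k)) - st (x k) * x k)" for k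
            using pos_mult_add_bound[of "f N k" "- (f N k - x k)"] by (simp only: st_minus minus_mult_minus) simp
          then have "pos (\<Sum>k\<in>{m..<n}. 2 *\<^sub>R (st (f N k) * f N k) + 2 *\<^sub>R (st (f N k - x k) * (f N k - x k)) - st (x k) * x k)"
            by (intro pos_sum)
          then show "pos (2 *\<^sub>R ?a + 2 *\<^sub>R ?b - (\<Sum>k\<in>{m..<n}. st (x k) * x k))"
            by (simp add: sum.distrib sum_subtractf scaleR_right.sum del: st_diff)
        qed (auto intro: pos_sum)
        also have "\<dots> \<le> 2 * norm ?a + 2 * norm ?b"
          using norm_triangle_ineq[of "2 *\<^sub>R ?a" "2 *\<^sub>R ?b"] by (simp del: st_diff)
        also have "\<dots> < 2 * (e / 4) + 2 * (e / 4)"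
          using M[OF that, of n] bd[OF N order_refl, of "{m..<n}"] d(2) by (simp del: st_diff)
        finally show ?thesis by simp
      qed
      then show "\<exists>N. \<forall>m\<ge>N. \<forall>n. norm (\<Sum>k\<in>{m..<n}. st (x k) * x k) < e" by blast
    qed
    then show ?thesis unfolding l2_def using xI by simp
  qed
  have "(\<lambda>n. ipnorm (l2_ip st) (f n - x)) \<longlonglongrightarrow> 0"
  proof (rule LIMSEQ_I)
    fix e :: real assume "e > 0"
    then obtain N where N: "\<forall>m\<ge>N. \<forall>n\<ge>N. ipnorm (l2_ip st) (f m - f n) < e / 2" using C half_gt_zero by blast
    have "ipnorm (l2_ip st) (f n - x) \<le> e / 2" if "n \<ge> N" for n
      by (rule l2_norm_diff_bound) (use f xL that \<open>e > 0\<close> bd[OF N that] in \<open>auto simp del: st_diff\<close>)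
    then show "\<exists>N. \<forall>n\<ge>N. norm (ipnorm (l2_ip st) (f n - x) - 0) < e"
      using \<open>e > 0\<close> by (intro exI[of _ N]) (force simp: abs_of_nonneg)
  qed
  then show ?thesis using that xL by blast
qed

end

section \<open>Exact factorization and the stabilized module\<close>

definition single :: "nat \<Rightarrow> 'a::zero \<Rightarrow> nat \<Rightarrow> 'a" where
  "single c a k = (if k = c then a else 0)"

context cstar_ideal
begin

lemma single_L2: assumes "a \<in> I" shows "single c a \<in> L2" "l2_ip st (single c a) (single c a) = st a * a"
proof -
  have "(\<lambda>k. st (single c a k) * single c a k) = (\<lambda>k. if k = c then st a * a else 0)"
    unfolding single_def by auto
  then have "(\<lambda>k. st (single c a k) * single c a k) sums (st a * a)"
    using sums_single[of c "\<lambda>_. st a * a"] by simp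
  then show "single c a \<in> L2" "l2_ip st (single c a) (single c a) = st a * a"
    using assms unfolding l2_def l2_ip_def by (auto simp: sums_iff single_def)
qed

lemma l2_ip_I: "x \<in> L2 \<Longrightarrow> y \<in> L2 \<Longrightarrow> l2_ip st x y \<in> I"
  unfolding l2_ip_def
  by (rule I_limit[OF _ summable_LIMSEQ[OF L2_summable]])
     (auto simp: l2_def intro!: subspace_sum subspace_I I_mult_left)

lemma L2_geometric:
  assumes "\<And>k. x k \<in> I" "\<And>k. norm (x k) \<le> \<epsilon> / 2 ^ k" "\<epsilon> > 0"
  shows "x \<in> L2" "ipnorm (l2_ip st) x \<le> 2 * \<epsilon>"
proof -
  have g: "(\<lambda>k. \<epsilon>\<^sup>2 * (1/4) ^ k) sums (\<epsilon>\<^sup>2 * (1 / (1 - 1/4)))"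
    by (intro sums_mult geometric_sums) simp
  have n: "norm (st (x k) * x k) \<le> \<epsilon>\<^sup>2 * (1/4) ^ k" for k
  proof -
    have "(norm (x k))\<^sup>2 \<le> (\<epsilon> / 2 ^ k)\<^sup>2" using assms(2) by (intro power_mono) auto
    moreover have "((2::real) ^ k)\<^sup>2 = 4 ^ k" by (simp add: power2_eq_square flip: power_mult_distrib)
    ultimately show ?thesis unfolding cstar_identity by (simp add: power_divide)
  qed
  have s: "summable (\<lambda>k. st (x k) * x k)"
    by (rule summable_comparison_test'[OF sums_summable[OF g], of 0]) (rule n)
  then show "x \<in> L2" using assms unfolding l2_def by simp
  show "ipnorm (l2_ip st) x \<le> 2 * \<epsilon>"
  proof (rule power2_le_imp_le)
    have "norm (l2_ip st x x) \<le> (\<Sum>k. \<epsilon>\<^sup>2 * (1/4) ^ k)"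
      unfolding l2_ip_def by (rule norm_suminf_le[OF n sums_summable[OF g]])
    also have "\<dots> = \<epsilon>\<^sup>2 * (4/3)" using sums_unique[OF g] by simp
    also have "\<dots> \<le> (2 * \<epsilon>)\<^sup>2" by (simp add: power_mult_distrib)
    finally show "(ipnorm (l2_ip st) x)\<^sup>2 \<le> (2 * \<epsilon>)\<^sup>2" unfolding ipnorm_sq .
  qed (use assms in simp)
qed

text \<open>Replaces the factorization of elements of \<open>I\<close> into products of elements of half the size:
  expand \<open>d = \<Sum>\<^sub>k d\<^sub>k e\<^sub>k\<close> with \<open>e\<^sub>k\<close> from the approximate unit and \<open>d\<^sub>k\<close> of norm at most \<open>\<epsilon>\<^sup>2 / 4\<^sup>k\<close>.\<close>
lemma simultaneous_factorization:
  fixes d :: "nat \<Rightarrow> 'a" and n :: nat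
  assumes "\<And>i. i < n \<Longrightarrow> d i \<in> I" "\<And>i. i < n \<Longrightarrow> norm (d i) \<le> \<epsilon>\<^sup>2" "\<epsilon> > 0"
  obtains s r where "s \<in> L2" "ipnorm (l2_ip st) s \<le> 2 * \<epsilon>"
    "\<And>i. i < n \<Longrightarrow> r i \<in> L2" "\<And>i. i < n \<Longrightarrow> ipnorm (l2_ip st) (r i) \<le> 2 * \<epsilon>"
    "\<And>i. i < n \<Longrightarrow> l2_ip st (r i) s = d i"
proof -
  let ?P = "\<lambda>k (D::nat \<Rightarrow> 'a). \<forall>i<n. D i \<in> I \<and> norm (D i) \<le> \<epsilon>\<^sup>2 / 4 ^ k"
  let ?Q = "\<lambda>(k::nat) D D'. \<exists>m. D' = (\<lambda>i. D i - D i * eu m)"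
  have "\<exists>D. \<forall>k. (?P k (D k) \<and> (k = 0 \<longrightarrow> D k = d)) \<and> ?Q k (D k) (D (Suc k))"
  proof (rule dependent_nat_choice)
    show "\<exists>D. ?P 0 D \<and> ((0::nat) = 0 \<longrightarrow> D = d)" using assms by (intro exI[of _ d]) auto
    fix D and k :: nat assume P: "?P k D \<and> (k = 0 \<longrightarrow> D = d)"
    have "\<forall>\<^sub>F m in sequentially. norm (D i - D i * eu m) < \<epsilon>\<^sup>2 / 4 ^ Suc k" if "i \<in> {..<n}" for i
      by (rule order_tendstoD(2)[OF tendsto_norm_zero[OF eu_right_diff]]) (use P that assms(3) in auto)
    then have "\<forall>\<^sub>F m in sequentially. \<forall>i\<in>{..<n}. norm (D i - D i * eu m) < \<epsilon>\<^sup>2 / 4 ^ Suc k"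
      by (intro eventually_ball_finite) auto
    \<comment> \<open>One index \<open>m\<close> for all \<open>i < n\<close>: this is why a single
      \<open>s\<close> factors all the \<open>d i\<close> at once.\<close>
    then obtain m where m: "\<forall>i\<in>{..<n}. norm (D i - D i * eu m) < \<epsilon>\<^sup>2 / 4 ^ Suc k"
      using eventually_happens trivial_limit_sequentially by blast
    have P': "?P (Suc k) (\<lambda>i. D i - D i * eu m)"
      using P m by (auto simp: I_diff I_mult_right less_imp_le simp del: power_Suc)
    show "\<exists>D'. (?P (Suc k) D' \<and> (Suc k = 0 \<longrightarrow> D' = d)) \<and> ?Q k D D'"
      by (rule exI[of _ "\<lambda>i. D i - D i * eu m"], intro conjI P' exI[of _ m]) simp_all
  qed
  then obtain D where D0: "\<forall>k. (?P k (D k) \<and> (k = 0 \<longrightarrow> D k = d)) \<and> ?Q k (D k) (D (Suc k))" by (rule exE)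
  then have D: "\<And>k. ?P k (D k)" "D 0 = d" "\<And>k. \<exists>m. D (Suc k) = (\<lambda>i. D k i - D k i * eu m)"
    by simp_all
  obtain m where m: "\<And>k. D (Suc k) = (\<lambda>i. D k i - D k i * eu (m k))" using D(3) by metis
  \<comment> \<open>The weights are split so that both factors have norm at most
    \<open>\<epsilon> / 2 ^ k\<close>, while \<open>st (r i k) * s k\<close> is
    \<open>D k i * eu (m k)\<close>, a telescoping difference.\<close>
  define s where "s = (\<lambda>k. (\<epsilon> / 2 ^ k) *\<^sub>R eu (m k))"
  define r where "r = (\<lambda>i k. st ((2 ^ k / \<epsilon>) *\<^sub>R D k i))"
  have s: "s k \<in> I" "norm (s k) \<le> \<epsilon> / 2 ^ k" for k
    unfolding s_def using eu_I eu_norm[of "m k"] assms(3) by (auto simp: I_scaleR divide_simps)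
  have r: "r i k \<in> I" "norm (r i k) \<le> \<epsilon> / 2 ^ k" if "i < n" for i k
  proof -
    show "r i k \<in> I" unfolding r_def using D(1) that by (auto intro!: I_st I_scaleR simp del: st_scaleR)
    have "norm (r i k) = (2 ^ k / \<epsilon>) * norm (D k i)" unfolding r_def using assms(3) by simp
    also have "\<dots> \<le> (2 ^ k / \<epsilon>) * (\<epsilon>\<^sup>2 / 4 ^ k)" using D(1) that assms(3) by (intro mult_left_mono) auto
    also have "(4::real) ^ k = 2 ^ k * 2 ^ k" by (simp flip: power_mult_distrib)
    then have "(2 ^ k / \<epsilon>) * (\<epsilon>\<^sup>2 / 4 ^ k) = \<epsilon> / 2 ^ k" using assms(3) by (simp add: field_simps power2_eq_square)
    finally show "norm (r i k) \<le> \<epsilon> / 2 ^ k" .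
  qed
  have ip: "l2_ip st (r i) s = d i" if i: "i < n" for i
  proof -
    have t: "st (r i k) * s k = D k i - D (Suc k) i" for k
      unfolding r_def s_def m using assms(3) by simp
    have "(\<lambda>k. D k i) \<longlonglongrightarrow> 0"
    proof (rule Lim_null_comparison)
      show "\<forall>\<^sub>F k in sequentially. norm (D k i) \<le> \<epsilon>\<^sup>2 * (1/4) ^ k"
        using D(1) i by (auto simp: power_divide)
      have "(\<lambda>k. (1/4) ^ k) \<longlonglongrightarrow> (0::real)" by (rule LIMSEQ_power_zero) simp
      then show "(\<lambda>k. \<epsilon>\<^sup>2 * (1/4) ^ k) \<longlonglongrightarrow> 0" by (rule tendsto_mult_right_zero)
    qed
    then have "(\<lambda>k. D k i - D (Suc k) i) sums (D 0 i - 0)" by (rule telescope_sums')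
    then show ?thesis unfolding l2_ip_def t D(2) using sums_unique by fastforce
  qed
  show ?thesis
    using that[of s r] L2_geometric[of s, OF s assms(3)] L2_geometric[of "r _", OF r assms(3)] ip by blast
qed

text \<open>Factor \<open>e\<close> as \<open>l2_ip st r s\<close> and polarize. Since
  \<open>e\<close> is selfadjoint, \<open>l2_ip st s r = e\<close> as well, so the halves of
  \<open>r + s\<close> and \<open>r - s\<close> serve as \<open>y\<close> and
  \<open>x\<close>.\<close>

lemma selfadjoint_difference:
  assumes "e \<in> I" "st e = e" "norm e \<le> \<epsilon>\<^sup>2" "\<epsilon> > 0"
  obtains x y where "x \<in> L2" "y \<in> L2" "ipnorm (l2_ip st) x \<le> 2 * \<epsilon>" "ipnorm (l2_ip st) y \<le> 2 * \<epsilon>"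
    "e = l2_ip st y y - l2_ip st x x"
proof -
  obtain s r where sr: "s \<in> L2" "ipnorm (l2_ip st) s \<le> 2 * \<epsilon>" "r \<in> L2" "ipnorm (l2_ip st) r \<le> 2 * \<epsilon>" "l2_ip st r s = e"
    using simultaneous_factorization[of 1 "\<lambda>_. e" \<epsilon>] assms by (metis One_nat_def lessI)
  have sr': "l2_ip st s r = e" using l2.ip_sym[OF sr(3,1)] sr(5) assms(2) by simp
  define h where "h = (\<lambda>z::nat \<Rightarrow> 'a. (\<lambda>k. (1/2) *\<^sub>R z k))"
  have h: "h z \<in> L2" "ipnorm (l2_ip st) (h z) = ipnorm (l2_ip st) z / 2" "l2_ip st (h z) (h z) = (1/4) *\<^sub>R l2_ip st z z"
    if "z \<in> L2" for z
  proof -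
    show "h z \<in> L2" unfolding h_def by (rule L2_scaleR[OF that])
    show 1: "l2_ip st (h z) (h z) = (1/4) *\<^sub>R l2_ip st z z"
      unfolding h_def l2_ip_def using suminf_scaleR_right[OF L2_summable[OF that that], of "1/4"] by simp
    show "ipnorm (l2_ip st) (h z) = ipnorm (l2_ip st) z / 2"
      unfolding ipnorm_def 1 by (simp add: real_sqrt_divide)
  qed
  have rs: "r + s \<in> L2" "r - s \<in> L2" using sr by auto
  have "ipnorm (l2_ip st) (r + s) \<le> 4 * \<epsilon>" using l2.nrm_triangle[OF sr(3,1)] sr by simp
  moreover have "ipnorm (l2_ip st) (r - s) \<le> 4 * \<epsilon>"
    using l2.nrm_triangle[OF sr(3) l2.minus_X[OF sr(1)]] l2.nrm_minus[OF sr(1)] sr by simp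
  moreover have "e = l2_ip st (h (r + s)) (h (r + s)) - l2_ip st (h (r - s)) (h (r - s))"
  proof -
    have "l2_ip st (r + s) (r + s) - l2_ip st (r - s) (r - s) = 4 *\<^sub>R e"
    proof -
      have "e + e + e + e = 4 *\<^sub>R e" using scaleR_add_left[of 2 2 e] by (simp add: scaleR_2 add.assoc)
      then show ?thesis
        using sr sr' by (simp add: l2.ip_add l2.ip_add_left l2.ip_diff l2.ip_diff_left algebra_simps)
    qed
    then show ?thesis using h(3)[OF rs(1)] h(3)[OF rs(2)] by (simp flip: scaleR_diff_right)
  qed
  ultimately show ?thesis using that[of "h (r - s)" "h (r + s)"] h[OF rs(1)] h[OF rs(2)] by simp
qed

end

context pre_hmod
begin

lemma tendsto_ip:
  assumes f: "\<And>n. f n \<in> X" "x \<in> X" "(\<lambda>n. nrm (f n - x)) \<longlonglongrightarrow> 0"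
    and g: "\<And>n. g n \<in> X" "y \<in> X" "(\<lambda>n. nrm (g n - y)) \<longlonglongrightarrow> 0"
  shows "(\<lambda>n. ip (f n) (g n)) \<longlonglongrightarrow> ip x y"
proof (rule LIM_zero_cancel, rule Lim_null_comparison)
  have "norm (ip (f n) (g n) - ip x y) \<le> nrm (f n - x) * (nrm (g n - y) + nrm y) + nrm x * nrm (g n - y)" for n
  proof -
    have "ip (f n) (g n) - ip x y = ip (f n - x) (g n) + ip x (g n - y)"
      using f(1,2) g(1,2) by (simp add: ip_diff ip_diff_left)
    then have "norm (ip (f n) (g n) - ip x y) \<le> nrm (f n - x) * nrm (g n) + nrm x * nrm (g n - y)"
      using norm_triangle_mono[OF norm_ip_le norm_ip_le, of "f n - x" "g n" x "g n - y"] f(1,2) g(1,2) by simp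
    moreover have "nrm (g n) \<le> nrm (g n - y) + nrm y" using nrm_triangle[of "g n - y" y] g(1,2) by simp
    ultimately show ?thesis using mult_left_mono[of "nrm (g n)" "nrm (g n - y) + nrm y" "nrm (f n - x)"] by simp
  qed
  then show "\<forall>\<^sub>F n in sequentially. norm (ip (f n) (g n) - ip x y)
      \<le> nrm (f n - x) * (nrm (g n - y) + nrm y) + nrm x * nrm (g n - y)" by simp
  have "(\<lambda>n. nrm (f n - x) * (nrm (g n - y) + nrm y) + nrm x * nrm (g n - y)) \<longlonglongrightarrow> 0 * (0 + nrm y) + nrm x * 0"
    by (intro tendsto_intros f g)
  then show "(\<lambda>n. nrm (f n - x) * (nrm (g n - y) + nrm y) + nrm x * nrm (g n - y)) \<longlonglongrightarrow> 0" by simp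
qed

end

locale ideal_hmod = pre_hmod cs st X act ip + cstar_ideal cs st I
  for cs :: "complex \<Rightarrow> 'a::{real_normed_algebra,banach} \<Rightarrow> 'a" and st :: "'a \<Rightarrow> 'a"
    and X :: "'x::ab_group_add set" and act :: "'x \<Rightarrow> 'a \<Rightarrow> 'x" and ip :: "'x \<Rightarrow> 'x \<Rightarrow> 'a"
    and I :: "'a set"
begin

lemma act_eu_tendsto:
  assumes "x \<in> X" "ip x x \<in> I" shows "(\<lambda>k. nrm (act x (eu k) - x)) \<longlonglongrightarrow> 0"
proof -
  have "ip (act x (eu k) - x) (act x (eu k) - x)
      = (ip x x - ip x x * eu k) - eu k * (ip x x - ip x x * eu k)" for k
    using assms(1) by (simp add: ip_diff ip_diff_left ip_act ip_act_left algebra_simps)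
  then have "(\<lambda>k. sqrt (norm (ip (act x (eu k) - x) (act x (eu k) - x)))) \<longlonglongrightarrow> sqrt 0"
    using tendsto_norm_zero[OF eu_sandwich[OF assms(2)]] by (intro tendsto_real_sqrt) simp
  then show ?thesis unfolding ipnorm_def by simp
qed

lemma ip_ideal: assumes "x \<in> X" "ip x x \<in> I" "z \<in> X" shows "ip z x \<in> I"
proof (rule I_limit)
  show "(\<lambda>k. ip z (act x (eu k))) \<longlonglongrightarrow> ip z x"
    by (rule tendsto_ip) (use assms act_eu_tendsto in auto)
  show "ip z (act x (eu k)) \<in> I" for k using assms by (simp add: ip_act I_mult_left eu_I)
qed

end

locale hmod = pre_hmod cs st X act ip
  for cs :: "complex \<Rightarrow> 'a::{real_normed_algebra,banach} \<Rightarrow> 'a" and st :: "'a \<Rightarrow> 'a"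
    and X :: "'x::ab_group_add set" and act :: "'x \<Rightarrow> 'a \<Rightarrow> 'x" and ip :: "'x \<Rightarrow> 'x \<Rightarrow> 'a" +
  assumes complete: "\<And>f. (\<And>n. f n \<in> X) \<Longrightarrow>
      (\<And>e. e > 0 \<Longrightarrow> \<exists>N. \<forall>m\<ge>N. \<forall>n\<ge>N. ipnorm ip (f m - f n) < e) \<Longrightarrow>
      \<exists>x\<in>X. (\<lambda>n. ipnorm ip (f n - x)) \<longlonglongrightarrow> 0"

text \<open>\<open>Xb b\<close> stands for the vectors supported on the blocks below
  \<open>b\<close>, and \<open>J b\<close> for the isometric copy of \<open>l2(I)\<close> in block
  \<open>b\<close>. This is the interface through which the extension step draws fresh
  coordinates.\<close>

locale blocked_hmod = hmod cs st X act ip + ideal_hmod cs st X act ip I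
  for cs :: "complex \<Rightarrow> 'a::{real_normed_algebra,banach} \<Rightarrow> 'a" and st :: "'a \<Rightarrow> 'a"
    and X :: "'x::ab_group_add set" and act :: "'x \<Rightarrow> 'a \<Rightarrow> 'x" and ip :: "'x \<Rightarrow> 'x \<Rightarrow> 'a"
    and I :: "'a set" +
  fixes Xb :: "nat \<Rightarrow> 'x set" and J :: "nat \<Rightarrow> (nat \<Rightarrow> 'a) \<Rightarrow> 'x"
  assumes Xb_X: "\<And>b x. x \<in> Xb b \<Longrightarrow> x \<in> X"
    and Xb_mono: "\<And>b c x. x \<in> Xb b \<Longrightarrow> b \<le> c \<Longrightarrow> x \<in> Xb c"
    and Xb_zero: "\<And>b. 0 \<in> Xb b"
    and Xb_add: "\<And>b x y. x \<in> Xb b \<Longrightarrow> y \<in> Xb b \<Longrightarrow> x + y \<in> Xb b"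
    and Xb_minus: "\<And>b x. x \<in> Xb b \<Longrightarrow> - x \<in> Xb b"
    and Xb_act: "\<And>b x a. x \<in> Xb b \<Longrightarrow> act x a \<in> Xb b"
    and J_Xb: "\<And>b r. r \<in> l2 st I \<Longrightarrow> J b r \<in> Xb (Suc b)"
    and J_ip: "\<And>b r s. r \<in> l2 st I \<Longrightarrow> s \<in> l2 st I \<Longrightarrow> ip (J b r) (J b s) = l2_ip st r s"
    and J_orth: "\<And>b c x r. x \<in> Xb b \<Longrightarrow> b \<le> c \<Longrightarrow> r \<in> l2 st I \<Longrightarrow> ip x (J c r) = 0"

section \<open>The stabilized module \<open>M \<oplus> l2(I)\<close>\<close>

locale hilbert_with_ideal = cstar_ideal cs st I
  for cs :: "complex \<Rightarrow> 'a::{real_normed_algebra,banach} \<Rightarrow> 'a" and st :: "'a \<Rightarrow> 'a" and I :: "'a set" +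
  fixes cm :: "complex \<Rightarrow> 'm::{real_normed_vector,banach} \<Rightarrow> 'm" and act :: "'m \<Rightarrow> 'a \<Rightarrow> 'm" and ip :: "'m \<Rightarrow> 'm \<Rightarrow> 'a"
  assumes hm: "hilbert_module cs st cm act ip"
begin

lemma norm_eq_ipnorm: "norm x = ipnorm ip x"
  using hm unfolding hilbert_module_def ipnorm_def by blast

sublocale M: ideal_hmod cs st UNIV act ip I
  by standard (use hm in \<open>simp_all add: hilbert_module_def\<close>)

definition sact :: "'m \<times> (nat \<Rightarrow> 'a) \<Rightarrow> 'a \<Rightarrow> 'm \<times> (nat \<Rightarrow> 'a)" where
  "sact p a = (act (fst p) a, \<lambda>k. snd p k * a)"

abbreviation "sip \<equiv> sum_ip ip st"
abbreviation "E \<equiv> (UNIV :: 'm set) \<times> L2"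

sublocale E: pre_hmod cs st E sact sip
proof
  fix x y z :: "'m \<times> (nat \<Rightarrow> 'a)" and a
  show "0 \<in> E" by (simp add: zero_prod_def L2_zero)
  assume x: "x \<in> E"
  then have x2: "snd x \<in> L2" by auto
  show "- x \<in> E" using x by (auto simp: uminus_prod_def)
  show "sact x a \<in> E" using x2 by (simp add: sact_def L2_act)
  show "pos (sip x x)" unfolding sum_ip_def by (intro pos_add M.ip_pos l2.ip_pos x2) simp
  show "x = 0" if "sip x x = 0"
  proof -
    have "norm (ip (fst x) (fst x)) \<le> norm (sip x x)" "norm (l2_ip st (snd x) (snd x)) \<le> norm (sip x x)"
      unfolding sum_ip_def using pos_norm_mono[OF M.ip_pos l2.ip_pos[OF x2]]
        pos_norm_mono[OF l2.ip_pos[OF x2] M.ip_pos] by (auto simp: add.commute)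
    then have "fst x = 0" "snd x = 0"
      using that M.ip_self_zero l2.ip_self_zero[OF x2] by auto
    then show ?thesis by (simp add: prod_eq_iff)
  qed
  assume y: "y \<in> E"
  then have y2: "snd y \<in> L2" by auto
  show "x + y \<in> E" using x2 y2 by (auto simp: plus_prod_def)
  show "sip x (sact y a) = sip x y * a"
    unfolding sum_ip_def sact_def using x2 y2 by (simp add: M.ip_act l2.ip_act distrib_right)
  show "st (sip x y) = sip y x"
    unfolding sum_ip_def using x2 y2 by (simp add: M.ip_sym l2.ip_sym)
  assume z: "z \<in> E"
  then have z2: "snd z \<in> L2" by auto
  show "sip x (y + z) = sip x y + sip x z"
    unfolding sum_ip_def using x2 y2 z2 by (simp add: M.ip_add l2.ip_add)
qed

lemma E_norm_bounds: assumes "p \<in> E"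
  shows "norm (fst p) \<le> ipnorm sip p" "ipnorm (l2_ip st) (snd p) \<le> ipnorm sip p"
    "ipnorm sip p \<le> norm (fst p) + ipnorm (l2_ip st) (snd p)"
proof -
  have p2: "snd p \<in> L2" using assms by auto
  show "norm (fst p) \<le> ipnorm sip p" "ipnorm (l2_ip st) (snd p) \<le> ipnorm sip p"
    unfolding norm_eq_ipnorm ipnorm_def sum_ip_def using pos_norm_mono[OF M.ip_pos l2.ip_pos[OF p2]]
        pos_norm_mono[OF l2.ip_pos[OF p2] M.ip_pos] by (auto simp: add.commute)
  have "p = (fst p, 0) + (0, snd p)" by simp
  then have "ipnorm sip p \<le> ipnorm sip (fst p, 0) + ipnorm sip (0, snd p)"
    using E.nrm_triangle[of "(fst p, 0)" "(0, snd p)"] p2 L2_zero by auto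
  moreover have "ipnorm sip (fst p, 0) = norm (fst p)" "ipnorm sip (0, snd p) = ipnorm (l2_ip st) (snd p)"
    unfolding norm_eq_ipnorm ipnorm_def sum_ip_def using L2_zero p2 by auto
  ultimately show "ipnorm sip p \<le> norm (fst p) + ipnorm (l2_ip st) (snd p)" by simp
qed

lemma E_complete:
  assumes f: "\<And>n. f n \<in> E" and C: "\<And>e. e > 0 \<Longrightarrow> \<exists>N. \<forall>m\<ge>N. \<forall>n\<ge>N. ipnorm sip (f m - f n) < e"
  shows "\<exists>x\<in>E. (\<lambda>n. ipnorm sip (f n - x)) \<longlonglongrightarrow> 0"
proof -
  have fd: "f m - f n \<in> E" for m n by (rule E.diff_X[OF f f])
  have "Cauchy (\<lambda>n. fst (f n))"
  proof (rule CauchyI)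
    fix e :: real assume "e > 0"
    then obtain N where "\<forall>m\<ge>N. \<forall>n\<ge>N. ipnorm sip (f m - f n) < e" using C by blast
    moreover have "norm (fst (f m) - fst (f n)) \<le> ipnorm sip (f m - f n)" for m n
      using E_norm_bounds(1)[OF fd, of m n] by simp
    ultimately show "\<exists>M. \<forall>m\<ge>M. \<forall>n\<ge>M. norm (fst (f m) - fst (f n)) < e" by (meson le_less_trans)
  qed
  then obtain l where l: "(\<lambda>n. fst (f n)) \<longlonglongrightarrow> l" using Cauchy_convergent convergent_def by blast
  have "\<exists>N. \<forall>m\<ge>N. \<forall>n\<ge>N. ipnorm (l2_ip st) (snd (f m) - snd (f n)) < e" if e: "e > 0" for e
  proof -
    obtain N where "\<forall>m\<ge>N. \<forall>n\<ge>N. ipnorm sip (f m - f n) < e" using C[OF e] by blast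
    moreover have "ipnorm (l2_ip st) (snd (f m) - snd (f n)) \<le> ipnorm sip (f m - f n)" for m n
      using E_norm_bounds(2)[OF fd, of m n] by simp
    ultimately show ?thesis by (meson le_less_trans)
  qed
  then obtain x where x: "x \<in> L2" "(\<lambda>n. ipnorm (l2_ip st) (snd (f n) - x)) \<longlonglongrightarrow> 0"
    using L2_complete[of "\<lambda>n. snd (f n)"] f by (metis mem_Times_iff)
  have lx: "(l, x) \<in> E" using x by simp
  have "(\<lambda>n. norm (fst (f n) - l) + ipnorm (l2_ip st) (snd (f n) - x)) \<longlonglongrightarrow> 0 + 0"
    using l x(2) by (intro tendsto_add) (auto simp: tendsto_norm_zero LIM_zero)
  then have "(\<lambda>n. ipnorm sip (f n - (l, x))) \<longlonglongrightarrow> 0"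
    using E_norm_bounds(3)[OF E.diff_X[OF f lx]]
    by (intro Lim_null_comparison[where f = "\<lambda>n. ipnorm sip (f n - (l, x))"]) (auto simp: abs_of_nonneg)
  then show ?thesis using lx by blast
qed

text \<open>The coordinates are split into infinitely many infinite blocks by \<open>prod_decode\<close>, so that every stage of
  the construction finds an unused copy of \<open>l\<^sub>2(I)\<close>.\<close>
definition blk :: "nat \<Rightarrow> ('m \<times> (nat \<Rightarrow> 'a)) set" where
  "blk b = {p \<in> E. \<forall>k. fst (prod_decode k) \<ge> b \<longrightarrow> snd p k = 0}"

definition emb :: "nat \<Rightarrow> (nat \<Rightarrow> 'a) \<Rightarrow> 'm \<times> (nat \<Rightarrow> 'a)" where
  "emb b r = (0, \<lambda>k. if fst (prod_decode k) = b then r (snd (prod_decode k)) else 0)"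

lemma strict_mono_prod_encode: "strict_mono (\<lambda>j. prod_encode (b, j))"
  unfolding strict_mono_Suc_iff by (simp add: prod_encode_def)

lemma not_in_range_prod_encode: "k \<notin> range (\<lambda>j. prod_encode (b, j)) \<Longrightarrow> fst (prod_decode k) \<noteq> b"
  by (metis prod.collapse prod_decode_inverse rangeI)

lemma emb_E: assumes "r \<in> L2" shows "emb b r \<in> E"
proof -
  let ?f = "\<lambda>k. st (snd (emb b r) k) * snd (emb b r) k"
  have "summable (\<lambda>j. ?f (prod_encode (b, j)))" using assms unfolding emb_def l2_def by simp
  then have "summable ?f"
    by (subst (asm) summable_mono_reindex[OF strict_mono_prod_encode])
       (auto simp: emb_def dest: not_in_range_prod_encode)
  moreover have "snd (emb b r) k \<in> I" for k using assms unfolding emb_def l2_def by auto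
  ultimately show ?thesis unfolding l2_def by (auto simp: mem_Times_iff)
qed

lemma emb_ip: assumes "r \<in> L2" "s \<in> L2" shows "sip (emb b r) (emb b s) = l2_ip st r s"
proof -
  let ?f = "\<lambda>k. st (snd (emb b r) k) * snd (emb b s) k"
  have "(\<Sum>j. ?f (prod_encode (b, j))) = (\<Sum>k. ?f k)"
    by (rule suminf_mono_reindex[OF strict_mono_prod_encode])
       (auto simp: emb_def dest: not_in_range_prod_encode)
  then show ?thesis unfolding sum_ip_def l2_ip_def by (simp add: emb_def)
qed

sublocale blocked_hmod cs st E sact sip I blk emb
proof
  fix b c :: nat and x y :: "'m \<times> (nat \<Rightarrow> 'a)" and a r s
  show "\<exists>x\<in>E. (\<lambda>n. ipnorm sip (f n - x)) \<longlonglongrightarrow> 0"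
    if "\<And>n. f n \<in> E" "\<And>e. e > 0 \<Longrightarrow> \<exists>N. \<forall>m\<ge>N. \<forall>n\<ge>N. ipnorm sip (f m - f n) < e" for f
    using E_complete[OF that] .
  show "0 \<in> blk b" using E.zero_X by (auto simp: blk_def)
  show "x \<in> blk b \<Longrightarrow> x \<in> E" "x \<in> blk b \<Longrightarrow> b \<le> c \<Longrightarrow> x \<in> blk c" by (auto simp: blk_def)
  show "x \<in> blk b \<Longrightarrow> y \<in> blk b \<Longrightarrow> x + y \<in> blk b" using E.add_X[of x y] by (auto simp: blk_def)
  show "x \<in> blk b \<Longrightarrow> - x \<in> blk b" using E.minus_X[of x] by (auto simp: blk_def)
  show "x \<in> blk b \<Longrightarrow> sact x a \<in> blk b" using E.act_X[of x a] by (auto simp: blk_def sact_def)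
  show "emb b r \<in> blk (Suc b)" if "r \<in> L2"
    using emb_E[OF that, of b] by (auto simp: blk_def emb_def)
  show "sip (emb b r) (emb b s) = l2_ip st r s" if "r \<in> L2" "s \<in> L2" using emb_ip[OF that] .
  show "sip x (emb c r) = 0" if "x \<in> blk b" "b \<le> c" "r \<in> L2"
  proof -
    have "st (snd x k) * snd (emb c r) k = 0" for k using that by (auto simp: blk_def emb_def)
    then show ?thesis unfolding sum_ip_def l2_ip_def by (simp add: emb_def)
  qed
qed

end

section \<open>Adjoining one pair\<close>

context blocked_hmod
begin

lemma J_X [simp]: "r \<in> L2 \<Longrightarrow> J b r \<in> X"
  using J_Xb Xb_X by blast

lemma J_orth_left: "x \<in> Xb b \<Longrightarrow> b \<le> c \<Longrightarrow> r \<in> L2 \<Longrightarrow> ip (J c r) x = 0"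
  using J_orth[of x b c r] ip_sym[of x "J c r"] Xb_X by simp

lemma J_orth_J: "b < c \<Longrightarrow> r \<in> L2 \<Longrightarrow> s \<in> L2 \<Longrightarrow> ip (J b r) (J c s) = 0"
  "b < c \<Longrightarrow> r \<in> L2 \<Longrightarrow> s \<in> L2 \<Longrightarrow> ip (J c s) (J b r) = 0"
  using J_orth[OF J_Xb, of r b c s] J_orth_left[OF J_Xb, of r b c s] by auto

lemma nrm_J: "r \<in> L2 \<Longrightarrow> nrm (J b r) = ipnorm (l2_ip st) r"
  unfolding ipnorm_def by (simp add: J_ip)

lemma Xb_sum: "(\<And>i. i < n \<Longrightarrow> f i \<in> Xb b) \<Longrightarrow> (\<Sum>i<n. f i) \<in> Xb b" for n :: nat
  by (induction n) (auto simp: Xb_zero Xb_add)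

lemma Xb_diff: "x \<in> Xb b \<Longrightarrow> y \<in> Xb b \<Longrightarrow> x - y \<in> Xb b"
  using Xb_add[OF _ Xb_minus, of x b y] by simp

end

section \<open>A unitary from families with equal Gram matrices\<close>

locale isometric_families = X: hmod cs st X actX ipX + Y: hmod cs st Y actY ipY
  for cs :: "complex \<Rightarrow> 'a::{real_normed_algebra,banach} \<Rightarrow> 'a" and st :: "'a \<Rightarrow> 'a"
    and X :: "'x::ab_group_add set" and actX ipX and Y :: "'y::ab_group_add set" and actY ipY +
  fixes u :: "nat \<Rightarrow> 'x" and v :: "nat \<Rightarrow> 'y"
  assumes u_X: "\<And>i. u i \<in> X" and v_Y: "\<And>i. v i \<in> Y" and gram: "\<And>i j. ipX (u i) (u j) = ipY (v i) (v j)"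
begin

definition combX :: "nat \<Rightarrow> (nat \<Rightarrow> 'a) \<Rightarrow> 'x" where "combX n c = (\<Sum>i<n. actX (u i) (c i))"
definition combY :: "nat \<Rightarrow> (nat \<Rightarrow> 'a) \<Rightarrow> 'y" where "combY n c = (\<Sum>i<n. actY (v i) (c i))"

lemma comb_in [simp]: "combX n c \<in> X" "combY n c \<in> Y"
  unfolding combX_def combY_def using u_X v_Y by auto

lemma comb_ip: "ipX (combX n c) (combX m d) = ipY (combY n c) (combY m d)"
  unfolding combX_def combY_def
  by (simp add: X.ip_sum X.ip_sum_left Y.ip_sum Y.ip_sum_left u_X v_Y X.ip_act X.ip_act_left Y.ip_act Y.ip_act_left gram)

lemma comb_norm_diff: "ipnorm ipX (combX n c - combX m d) = ipnorm ipY (combY n c - combY m d)"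
  unfolding ipnorm_def by (simp add: X.ip_diff X.ip_diff_left Y.ip_diff Y.ip_diff_left comb_ip)

text \<open>The closure of the assignment of \<open>combY n c\<close> to \<open>combX n c\<close>.
  As a relation it can be used before the assignment is known to be well defined, and exchanging the
  two families turns it into its converse.\<close>

definition graph :: "'x \<Rightarrow> 'y \<Rightarrow> bool" where
  "graph x y \<longleftrightarrow> x \<in> X \<and> y \<in> Y \<and> (\<exists>n c. (\<lambda>k. ipnorm ipX (combX (n k) (c k) - x)) \<longlonglongrightarrow> 0 \<and>
      (\<lambda>k. ipnorm ipY (combY (n k) (c k) - y)) \<longlonglongrightarrow> 0)"

lemma graph_ip: assumes "graph x y" "graph x' y'" shows "ipX x x' = ipY y y'"
proof -
  obtain n c where c: "(\<lambda>k. ipnorm ipX (combX (n k) (c k) - x)) \<longlonglongrightarrow> 0" "(\<lambda>k. ipnorm ipY (combY (n k) (c k) - y)) \<longlonglongrightarrow> 0"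
    using assms unfolding graph_def by blast
  obtain m d where d: "(\<lambda>k. ipnorm ipX (combX (m k) (d k) - x')) \<longlonglongrightarrow> 0" "(\<lambda>k. ipnorm ipY (combY (m k) (d k) - y')) \<longlonglongrightarrow> 0"
    using assms unfolding graph_def by blast
  have "(\<lambda>k. ipX (combX (n k) (c k)) (combX (m k) (d k))) \<longlonglongrightarrow> ipX x x'"
    by (rule X.tendsto_ip) (use c d assms in \<open>auto simp: graph_def\<close>)
  moreover have "(\<lambda>k. ipY (combY (n k) (c k)) (combY (m k) (d k))) \<longlonglongrightarrow> ipY y y'"
    by (rule Y.tendsto_ip) (use c d assms in \<open>auto simp: graph_def\<close>)
  ultimately show ?thesis unfolding comb_ip by (rule LIMSEQ_unique)
qed

lemma graph_functional: assumes "graph x y" "graph x y'" shows "y = y'"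
proof -
  have "y \<in> Y" "y' \<in> Y" using assms unfolding graph_def by auto
  moreover have "ipY y y = ipX x x" "ipY y y' = ipX x x" "ipY y' y = ipX x x" "ipY y' y' = ipX x x"
    using graph_ip[OF assms(1) assms(1)] graph_ip[OF assms(1) assms(2)] graph_ip[OF assms(2) assms(1)]
      graph_ip[OF assms(2) assms(2)] by auto
  ultimately have "ipY (y - y') (y - y') = 0" by (simp add: Y.ip_diff Y.ip_diff_left)
  then show ?thesis using Y.ip_self_zero[of "y - y'"] \<open>y \<in> Y\<close> \<open>y' \<in> Y\<close> by simp
qed

lemma graph_total:
  assumes "x \<in> X" and dense: "\<And>e. e > 0 \<Longrightarrow> \<exists>n c. ipnorm ipX (combX n c - x) < e"
  shows "\<exists>y. graph x y"
proof -
  have "\<forall>k. \<exists>n c. ipnorm ipX (combX n c - x) < inverse (real (Suc k))" using dense by simp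
  then obtain n c where nc: "\<And>k. ipnorm ipX (combX (n k) (c k) - x) < inverse (real (Suc k))" by metis
  have lim: "(\<lambda>k. ipnorm ipX (combX (n k) (c k) - x)) \<longlonglongrightarrow> 0"
    by (rule Lim_null_comparison[OF _ LIMSEQ_inverse_real_of_nat]) (use nc in \<open>auto intro!: always_eventually less_imp_le simp del: of_nat_Suc\<close>)
  have "\<exists>y\<in>Y. (\<lambda>k. ipnorm ipY (combY (n k) (c k) - y)) \<longlonglongrightarrow> 0"
  proof (rule Y.complete)
    fix e :: real assume e: "e > 0"
    then obtain N where N: "\<And>k. k \<ge> N \<Longrightarrow> ipnorm ipX (combX (n k) (c k) - x) < e / 2"
      using LIMSEQ_D[OF lim, of "e / 2"] by (auto simp: abs_of_nonneg)
    have "ipnorm ipY (combY (n k) (c k) - combY (n l) (c l)) < e" if "k \<ge> N" "l \<ge> N" for k l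
    proof -
      have "ipnorm ipX (combX (n k) (c k) - combX (n l) (c l))
          \<le> ipnorm ipX (combX (n k) (c k) - x) + ipnorm ipX (x - combX (n l) (c l))"
        by (rule X.nrm_diff_triangle) (use assms in auto)
      also have "\<dots> < e / 2 + e / 2"
        using N that X.nrm_diff_commute[OF assms(1) comb_in(1)] by (intro add_strict_mono) auto
      finally show ?thesis unfolding comb_norm_diff by simp
    qed
    then show "\<exists>N. \<forall>m\<ge>N. \<forall>na\<ge>N. ipnorm ipY (combY (n m) (c m) - combY (n na) (c na)) < e" by blast
  qed simp
  then show ?thesis unfolding graph_def using lim assms(1) by blast
qed

end

text \<open>Images exist by density and completeness and are unique because inner products are
  preserved; the inverse comes from the exchanged families. The second conclusion describes
  \<open>U\<close> by limits, so that coherence can be passed to the limit.\<close>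

lemma isometric_families_unitary:
  assumes "isometric_families cs st X actX ipX Y actY ipY u v"
    and dX: "\<And>x e. x \<in> X \<Longrightarrow> e > 0 \<Longrightarrow> \<exists>n c. ipnorm ipX ((\<Sum>i<n. actX (u i) (c i)) - x) < e"
    and dY: "\<And>y e. y \<in> Y \<Longrightarrow> e > 0 \<Longrightarrow> \<exists>n c. ipnorm ipY ((\<Sum>i<n. actY (v i) (c i)) - y) < e"
  obtains U where "unitary_op X ipX Y ipY U"
    "\<And>x. x \<in> X \<Longrightarrow> \<exists>n c. (\<lambda>k. ipnorm ipX ((\<Sum>i<n k. actX (u i) (c k i)) - x)) \<longlonglongrightarrow> 0 \<and>
        (\<lambda>k. ipnorm ipY ((\<Sum>i<n k. actY (v i) (c k i)) - U x)) \<longlonglongrightarrow> 0"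
proof -
  interpret isometric_families cs st X actX ipX Y actY ipY u v by (rule assms)
  interpret R: isometric_families cs st Y actY ipY X actX ipX v u
    by standard (use u_X v_Y gram in auto)
  have sw: "R.graph y x \<longleftrightarrow> graph x y" for x y
    unfolding graph_def R.graph_def R.combX_def R.combY_def combX_def combY_def by blast
  define U where "U x = (SOME y. graph x y)" for x
  define V where "V y = (SOME x. graph x y)" for y
  have U: "graph x (U x)" if "x \<in> X" for x
    unfolding U_def by (rule someI_ex, rule graph_total) (use that dX in \<open>auto simp: combX_def\<close>)
  have V: "graph (V y) y" if "y \<in> Y" for y
    unfolding V_def
    by (rule someI_ex, rule R.graph_total[unfolded sw]) (use that dY in \<open>auto simp: R.combX_def\<close>)
  have UY: "U x \<in> Y" if "x \<in> X" for x using U[OF that] unfolding graph_def by blast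
  have VX: "V y \<in> X" if "y \<in> Y" for y using V[OF that] unfolding graph_def by blast
  have "unitary_op X ipX Y ipY U"
    unfolding unitary_op_def
  proof (intro conjI exI[of _ V] ballI)
    fix x assume x: "x \<in> X"
    show "U x \<in> Y" by (rule UY[OF x])
    show "V (U x) = x" using R.graph_functional[unfolded sw] U[OF x] V[OF UY[OF x]] by blast
    fix y assume y: "y \<in> Y"
    show "ipY (U x) y = ipX x (V y)" using graph_ip[OF U[OF x] V[OF y]] by simp
  next
    fix y assume y: "y \<in> Y"
    show "V y \<in> X" by (rule VX[OF y])
    show "U (V y) = y" using graph_functional U[OF VX[OF y]] V[OF y] by blast
  qed
  then show ?thesis using that U unfolding graph_def combX_def combY_def by blast
qed

text \<open>\<open>coh\<close> abstracts from agreement under \<phi> modulo \<open>I\<close>. By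
  \<open>coh_ideal\<close> any two vectors of the ideal parts are coherent, so corrections in
  \<open>l2(I)\<close> never disturb coherence.\<close>

locale back_and_forth = X: blocked_hmod cs st X actX ipX I Xb JX + Y: blocked_hmod cs st Y actY ipY I Yb JY
  for cs :: "complex \<Rightarrow> 'a::{real_normed_algebra,banach} \<Rightarrow> 'a" and st :: "'a \<Rightarrow> 'a" and I :: "'a set"
    and X :: "'x::ab_group_add set" and actX ipX Xb JX and Y :: "'y::ab_group_add set" and actY ipY Yb JY +
  fixes coh :: "'x \<Rightarrow> 'y \<Rightarrow> bool"
  assumes coh_ip: "\<And>x y x' y'. coh x y \<Longrightarrow> coh x' y' \<Longrightarrow> ipX x x' - ipY y y' \<in> I"
    and coh_in: "\<And>x y. coh x y \<Longrightarrow> x \<in> X \<and> y \<in> Y"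
    and coh_add: "\<And>x y x' y'. coh x y \<Longrightarrow> coh x' y' \<Longrightarrow> coh (x + x') (y + y')"
    and coh_act: "\<And>x y a. coh x y \<Longrightarrow> coh (actX x a) (actY y a)"
    and coh_ideal: "\<And>x y. x \<in> X \<Longrightarrow> y \<in> Y \<Longrightarrow> ipX x x \<in> I \<Longrightarrow> ipY y y \<in> I \<Longrightarrow> coh x y"
    and coh_limit: "\<And>f g x y. (\<And>n. coh (f n) (g n)) \<Longrightarrow> x \<in> X \<Longrightarrow> y \<in> Y \<Longrightarrow>
        (\<lambda>n. ipnorm ipX (f n - x)) \<longlonglongrightarrow> 0 \<Longrightarrow> (\<lambda>n. ipnorm ipY (g n - y)) \<longlonglongrightarrow> 0 \<Longrightarrow> coh x y"
begin

abbreviation "nX \<equiv> ipnorm ipX"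
abbreviation "nY \<equiv> ipnorm ipY"
abbreviation "n2 \<equiv> ipnorm (l2_ip st)"

definition exact :: "nat \<Rightarrow> nat \<Rightarrow> (nat \<Rightarrow> 'x) \<Rightarrow> (nat \<Rightarrow> 'y) \<Rightarrow> bool" where
  "exact n b u v \<longleftrightarrow> (\<forall>i<n. u i \<in> Xb b \<and> v i \<in> Yb b \<and> coh (u i) (v i) \<and>
      (\<forall>j<n. ipX (u i) (u j) = ipY (v i) (v j)))"

definition close :: "nat \<Rightarrow> real \<Rightarrow> (nat \<Rightarrow> 'x) \<Rightarrow> (nat \<Rightarrow> 'y) \<Rightarrow> (nat \<Rightarrow> 'x) \<Rightarrow> (nat \<Rightarrow> 'y) \<Rightarrow> bool" where
  "close n \<epsilon> u v u' v' \<longleftrightarrow> (\<forall>i<n. nX (u' i - u i) \<le> \<epsilon> \<and> nY (v' i - v i) \<le> \<epsilon>)"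

lemma exactD:
  assumes "exact n b u v" "i < n"
  shows "u i \<in> Xb b" "v i \<in> Yb b" "u i \<in> X" "v i \<in> Y" "coh (u i) (v i)"
    "\<And>j. j < n \<Longrightarrow> ipX (u i) (u j) = ipY (v i) (v j)"
  using assms X.Xb_X Y.Xb_X unfolding exact_def by auto

lemma exact_mono: "exact n b u v \<Longrightarrow> b \<le> c \<Longrightarrow> exact n c u v"
  unfolding exact_def using X.Xb_mono Y.Xb_mono by blast

text \<open>Block \<open>b\<close> receives \<open>r i\<close> in \<open>u i\<close> and in
  \<open>v i\<close>, so the old Gram entries change equally. The vector \<open>s\<close> is added
  to \<open>w\<close> in block \<open>b\<close>, where it meets the \<open>r i\<close> and supplies
  what the mixed entries lack, but to \<open>t\<close> in the free block \<open>b + 1\<close>; its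
  square thus appears on both sides. Block \<open>b + 2\<close> carries \<open>x\<close> and
  \<open>y\<close>, which settle the diagonal entry.\<close>

lemma exact_extend:
  assumes ex: "exact n b u v" and t: "t \<in> Xb b" and w: "w \<in> Yb b" and tw: "coh t w" and \<epsilon>: "\<epsilon> > 0"
    and d: "\<And>i. i < n \<Longrightarrow> norm (ipX (u i) t - ipY (v i) w) \<le> \<epsilon>\<^sup>2"
    and x: "x \<in> l2 st I" and y: "y \<in> l2 st I"
    and xy: "ipX t t - ipY w w = l2_ip st y y - l2_ip st x x"
  obtains u' v' where "exact (Suc n) (b + 3) u' v'" "close n (2 * \<epsilon>) u v u' v'"
    "nX (u' n - t) \<le> 2 * \<epsilon> + n2 x" "nY (v' n - w) \<le> 2 * \<epsilon> + n2 y"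
proof -
  note E = exactD[OF ex]
  obtain s r where sr: "s \<in> l2 st I" "n2 s \<le> 2 * \<epsilon>"
    "\<And>i. i < n \<Longrightarrow> r i \<in> l2 st I" "\<And>i. i < n \<Longrightarrow> n2 (r i) \<le> 2 * \<epsilon>"
    "\<And>i. i < n \<Longrightarrow> l2_ip st (r i) s = ipX (u i) t - ipY (v i) w"
    using X.simultaneous_factorization[of n "\<lambda>i. ipX (u i) t - ipY (v i) w" \<epsilon>] coh_ip[OF E(5) tw] d \<epsilon> by metis
  have tX: "t \<in> X" and wY: "w \<in> Y" using t w X.Xb_X Y.Xb_X by auto
  define tn where "tn = t + (JX (b + 1) s + JX (b + 2) x)"
  define wn where "wn = w + (JY b s + JY (b + 2) y)"
  define u' where "u' i = (if i < n then u i + JX b (r i) else tn)" for i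
  define v' where "v' i = (if i < n then v i + JY b (r i) else wn)" for i
  note JJ = X.J_ip Y.J_ip X.J_orth_J Y.J_orth_J
  have oX: "ipX z (JX c q) = 0" "ipX (JX c q) z = 0" if "z \<in> Xb b" "b \<le> c" "q \<in> l2 st I" for z c q
    using X.J_orth[OF that] X.J_orth_left[OF that] by auto
  have oY: "ipY z (JY c q) = 0" "ipY (JY c q) z = 0" if "z \<in> Yb b" "b \<le> c" "q \<in> l2 st I" for z c q
    using Y.J_orth[OF that] Y.J_orth_left[OF that] by auto
  have uu: "ipX (u' i) (u' j) = ipY (v' i) (v' j)" if "i < n" "j < n" for i j
    using that E sr(3) unfolding u'_def v'_def
    by (simp add: X.ip_add X.ip_add_left Y.ip_add Y.ip_add_left JJ oX oY)
  have un: "ipX (u' i) tn = ipY (v' i) wn" if i: "i < n" for i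
  proof -
    have "ipX (u' i) tn = ipX (u i) t"
      using i E[OF i] sr(1,3) x tX t unfolding u'_def tn_def
      by (simp add: X.ip_add X.ip_add_left JJ oX)
    moreover have "ipY (v' i) wn = ipY (v i) w + l2_ip st (r i) s"
      using i E[OF i] sr(1,3) y wY w unfolding v'_def wn_def
      by (simp add: Y.ip_add Y.ip_add_left JJ oY)
    ultimately show ?thesis using sr(5)[OF i] by simp
  qed
  have inX: "u' i \<in> X" and inY: "v' i \<in> Y" for i
    using E sr x y tX wY unfolding u'_def v'_def tn_def wn_def by auto
  have tnX: "tn \<in> X" and wnY: "wn \<in> Y" using sr x y tX wY unfolding tn_def wn_def by auto
  have nu: "ipX tn (u' i) = ipY wn (v' i)" if "i < n" for i
    using un[OF that] X.ip_sym[OF inX tnX, of i] Y.ip_sym[OF inY wnY, of i] by simp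
  have nn: "ipX tn tn = ipY wn wn"
  proof -
    have "ipX tn tn = ipX t t + l2_ip st s s + l2_ip st x x"
      using sr x tX t unfolding tn_def by (simp add: X.ip_add X.ip_add_left JJ oX algebra_simps)
    moreover have "ipY wn wn = ipY w w + l2_ip st s s + l2_ip st y y"
      using sr y wY w unfolding wn_def by (simp add: Y.ip_add Y.ip_add_left JJ oY algebra_simps)
    ultimately show ?thesis using xy by (simp add: algebra_simps)
  qed
  have "exact (Suc n) (b + 3) u' v'"
    unfolding exact_def
  proof (intro allI impI conjI)
    fix i assume i: "i < Suc n"
    have J: "JX c q \<in> Xb (b + 3)" "JY c q \<in> Yb (b + 3)" if "c \<le> b + 2" "q \<in> l2 st I" for c q
      using X.Xb_mono[OF X.J_Xb[OF that(2), of c]] Y.Xb_mono[OF Y.J_Xb[OF that(2), of c]] that by auto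
    have up: "z \<in> Xb (b + 3)" if "z \<in> Xb b" for z using X.Xb_mono[OF that] by simp
    have upY: "z \<in> Yb (b + 3)" if "z \<in> Yb b" for z using Y.Xb_mono[OF that] by simp
    show "u' i \<in> Xb (b + 3)"
      using E(1) sr x t unfolding u'_def tn_def by (auto intro!: X.Xb_add J intro: up)
    show "v' i \<in> Yb (b + 3)"
      using E(2) sr y w unfolding v'_def wn_def by (auto intro!: Y.Xb_add J intro: upY)
    show "coh (u' i) (v' i)"
    proof (cases "i < n")
      case True
      have "coh (JX b (r i)) (JY b (r i))"
        using sr(3)[OF True] by (intro coh_ideal) (auto simp: JJ X.l2_ip_I)
      then show ?thesis using coh_add[OF E(5)[OF True]] True unfolding u'_def v'_def by simp
    next
      case False
      have "coh (JX (b + 1) s + JX (b + 2) x) (JY b s + JY (b + 2) y)"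
        using sr(1) x y
        by (intro coh_ideal) (auto simp: X.ip_add X.ip_add_left Y.ip_add Y.ip_add_left JJ intro!: X.I_add X.l2_ip_I)
      then show ?thesis using coh_add[OF tw] False unfolding u'_def v'_def tn_def wn_def by simp
    qed
    fix j assume j: "j < Suc n"
    have tn': "u' n = tn" "v' n = wn" unfolding u'_def v'_def by auto
    show "ipX (u' i) (u' j) = ipY (v' i) (v' j)"
      using i j uu un nu nn tn' by (metis less_Suc_eq)
  qed
  moreover have "close n (2 * \<epsilon>) u v u' v'"
    unfolding close_def u'_def v'_def using sr(3,4) by (simp add: X.nrm_J Y.nrm_J)
  moreover have "nX (u' n - t) \<le> 2 * \<epsilon> + n2 x"
    using X.nrm_triangle[of "JX (b + 1) s" "JX (b + 2) x"] sr(1,2) x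
    unfolding u'_def tn_def by (simp add: X.nrm_J)
  moreover have "nY (v' n - w) \<le> 2 * \<epsilon> + n2 y"
    using Y.nrm_triangle[of "JY b s" "JY (b + 2) y"] sr(1,2) y
    unfolding v'_def wn_def by (simp add: Y.nrm_J)
  ultimately show ?thesis by (rule that)
qed

lemma exact_step_X:
  assumes ex: "exact n b u v" and t: "t \<in> Xb b" and tI: "ipX t t \<in> I" and \<epsilon>: "\<epsilon> > 0"
  obtains u' v' where "exact (Suc n) (b + 3) u' v'" "close n (2 * \<epsilon>) u v u' v'" "nX (u' n - t) \<le> 2 * \<epsilon>"
proof -
  note E = exactD[OF ex]
  have tX: "t \<in> X" using t X.Xb_X by auto
  have "\<exists>c. (\<forall>i<n. c i \<in> I) \<and> (\<forall>i<n. norm (ipX (u i) (t - (\<Sum>i<n. actX (u i) (c i)))) \<le> \<epsilon>\<^sup>2) \<and>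
    X.pos (ipX t t - ipX (\<Sum>i<n. actX (u i) (c i)) (\<Sum>i<n. actX (u i) (c i)))" (is "\<exists>c. ?A c")
  proof (rule X.approximate_projection[of n u t I "\<epsilon>\<^sup>2"])
    fix c assume "\<And>i. i < n \<Longrightarrow> c i \<in> I"
      "\<And>i. i < n \<Longrightarrow> norm (ipX (u i) (t - (\<Sum>i<n. actX (u i) (c i)))) \<le> \<epsilon>\<^sup>2"
      "X.pos (ipX t t - ipX (\<Sum>i<n. actX (u i) (c i)) (\<Sum>i<n. actX (u i) (c i)))"
    then have "?A c" by simp
    then show ?thesis by (rule exI[where P = ?A])
  qed (use E(3) tX X.subspace_I X.I_mult_left X.ip_ideal[OF tX tI] \<epsilon> in auto)
  then obtain c where "?A c" by (rule exE[where P = ?A])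
  then have c: "\<And>i. i < n \<Longrightarrow> c i \<in> I"
    "\<And>i. i < n \<Longrightarrow> norm (ipX (u i) (t - (\<Sum>i<n. actX (u i) (c i)))) \<le> \<epsilon>\<^sup>2"
    "X.pos (ipX t t - ipX (\<Sum>i<n. actX (u i) (c i)) (\<Sum>i<n. actX (u i) (c i)))" by simp_all
  define t' w where "t' = (\<Sum>i<n. actX (u i) (c i))" and "w = (\<Sum>i<n. actY (v i) (c i))"
  have tw: "t' \<in> X" "w \<in> Y" "w \<in> Yb b" unfolding t'_def w_def using E by (auto intro!: Y.Xb_sum Y.Xb_act)
  have ut: "ipX (u i) t' = ipY (v i) w" if "i < n" for i
    unfolding t'_def w_def using E that by (simp add: X.ip_sum_lessThan Y.ip_sum_lessThan X.ip_act Y.ip_act)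
  have t't': "ipX t' t' = ipY w w"
  proof -
    have "ipX t' t' = (\<Sum>i<n. st (c i) * ipX (u i) t')"
      by (subst t'_def, subst X.ip_sum_left) (use tw E in \<open>auto simp: X.ip_act_left\<close>)
    moreover have "ipY w w = (\<Sum>i<n. st (c i) * ipY (v i) w)"
      by (subst w_def, subst Y.ip_sum_left) (use tw E in \<open>auto simp: Y.ip_act_left\<close>)
    ultimately show ?thesis using ut by simp
  qed
  \<comment> \<open>The coefficients \<open>c i\<close> lie in \<open>I\<close>, hence so does
    \<open>ipY w w\<close>; this makes \<open>t\<close> and \<open>w\<close> coherent by
    \<open>coh_ideal\<close>.\<close>
  have wI: "ipY w w \<in> I"
  proof -
    have "ipY w w = (\<Sum>i<n. ipY w (v i) * c i)"
      by (subst (2) w_def, subst Y.ip_sum_lessThan) (use tw E in \<open>auto simp: Y.ip_act\<close>)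
    then show ?thesis using c(1) by (auto intro!: subspace_sum X.subspace_I X.I_mult_left)
  qed
  have "X.pos (ipX t t - ipY w w)" "ipX t t - ipY w w \<in> I"
    using c(3) t't' tI wI X.I_diff unfolding t'_def by auto
  then obtain a where a: "a \<in> I" "st a * a = ipX t t - ipY w w" using X.pos_I_sqrt by metis
  define y where "y = single 0 a"
  have y: "y \<in> l2 st I" "l2_ip st y y = st a * a" unfolding y_def using X.single_L2[OF a(1)] by auto
  have d: "norm (ipX (u i) t - ipY (v i) w) \<le> \<epsilon>\<^sup>2" if "i < n" for i
    using c(2)[OF that] ut[OF that] E(3)[OF that] tX tw unfolding t'_def[symmetric] by (simp add: X.ip_diff)
  \<comment> \<open>The remaining defect is positive, so it is supplied on the Y side alone, with
    \<open>x = 0\<close>. Thus \<open>t\<close> is met up to \<open>2 * \<epsilon>\<close>, while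
    the new vector on the Y side is free and may be large.\<close>
  have e: "ipX t t - ipY w w = l2_ip st y y - l2_ip st 0 0" using y(2) a(2) X.L2_zero by simp
  obtain u' v' where "exact (Suc n) (b + 3) u' v'" "close n (2 * \<epsilon>) u v u' v'" "nX (u' n - t) \<le> 2 * \<epsilon> + n2 0"
    by (rule exact_extend[OF ex t tw(3) coh_ideal[OF tX tw(2) tI wI] \<epsilon> d X.L2_zero y(1) e])
  then show ?thesis using that by simp
qed

text \<open>Cutting with the same \<open>eu k\<close> on both sides preserves coherence and makes
  all defects smaller than \<open>\<epsilon>\<^sup>2\<close> for large \<open>k\<close>. The
  diagonal defect has no sign, so both sides receive a correction of norm up to
  \<open>2 * \<epsilon>\<close>, on top of the \<open>2 * \<epsilon>\<close> for \<open>s\<close>;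
  this gives the constant 4.\<close>

lemma exact_step_generators:
  assumes ex: "exact n b u v" and m: "m \<in> Xb b" and w: "w \<in> Yb b" and mw: "coh m w" and \<epsilon>: "\<epsilon> > 0"
  obtains u' v' k where "exact (Suc n) (b + 3) u' v'" "close n (2 * \<epsilon>) u v u' v'"
    "nX (u' n - (m - actX m (X.eu k))) \<le> 4 * \<epsilon>" "nY (v' n - (w - actY w (X.eu k))) \<le> 4 * \<epsilon>"
proof -
  note E = exactD[OF ex]
  have mX: "m \<in> X" and wY: "w \<in> Y" using m w X.Xb_X Y.Xb_X by auto
  define d where "d i = ipX (u i) m - ipY (v i) w" for i
  define e where "e = ipX m m - ipY w w"
  have dI: "d i \<in> I" if "i < n" for i unfolding d_def using coh_ip[OF E(5)[OF that] mw] .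
  have eI: "e \<in> I" unfolding e_def using coh_ip[OF mw mw] .
  have "\<forall>\<^sub>F k in sequentially. norm (d i - d i * X.eu k) < \<epsilon>\<^sup>2" if "i \<in> {..<n}" for i
    by (rule order_tendstoD(2)[OF tendsto_norm_zero[OF X.eu_right_diff]]) (use that dI \<epsilon> in auto)
  then have "\<forall>\<^sub>F k in sequentially. \<forall>i\<in>{..<n}. norm (d i - d i * X.eu k) < \<epsilon>\<^sup>2"
    by (intro eventually_ball_finite) auto
  moreover have "\<forall>\<^sub>F k in sequentially. norm ((e - e * X.eu k) - X.eu k * (e - e * X.eu k)) < \<epsilon>\<^sup>2"
    by (rule order_tendstoD(2)[OF tendsto_norm_zero[OF X.eu_sandwich[OF eI]]]) (use \<epsilon> in auto)
  ultimately have "\<forall>\<^sub>F k in sequentially. (\<forall>i\<in>{..<n}. norm (d i - d i * X.eu k) < \<epsilon>\<^sup>2)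
      \<and> norm ((e - e * X.eu k) - X.eu k * (e - e * X.eu k)) < \<epsilon>\<^sup>2" by (rule eventually_conj)
  then obtain k where k: "\<And>i. i < n \<Longrightarrow> norm (d i - d i * X.eu k) < \<epsilon>\<^sup>2"
    "norm ((e - e * X.eu k) - X.eu k * (e - e * X.eu k)) < \<epsilon>\<^sup>2"
    using eventually_happens'[OF sequentially_bot] by (metis (no_types, lifting) lessThan_iff)
  define t s where "t = m - actX m (X.eu k)" and "s = w - actY w (X.eu k)"
  define f where "f = (e - e * X.eu k) - X.eu k * (e - e * X.eu k)"
  have ts: "t \<in> Xb b" "s \<in> Yb b" "t \<in> X" "s \<in> Y"
    unfolding t_def s_def using m w mX wY by (auto intro: X.Xb_diff X.Xb_act Y.Xb_diff Y.Xb_act)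
  have "coh t s"
  proof -
    have "coh (actX m (- X.eu k)) (actY w (- X.eu k))" by (rule coh_act[OF mw])
    moreover have "actX m (- X.eu k) = - actX m (X.eu k)" "actY w (- X.eu k) = - actY w (X.eu k)"
      using X.act_diff[OF mX, of 0 "X.eu k"] Y.act_diff[OF wY, of 0 "X.eu k"] mX wY
      by (auto simp: X.act_zero Y.act_zero)
    ultimately show ?thesis unfolding t_def s_def using coh_add[OF mw] by fastforce
  qed
  have dk: "norm (ipX (u i) t - ipY (v i) s) \<le> \<epsilon>\<^sup>2" if "i < n" for i
  proof -
    have "ipX (u i) t - ipY (v i) s = d i - d i * X.eu k"
      unfolding t_def s_def d_def using E[OF that] mX wY
      by (simp add: X.ip_diff Y.ip_diff X.ip_act Y.ip_act algebra_simps)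
    then show ?thesis using k(1)[OF that] by simp
  qed
  have fe: "ipX t t - ipY s s = f"
    unfolding t_def s_def f_def e_def using mX wY
    by (simp add: X.ip_diff Y.ip_diff X.ip_diff_left Y.ip_diff_left X.ip_act Y.ip_act X.ip_act_left Y.ip_act_left algebra_simps)
  have "f \<in> I" unfolding f_def using eI by (intro X.I_diff X.I_mult_left X.I_mult_right)
  moreover have "st f = f" unfolding fe[symmetric] using ts by (simp add: X.ip_sym Y.ip_sym)
  moreover have "norm f \<le> \<epsilon>\<^sup>2" using k(2) unfolding f_def by simp
  ultimately obtain x y where xy: "x \<in> l2 st I" "y \<in> l2 st I" "n2 x \<le> 2 * \<epsilon>" "n2 y \<le> 2 * \<epsilon>"
    "f = l2_ip st y y - l2_ip st x x" using X.selfadjoint_difference[of f \<epsilon>] \<epsilon> by metis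
  obtain u' v' where uv: "exact (Suc n) (b + 3) u' v'" "close n (2 * \<epsilon>) u v u' v'"
    "nX (u' n - t) \<le> 2 * \<epsilon> + n2 x" "nY (v' n - s) \<le> 2 * \<epsilon> + n2 y"
    by (rule exact_extend[OF ex ts(1,2) \<open>coh t s\<close> \<epsilon> dk xy(1,2) fe[unfolded xy(5)]])
  then show ?thesis using that[OF uv(1,2), of k] xy(3,4) unfolding t_def s_def by simp
qed

end

section \<open>The limit of the construction\<close>

context pre_hmod
begin

definition closed_span :: "(nat \<Rightarrow> 'x) \<Rightarrow> 'x set" where
  "closed_span u = {x \<in> X. \<forall>e>0. \<exists>n c. nrm ((\<Sum>i<n. act (u i) (c i)) - x) < e}"

lemma closed_span_limit:
  assumes "\<And>i. u i \<in> X" "\<And>n. f n \<in> closed_span u" "x \<in> X" "(\<lambda>n. nrm (f n - x)) \<longlonglongrightarrow> 0"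
  shows "x \<in> closed_span u"
  unfolding closed_span_def
proof (intro CollectI conjI allI impI assms)
  fix e :: real assume e: "e > 0"
  then obtain n where n: "nrm (f n - x) < e / 2"
    using order_tendstoD(2)[OF assms(4), of "e / 2"] eventually_happens'[OF sequentially_bot] by fastforce
  obtain m c where c: "nrm ((\<Sum>i<m. act (u i) (c i)) - f n) < e / 2"
    using assms(2)[of n] e half_gt_zero unfolding closed_span_def by blast
  have "nrm ((\<Sum>i<m. act (u i) (c i)) - x) \<le> nrm ((\<Sum>i<m. act (u i) (c i)) - f n) + nrm (f n - x)"
    by (rule nrm_diff_triangle) (use assms(1-3) in \<open>auto simp: closed_span_def\<close>)
  then show "\<exists>n c. nrm ((\<Sum>i<n. act (u i) (c i)) - x) < e" using n c by (intro exI[of _ m] exI[of _ c]) simp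
qed

lemma closed_span_add:
  assumes u: "\<And>i. u i \<in> X" and "x \<in> closed_span u" "y \<in> closed_span u" shows "x + y \<in> closed_span u"
  unfolding closed_span_def
proof (intro CollectI conjI allI impI)
  have xy: "x \<in> X" "y \<in> X" using assms unfolding closed_span_def by auto
  then show "x + y \<in> X" by simp
  fix e :: real assume "e > 0"
  then have e2: "e / 2 > 0" by simp
  obtain n c where c: "nrm ((\<Sum>i<n. act (u i) (c i)) - x) < e / 2"
    using assms(2) e2 unfolding closed_span_def by blast
  obtain m d where d: "nrm ((\<Sum>i<m. act (u i) (d i)) - y) < e / 2"
    using assms(3) e2 unfolding closed_span_def by blast
  define N where "N = max n m"
  define c' d' where "c' i = (if i < n then c i else 0)" and "d' i = (if i < m then d i else 0)" for i
  have c': "(\<Sum>i<n. act (u i) (c i)) = (\<Sum>i<N. act (u i) (c' i))"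
    by (rule sum.mono_neutral_cong_left) (auto simp: N_def c'_def act_zero u)
  have d': "(\<Sum>i<m. act (u i) (d i)) = (\<Sum>i<N. act (u i) (d' i))"
    by (rule sum.mono_neutral_cong_left) (auto simp: N_def d'_def act_zero u)
  have "(\<Sum>i<N. act (u i) (c' i + d' i)) - (x + y)
      = ((\<Sum>i<n. act (u i) (c i)) - x) + ((\<Sum>i<m. act (u i) (d i)) - y)"
    unfolding c' d' using u by (simp add: act_add sum.distrib)
  moreover have "nrm (((\<Sum>i<n. act (u i) (c i)) - x) + ((\<Sum>i<m. act (u i) (d i)) - y)) < e / 2 + e / 2"
    by (rule le_less_trans[OF nrm_triangle add_strict_mono[OF c d]]) (use u xy in auto)
  ultimately have "nrm ((\<Sum>i<N. act (u i) (c' i + d' i)) - (x + y)) < e" by (metis field_sum_of_halves)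
  then show "\<exists>n c. nrm ((\<Sum>i<n. act (u i) (c i)) - (x + y)) < e"
    by (intro exI[of _ N] exI[of _ "\<lambda>i. c' i + d' i"])
qed

lemma closed_span_zero: "0 \<in> closed_span u"
  unfolding closed_span_def by (auto intro!: exI[of _ 0])

lemma closed_span_act_base: assumes u: "\<And>i. u i \<in> X" shows "act (u i) a \<in> closed_span u"
  unfolding closed_span_def
proof (intro CollectI conjI allI impI)
  show "act (u i) a \<in> X" using u by simp
  fix e :: real assume "e > 0"
  have "(\<Sum>j<Suc i. act (u j) (if j = i then a else 0)) = (\<Sum>j\<in>{i}. act (u j) a)"
    by (rule sum.mono_neutral_cong_right) (auto simp: act_zero u)
  then have "nrm ((\<Sum>j<Suc i. act (u j) (if j = i then a else 0)) - act (u i) a) < e" using \<open>e > 0\<close> by simp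
  then show "\<exists>n c. nrm ((\<Sum>i<n. act (u i) (c i)) - act (u i) a) < e"
    by (intro exI[of _ "Suc i"] exI[of _ "\<lambda>j. if j = i then a else 0"])
qed

text \<open>Stated for \<open>act t a\<close> because without a unit in \<open>A\<close> the vectors
  \<open>u i\<close> themselves need not be of the form \<open>act (u i) c\<close>. The bound
  \<open>2 / 2 ^ p\<close> is the accuracy with which requests are served.\<close>

lemma closed_span_act_approx:
  assumes u: "\<And>i. u i \<in> X" and t: "t \<in> X"
    and w: "\<And>p. \<exists>w\<in>X. nrm (w - t) \<le> 2 / 2 ^ p \<and> act w a \<in> closed_span u"
  shows "act t a \<in> closed_span u"
proof -
  obtain w where w: "\<And>p. w p \<in> X" "\<And>p. nrm (w p - t) \<le> 2 / 2 ^ p" "\<And>p. act (w p) a \<in> closed_span u"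
    using w by metis
  show ?thesis
  proof (rule closed_span_limit[OF u w(3)])
    have "nrm (act (w p) a - act t a) \<le> 2 * norm a * (1/2) ^ p" for p
    proof -
      have "nrm (act (w p - t) a) \<le> nrm (w p - t) * norm a" using w t by (intro nrm_act) simp
      also have "\<dots> \<le> 2 / 2 ^ p * norm a" by (intro mult_right_mono w) simp
      finally show ?thesis using w(1) t by (simp add: act_diff_left power_divide)
    qed
    moreover have "(\<lambda>p. 2 * norm a * (1/2) ^ p) \<longlonglongrightarrow> 0"
      by (intro tendsto_mult_right_zero LIMSEQ_power_zero) simp
    ultimately show "(\<lambda>p. nrm (act (w p) a - act t a)) \<longlonglongrightarrow> 0"
      by (intro Lim_null_comparison[where f = "\<lambda>p. nrm (act (w p) a - act t a)"]) auto
  qed (use t in simp)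
qed

end

lemma (in hmod) geometric_limit:
  assumes f: "\<And>n. f n \<in> X" and d: "\<And>n. nrm (f (Suc n) - f n) \<le> C / 2 ^ n" and C: "C \<ge> 0"
  obtains x where "x \<in> X" "(\<lambda>n. nrm (f n - x)) \<longlonglongrightarrow> 0" "nrm (f 0 - x) \<le> 2 * C"
proof -
  have b: "nrm (f (n + k) - f n) \<le> 2 * C / 2 ^ n - 2 * C / 2 ^ (n + k)" for n k
  proof (induction k)
    case (Suc k)
    have "nrm (f (n + Suc k) - f n) \<le> nrm (f (n + Suc k) - f (n + k)) + nrm (f (n + k) - f n)"
      by (rule nrm_diff_triangle) (rule f)+
    also have "\<dots> \<le> C / 2 ^ (n + k) + (2 * C / 2 ^ n - 2 * C / 2 ^ (n + k))"
      using d[of "n + k"] Suc by (intro add_mono) auto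
    also have "\<dots> = 2 * C / 2 ^ n - 2 * C / 2 ^ (n + Suc k)" by (simp add: field_simps)
    finally show ?case .
  qed simp
  have b': "nrm (f m - f n) \<le> 2 * C / 2 ^ n" if "n \<le> m" for m n
    using b[of n "m - n"] that C by (simp add: order_trans)
  have "\<exists>x\<in>X. (\<lambda>n. nrm (f n - x)) \<longlonglongrightarrow> 0"
  proof (rule complete[OF f])
    fix e :: real assume "e > 0"
    have "(\<lambda>n. 2 * C * (1/2) ^ n) \<longlonglongrightarrow> 0" by (intro tendsto_mult_right_zero LIMSEQ_power_zero) simp
    from order_tendstoD(2)[OF this \<open>e > 0\<close>] obtain N where N: "\<And>n. n \<ge> N \<Longrightarrow> 2 * C / 2 ^ n < e"
      unfolding eventually_sequentially by (auto simp: power_divide)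
    have "nrm (f m - f n) < e" if "m \<ge> N" "n \<ge> N" for m n
    proof (cases "n \<le> m")
      case True
      then show ?thesis using b' N[OF that(2)] by (meson le_less_trans)
    next
      case False
      then have "nrm (f n - f m) < e" using b'[of m n] N[OF that(1)] by (meson le_less_trans nat_le_linear)
      then show ?thesis using nrm_diff_commute f by metis
    qed
    then show "\<exists>N. \<forall>m\<ge>N. \<forall>n\<ge>N. nrm (f m - f n) < e" by blast
  qed
  then obtain x where x: "x \<in> X" "(\<lambda>n. nrm (f n - x)) \<longlonglongrightarrow> 0" by blast
  have "nrm (f 0 - x) \<le> 2 * C + nrm (f n - x)" for n
    using nrm_diff_triangle[OF f f x(1), of 0 n] b'[of 0 n] nrm_diff_commute[OF f f, of 0 n] by simp
  moreover have "(\<lambda>n. 2 * C + nrm (f n - x)) \<longlonglongrightarrow> 2 * C + 0" by (intro tendsto_intros x)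
  ultimately have "nrm (f 0 - x) \<le> 2 * C + 0" by (intro tendsto_lowerbound[where F = sequentially]) auto
  then show ?thesis using that x by simp
qed

context back_and_forth
begin

text \<open>The axioms of \<open>back_and_forth\<close> are symmetric, so it is interpreted with the
  two sides exchanged and \<open>coh\<close> reversed; \<open>exact_step_X\<close> of that
  interpretation is the claim.\<close>

lemma exact_step_Y:
  assumes ex: "exact n b u v" and t: "t \<in> Yb b" and tI: "ipY t t \<in> I" and \<epsilon>: "\<epsilon> > 0"
  obtains u' v' where "exact (Suc n) (b + 3) u' v'" "close n (2 * \<epsilon>) u v u' v'" "nY (v' n - t) \<le> 2 * \<epsilon>"
proof -
  interpret R: back_and_forth cs st I Y actY ipY Yb JY X actX ipX Xb JX "\<lambda>y x. coh x y"
  proof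
    fix x x' y y' assume "coh x y" "coh x' y'"
    from X.I_minus[OF coh_ip[OF this]] show "ipY y y' - ipX x x' \<in> I" by simp
  next
    show "coh x y" if "\<And>n. coh (f n) (g n)" "y \<in> Y" "x \<in> X" "(\<lambda>n. nY (g n - y)) \<longlonglongrightarrow> 0" "(\<lambda>n. nX (f n - x)) \<longlonglongrightarrow> 0"
      for f g x y using coh_limit[OF that(1,3,2,5,4)] .
  next
    show "coh x y" if "y \<in> Y" "x \<in> X" "ipY y y \<in> I" "ipX x x \<in> I" for x y
      using coh_ideal[OF that(2,1,4,3)] .
    show "y \<in> Y \<and> x \<in> X" if "coh x y" for x y using coh_in[OF that] by simp
  qed (rule coh_add coh_act; assumption)+
  have sw: "R.exact n b v u \<longleftrightarrow> exact n b u v" for n b u v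
    unfolding exact_def R.exact_def by metis
  have sc: "R.close n e v u v' u' \<longleftrightarrow> close n e u v u' v'" for n e u v u' v'
    unfolding close_def R.close_def by blast
  show ?thesis
    using R.exact_step_X[unfolded sw sc, OF ex t tI \<epsilon>] that by metis
qed

end

text \<open>\<open>mt\<close> ensures that the parts cut off from the generators are themselves
  targets. \<open>genX\<close> and \<open>genY\<close> speak of arbitrary closed additive sets
  \<open>Z\<close>, so that the closed spans of the constructed families can be inserted.\<close>

locale back_and_forth_generated =
  back_and_forth cs st I X actX ipX Xb JX Y actY ipY Yb JY coh
  for cs :: "complex \<Rightarrow> 'a::{real_normed_algebra,banach} \<Rightarrow> 'a" and st :: "'a \<Rightarrow> 'a" and I :: "'a set"
    and X :: "'x::ab_group_add set" and actX ipX Xb JX and Y :: "'y::ab_group_add set" and actY ipY Yb JY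
    and coh :: "'x \<Rightarrow> 'y \<Rightarrow> bool" +
  fixes tX mX :: "nat \<Rightarrow> 'x" and tY mY :: "nat \<Rightarrow> 'y"
  assumes tX: "\<And>j. \<exists>b. tX j \<in> Xb b" "\<And>j. ipX (tX j) (tX j) \<in> I"
    and tY: "\<And>j. \<exists>b. tY j \<in> Yb b" "\<And>j. ipY (tY j) (tY j) \<in> I"
    and m: "\<And>j. coh (mX j) (mY j)" "\<And>j. mX j \<in> Xb 0" "\<And>j. mY j \<in> Yb 0"
    and mt: "\<And>j k. \<exists>i. tX i = actX (mX j) (X.eu k)" "\<And>j k. \<exists>i. tY i = actY (mY j) (X.eu k)"
    and genX: "\<And>Z x. 0 \<in> Z \<Longrightarrow> (\<And>x y. x \<in> Z \<Longrightarrow> y \<in> Z \<Longrightarrow> x + y \<in> Z) \<Longrightarrow>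
       (\<And>f x. (\<And>n. f n \<in> Z) \<Longrightarrow> x \<in> X \<Longrightarrow> (\<lambda>n. ipnorm ipX (f n - x)) \<longlonglongrightarrow> 0 \<Longrightarrow> x \<in> Z) \<Longrightarrow>
       (\<And>j a. actX (tX j) a \<in> Z) \<Longrightarrow> (\<And>j a. actX (mX j) a \<in> Z) \<Longrightarrow> x \<in> X \<Longrightarrow> x \<in> Z"
    and genY: "\<And>Z y. 0 \<in> Z \<Longrightarrow> (\<And>x y. x \<in> Z \<Longrightarrow> y \<in> Z \<Longrightarrow> x + y \<in> Z) \<Longrightarrow>
       (\<And>f x. (\<And>n. f n \<in> Z) \<Longrightarrow> x \<in> Y \<Longrightarrow> (\<lambda>n. ipnorm ipY (f n - x)) \<longlonglongrightarrow> 0 \<Longrightarrow> x \<in> Z) \<Longrightarrow>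
       (\<And>j a. actY (tY j) a \<in> Z) \<Longrightarrow> (\<And>j a. actY (mY j) a \<in> Z) \<Longrightarrow> y \<in> Y \<Longrightarrow> y \<in> Z"
begin

text \<open>In the third kind \<open>k\<close> stays existential, as the stage that serves the
  request picks it. What is then missing from the generator is recovered from the targets by
  \<open>mt\<close>, for whichever \<open>k\<close> was picked.\<close>

definition request :: "nat \<Rightarrow> real \<Rightarrow> 'x \<Rightarrow> 'y \<Rightarrow> bool" where
  "request j \<epsilon> x y \<longleftrightarrow>
    (if j mod 3 = 0 then nX (x - tX (j div 3)) \<le> \<epsilon>
     else if j mod 3 = 1 then nY (y - tY (j div 3)) \<le> \<epsilon>
     else \<exists>k. nX (x - (mX (j div 3) - actX (mX (j div 3)) (X.eu k))) \<le> \<epsilon> \<and>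
              nY (y - (mY (j div 3) - actY (mY (j div 3)) (X.eu k))) \<le> \<epsilon>)"

lemma exact_step:
  assumes ex: "exact n b u v" and \<epsilon>: "\<epsilon> > 0"
  shows "\<exists>b' u' v'. exact (Suc n) b' u' v' \<and> close n \<epsilon> u v u' v' \<and> request j \<epsilon> (u' n) (v' n)"
proof -
  define i where "i = j div 3"
  \<comment> \<open>The weakest estimate among the three steps, that for generators, has the
    constant 4.\<close>
  have \<epsilon>4: "\<epsilon> / 4 > 0" using \<epsilon> by simp
  have cl: "close n (2 * (\<epsilon> / 4)) u v u' v' \<Longrightarrow> close n \<epsilon> u v u' v'" for u' v'
  proof -
    have "2 * (\<epsilon> / 4) \<le> \<epsilon>" using \<epsilon> by simp
    then show "close n (2 * (\<epsilon> / 4)) u v u' v' \<Longrightarrow> close n \<epsilon> u v u' v'"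
      unfolding close_def by (meson order_trans)
  qed
  consider "j mod 3 = 0" | "j mod 3 = 1" | "j mod 3 \<noteq> 0" "j mod 3 \<noteq> 1" by blast
  then show ?thesis
  proof cases
    case 1
    obtain c where c: "tX i \<in> Xb c" using tX by blast
    obtain u' v' where "exact (Suc n) (max b c + 3) u' v'" "close n (2 * (\<epsilon> / 4)) u v u' v'"
       "nX (u' n - tX i) \<le> 2 * (\<epsilon> / 4)"
      by (rule exact_step_X[OF exact_mono[OF ex] X.Xb_mono[OF c] tX(2) \<epsilon>4, of "max b c"]) auto
    then show ?thesis using 1 cl \<epsilon> unfolding request_def i_def
      by (intro exI[of _ "max b c + 3"] exI[of _ u'] exI[of _ v']) auto
  next
    case 2
    obtain c where c: "tY i \<in> Yb c" using tY by blast
    obtain u' v' where "exact (Suc n) (max b c + 3) u' v'" "close n (2 * (\<epsilon> / 4)) u v u' v'"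
       "nY (v' n - tY i) \<le> 2 * (\<epsilon> / 4)"
      by (rule exact_step_Y[OF exact_mono[OF ex] Y.Xb_mono[OF c] tY(2) \<epsilon>4, of "max b c"]) auto
    then show ?thesis using 2 cl \<epsilon> unfolding request_def i_def
      by (intro exI[of _ "max b c + 3"] exI[of _ u'] exI[of _ v']) auto
  next
    case 3
    obtain u' v' k where "exact (Suc n) (b + 3) u' v'" "close n (2 * (\<epsilon> / 4)) u v u' v'"
       "nX (u' n - (mX i - actX (mX i) (X.eu k))) \<le> 4 * (\<epsilon> / 4)"
       "nY (v' n - (mY i - actY (mY i) (X.eu k))) \<le> 4 * (\<epsilon> / 4)"
      by (rule exact_step_generators[OF ex X.Xb_mono[OF m(2)] Y.Xb_mono[OF m(3)] m(1) \<epsilon>4, of i]) auto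
    then show ?thesis using 3 cl unfolding request_def i_def
      by (intro exI[of _ "b + 3"] exI[of _ u'] exI[of _ v']) auto
  qed
qed

text \<open>Stage \<open>s\<close> serves request \<open>fst (prod_decode s)\<close>, so every request is served infinitely often.\<close>
lemma exact_families:
  obtains u v where "\<And>i. u i \<in> X" "\<And>i. v i \<in> Y" "\<And>i j. ipX (u i) (u j) = ipY (v i) (v j)"
    "\<And>i. coh (u i) (v i)" "\<And>s. request (fst (prod_decode s)) (2 / 2 ^ s) (u s) (v s)"
proof -
  let ?P = "\<lambda>n S. case S of (b, u, v) \<Rightarrow> exact n b u v"
  let ?Q = "\<lambda>n S S'. case S of (b, u, v) \<Rightarrow> case S' of (b', u', v') \<Rightarrow>
      close n (1 / 2 ^ n) u v u' v' \<and> request (fst (prod_decode n)) (1 / 2 ^ n) (u' n) (v' n)"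
  have "\<exists>f. \<forall>n. ?P n (f n) \<and> ?Q n (f n) (f (Suc n))"
  proof (rule dependent_nat_choice)
    show "\<exists>S. ?P 0 S" by (intro exI[of _ "(0, undefined, undefined)"]) (simp add: exact_def)
    fix S n assume "?P n S"
    then obtain b u v where S: "S = (b, u, v)" "exact n b u v" by (cases S) auto
    show "\<exists>S'. ?P (Suc n) S' \<and> ?Q n S S'"
      using exact_step[OF S(2), of "1 / 2 ^ n" "fst (prod_decode n)"] unfolding S(1) by fastforce
  qed
  then obtain f where "\<forall>n. ?P n (f n) \<and> ?Q n (f n) (f (Suc n))" by (rule exE)
  then have f: "\<And>n. ?P n (f n)" "\<And>n. ?Q n (f n) (f (Suc n))" by simp_all
  define b U V where "b n = fst (f n)" and "U n = fst (snd (f n))" and "V n = snd (snd (f n))" for n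
  have ex: "exact n (b n) (U n) (V n)" for n using f(1)[of n] unfolding b_def U_def V_def by (simp add: case_prod_unfold)
  have Q: "close n (1 / 2 ^ n) (U n) (V n) (U (Suc n)) (V (Suc n))"
    "request (fst (prod_decode n)) (1 / 2 ^ n) (U (Suc n) n) (V (Suc n) n)" for n
    using f(2)[of n] unfolding U_def V_def by (simp_all add: case_prod_unfold)
  note E = exactD[OF ex]
  \<comment> \<open>Entry \<open>i\<close> is first present in \<open>U (Suc i)\<close>. From there
    its drift is at most the sum of \<open>1 / 2 ^ n\<close> over \<open>n > i\<close>, that is
    \<open>1 / 2 ^ i\<close>; together with the accuracy \<open>1 / 2 ^ i\<close> of the request
    this yields the factor 2.\<close>
  have "\<exists>x. x \<in> X \<and> (\<lambda>k. nX (U (Suc i + k) i - x)) \<longlonglongrightarrow> 0 \<and> nX (U (Suc i + 0) i - x) \<le> 2 * (1 / 2 ^ Suc i)" for i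
  proof (rule X.geometric_limit[of "\<lambda>k. U (Suc i + k) i" "1 / 2 ^ Suc i"])
    show "U (Suc i + k) i \<in> X" for k by (rule E) simp
    show "nX (U (Suc i + Suc k) i - U (Suc i + k) i) \<le> 1 / 2 ^ Suc i / 2 ^ k" for k
      using Q(1)[of "Suc i + k"] unfolding close_def by (simp add: power_add mult.assoc)
  qed auto
  then obtain u where u: "\<And>i. u i \<in> X" "\<And>i. (\<lambda>k. nX (U (Suc i + k) i - u i)) \<longlonglongrightarrow> 0"
    "\<And>i. nX (U (Suc i) i - u i) \<le> 1 / 2 ^ i" by (simp add: choice_iff) metis
  have "\<exists>x. x \<in> Y \<and> (\<lambda>k. nY (V (Suc i + k) i - x)) \<longlonglongrightarrow> 0 \<and> nY (V (Suc i + 0) i - x) \<le> 2 * (1 / 2 ^ Suc i)" for i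
  proof (rule Y.geometric_limit[of "\<lambda>k. V (Suc i + k) i" "1 / 2 ^ Suc i"])
    show "V (Suc i + k) i \<in> Y" for k by (rule E) simp
    show "nY (V (Suc i + Suc k) i - V (Suc i + k) i) \<le> 1 / 2 ^ Suc i / 2 ^ k" for k
      using Q(1)[of "Suc i + k"] unfolding close_def by (simp add: power_add mult.assoc)
  qed auto
  then obtain v where v: "\<And>i. v i \<in> Y" "\<And>i. (\<lambda>k. nY (V (Suc i + k) i - v i)) \<longlonglongrightarrow> 0"
    "\<And>i. nY (V (Suc i) i - v i) \<le> 1 / 2 ^ i" by (simp add: choice_iff) metis
  show ?thesis
  proof (rule that[of u v])
    fix i j s
    show "u i \<in> X" "v i \<in> Y" by (rule u v)+
    \<comment> \<open>The shifts bring both sequences to the common stage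
      \<open>Suc i + (k + Suc j)\<close>, at which entries \<open>i\<close> and \<open>j\<close> are
      both present.\<close>
    have a: "(\<lambda>k. nX (U (Suc i + (k + Suc j)) i - u i)) \<longlonglongrightarrow> 0" "(\<lambda>k. nX (U (Suc j + (k + Suc i)) j - u j)) \<longlonglongrightarrow> 0"
      "(\<lambda>k. nY (V (Suc i + (k + Suc j)) i - v i)) \<longlonglongrightarrow> 0" "(\<lambda>k. nY (V (Suc j + (k + Suc i)) j - v j)) \<longlonglongrightarrow> 0"
      by (rule LIMSEQ_ignore_initial_segment[OF u(2)] LIMSEQ_ignore_initial_segment[OF v(2)])+
    have "Suc j + (k + Suc i) = Suc i + (k + Suc j)" for k by simp
    note a = a[unfolded this]
    have "(\<lambda>k. ipX (U (Suc i + (k + Suc j)) i) (U (Suc i + (k + Suc j)) j)) \<longlonglongrightarrow> ipX (u i) (u j)"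
      by (rule X.tendsto_ip[OF E(3) u(1) a(1) E(3) u(1) a(2)]) auto
    moreover have "(\<lambda>k. ipY (V (Suc i + (k + Suc j)) i) (V (Suc i + (k + Suc j)) j)) \<longlonglongrightarrow> ipY (v i) (v j)"
      by (rule Y.tendsto_ip[OF E(4) v(1) a(3) E(4) v(1) a(4)]) auto
    moreover have "ipX (U (Suc i + (k + Suc j)) i) (U (Suc i + (k + Suc j)) j)
        = ipY (V (Suc i + (k + Suc j)) i) (V (Suc i + (k + Suc j)) j)" for k
      by (rule E(6)) auto
    ultimately show "ipX (u i) (u j) = ipY (v i) (v j)" using LIMSEQ_unique by simp
    show "coh (u i) (v i)"
      by (rule coh_limit[OF E(5) u(1) v(1) u(2) v(2)]) simp
    have tri: "nX (u s - z) \<le> 2 / 2 ^ s" if "nX (U (Suc s) s - z) \<le> 1 / 2 ^ s" "z \<in> X" for z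
      using X.nrm_diff_triangle[OF u(1)[of s] E(3)[of s "Suc s"] that(2)] u(3)[of s] that
        X.nrm_diff_commute[OF u(1)[of s] E(3)[of s "Suc s"]] by simp
    have triY: "nY (v s - z) \<le> 2 / 2 ^ s" if "nY (V (Suc s) s - z) \<le> 1 / 2 ^ s" "z \<in> Y" for z
      using Y.nrm_diff_triangle[OF v(1)[of s] E(4)[of s "Suc s"] that(2)] v(3)[of s] that
        Y.nrm_diff_commute[OF v(1)[of s] E(4)[of s "Suc s"]] by simp
    have tin: "tX j \<in> X" "tY j \<in> Y" "mX j \<in> X" "mY j \<in> Y" for j
      using tX(1)[of j] tY(1)[of j] m(2,3)[of j] X.Xb_X Y.Xb_X by auto
    show "request (fst (prod_decode s)) (2 / 2 ^ s) (u s) (v s)"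
      using Q(2)[of s] unfolding request_def by (auto split: if_splits intro!: tri triY tin) (metis tri triY tin X.diff_X Y.diff_X X.act_X Y.act_X)
  qed
qed

lemma tXY_in: "tX j \<in> X" "tY j \<in> Y" "mX j \<in> X" "mY j \<in> Y"
  using tX(1)[of j] tY(1)[of j] m(2,3)[of j] X.Xb_X Y.Xb_X by auto

lemma request_mono: "request j \<delta> x y \<Longrightarrow> \<delta> \<le> \<epsilon> \<Longrightarrow> request j \<epsilon> x y"
  unfolding request_def by (auto split: if_splits intro: order_trans)

theorem coherent_unitary: "\<exists>U. unitary_op X ipX Y ipY U \<and> (\<forall>x\<in>X. coh x (U x))"
proof -
  obtain u v where u: "\<And>i. u i \<in> X" and v: "\<And>i. v i \<in> Y" and gr: "\<And>i j. ipX (u i) (u j) = ipY (v i) (v j)"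
    and co: "\<And>i. coh (u i) (v i)" and rq: "\<And>s. request (fst (prod_decode s)) (2 / 2 ^ s) (u s) (v s)"
    using exact_families by metis
  have r: "\<exists>s. request j (2 / 2 ^ p) (u s) (v s)" for j p
  proof -
    \<comment> \<open>Stage \<open>prod_encode (j, p)\<close> serves request \<open>j\<close> and is
      at least \<open>p\<close>, so accuracy \<open>2 / 2 ^ p\<close> is reached.\<close>
    have "(2::real) / 2 ^ prod_encode (j, p) \<le> 2 / 2 ^ p"
      by (intro divide_left_mono power_increasing le_prod_encode_2) auto
    then show ?thesis using request_mono[OF rq[of "prod_encode (j, p)"]] by auto
  qed
  have tXz: "actX (tX j) a \<in> X.closed_span u" for j a
  proof (rule X.closed_span_act_approx[OF u tXY_in(1)])
    fix p
    obtain s where "request (3 * j) (2 / 2 ^ p) (u s) (v s)" using r by blast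
    then show "\<exists>w\<in>X. nX (w - tX j) \<le> 2 / 2 ^ p \<and> actX w a \<in> X.closed_span u"
      using u X.closed_span_act_base[OF u] unfolding request_def by (intro bexI[of _ "u s"]) auto
  qed
  have tYz: "actY (tY j) a \<in> Y.closed_span v" for j a
  proof (rule Y.closed_span_act_approx[OF v tXY_in(2)])
    fix p
    have "(3 * j + 1) mod 3 = 1" "(3 * j + 1) div 3 = j" by presburger+
    moreover obtain s where "request (3 * j + 1) (2 / 2 ^ p) (u s) (v s)" using r by blast
    ultimately show "\<exists>w\<in>Y. nY (w - tY j) \<le> 2 / 2 ^ p \<and> actY w a \<in> Y.closed_span v"
      using v Y.closed_span_act_base[OF v] unfolding request_def by (intro bexI[of _ "v s"]) auto
  qed
  have rm: "\<exists>s k. nX (u s - (mX j - actX (mX j) (X.eu k))) \<le> 2 / 2 ^ p \<and>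
      nY (v s - (mY j - actY (mY j) (X.eu k))) \<le> 2 / 2 ^ p" for j p
  proof -
    have "(3 * j + 2) mod 3 = 2" "(3 * j + 2) div 3 = j" by presburger+
    moreover obtain s where "request (3 * j + 2) (2 / 2 ^ p) (u s) (v s)" using r by blast
    ultimately show ?thesis unfolding request_def by auto
  qed
  have mXz: "actX (mX j) a \<in> X.closed_span u" for j a
  proof (rule X.closed_span_act_approx[OF u tXY_in(3)])
    fix p
    obtain s k where s: "nX (u s - (mX j - actX (mX j) (X.eu k))) \<le> 2 / 2 ^ p" using rm by blast
    obtain i where i: "tX i = actX (mX j) (X.eu k)" using mt by blast
    \<comment> \<open>\<open>u s\<close> approximates \<open>m - m e_k\<close>, and the target
      \<open>tX i\<close> is the cut-off part \<open>m e_k\<close>; their sum approximates the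
      generator with an error independent of \<open>k\<close>.\<close>
    have "actX (u s + tX i) a \<in> X.closed_span u"
      using X.closed_span_add[OF u X.closed_span_act_base[OF u] tXz] u tXY_in by (simp add: X.act_add_left)
    then show "\<exists>w\<in>X. nX (w - mX j) \<le> 2 / 2 ^ p \<and> actX w a \<in> X.closed_span u"
      using s u tXY_in(1) unfolding i[symmetric] by (intro bexI[of _ "u s + tX i"]) (auto simp: algebra_simps)
  qed
  have mYz: "actY (mY j) a \<in> Y.closed_span v" for j a
  proof (rule Y.closed_span_act_approx[OF v tXY_in(4)])
    fix p
    obtain s k where s: "nY (v s - (mY j - actY (mY j) (X.eu k))) \<le> 2 / 2 ^ p" using rm by blast
    obtain i where i: "tY i = actY (mY j) (X.eu k)" using mt by blast
    have "actY (v s + tY i) a \<in> Y.closed_span v"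
      using Y.closed_span_add[OF v Y.closed_span_act_base[OF v] tYz] v tXY_in by (simp add: Y.act_add_left)
    then show "\<exists>w\<in>Y. nY (w - mY j) \<le> 2 / 2 ^ p \<and> actY w a \<in> Y.closed_span v"
      using s v tXY_in(2) unfolding i[symmetric] by (intro bexI[of _ "v s + tY i"]) (auto simp: algebra_simps)
  qed
  have dX: "x \<in> X.closed_span u" if "x \<in> X" for x
    by (rule genX[OF X.closed_span_zero X.closed_span_add[OF u] X.closed_span_limit[OF u] tXz mXz that])
  have dY: "y \<in> Y.closed_span v" if "y \<in> Y" for y
    by (rule genY[OF Y.closed_span_zero Y.closed_span_add[OF v] Y.closed_span_limit[OF v] tYz mYz that])
  have "isometric_families cs st X actX ipX Y actY ipY u v"
    by unfold_locales (use u v gr in auto)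
  then obtain U where U: "unitary_op X ipX Y ipY U"
    "\<And>x. x \<in> X \<Longrightarrow> \<exists>n c. (\<lambda>k. nX ((\<Sum>i<n k. actX (u i) (c k i)) - x)) \<longlonglongrightarrow> 0 \<and>
        (\<lambda>k. nY ((\<Sum>i<n k. actY (v i) (c k i)) - U x)) \<longlonglongrightarrow> 0"
    by (rule isometric_families_unitary) (use dX dY in \<open>auto simp: X.closed_span_def Y.closed_span_def\<close>)
  have cs: "coh (\<Sum>i<n. actX (u i) (c i)) (\<Sum>i<n. actY (v i) (c i))" for n :: nat and c
    by (induction n) (auto intro!: coh_add coh_act co coh_ideal)
  have "coh x (U x)" if x: "x \<in> X" for x
  proof -
    obtain n c where "(\<lambda>k. nX ((\<Sum>i<n k. actX (u i) (c k i)) - x)) \<longlonglongrightarrow> 0"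
        "(\<lambda>k. nY ((\<Sum>i<n k. actY (v i) (c k i)) - U x)) \<longlonglongrightarrow> 0" using U(2)[OF x] by blast
    moreover have "U x \<in> Y" using U(1) x unfolding unitary_op_def by blast
    ultimately show ?thesis using coh_limit[OF cs x] by blast
  qed
  then show ?thesis using U(1) by blast
qed

end

section \<open>Lifting a unitary of the quotients\<close>

context hilbert_with_ideal
begin

lemma act_scaleR: "r *\<^sub>R act x a = act x (r *\<^sub>R a)"
  and ip_scaleR: "ip x (r *\<^sub>R y) = r *\<^sub>R ip x y"
  using hm cs_of_real unfolding hilbert_module_def by metis+

lemma bounded_linear_ip: "bounded_linear (ip y)"
  by (rule bounded_linear_intro[where K = "norm y"])
     (use M.norm_ip_le[of y] in \<open>auto simp: M.ip_add ip_scaleR norm_eq_ipnorm mult.commute\<close>)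

abbreviation "MI \<equiv> submod_ideal act I"

text \<open>The vectors whose inner products with every \<open>y\<close> lie in \<open>I\<close>
  form a closed subspace containing the generators of \<open>MI\<close>; asking this for all
  \<open>y\<close> makes the condition linear. Conversely, \<open>act z (eu k)\<close> tends to
  \<open>z\<close>.\<close>

lemma submod_ideal_iff: "z \<in> MI \<longleftrightarrow> ip z z \<in> I"
proof
  let ?W = "\<Inter>y. ip y -` I"
  have "closed ?W"
    using bounded_linear_ip I_closed
    by (intro closed_INT ballI continuous_closed_vimage) (auto intro: linear_continuous_at)
  moreover have "subspace ?W"
    unfolding subspace_def by (auto simp: M.ip_add ip_scaleR I_add I_scaleR)
  moreover have "{act m i | m i. i \<in> I} \<subseteq> ?W" by (auto simp: M.ip_act I_mult_left)
  ultimately have "MI \<subseteq> ?W"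
    unfolding submod_ideal_def by (intro closure_minimal span_minimal)
  then show "z \<in> MI \<Longrightarrow> ip z z \<in> I" by blast
  assume "ip z z \<in> I"
  then have "(\<lambda>k. norm (act z (eu k) - z)) \<longlonglongrightarrow> 0"
    using M.act_eu_tendsto[of z] unfolding norm_eq_ipnorm by simp
  then have "(\<lambda>k. act z (eu k)) \<longlonglongrightarrow> z" by (simp add: LIM_zero_iff tendsto_norm_zero_iff)
  moreover have "act z (eu k) \<in> span {act m i | m i. i \<in> I}" for k
    using eu_I by (intro span_base) blast
  ultimately show "z \<in> MI" unfolding submod_ideal_def closure_sequential
    by (intro exI[of _ "\<lambda>k. act z (eu k)"]) simp
qed

lemma MI_ip: "z \<in> MI \<Longrightarrow> ip y z \<in> I" "z \<in> MI \<Longrightarrow> ip z y \<in> I"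
  using M.ip_ideal[of z y] I_st[of "ip y z"] by (auto simp: submod_ideal_iff M.ip_sym)

lemma subspace_MI: "subspace MI"
proof -
  have "MI = {z. \<forall>y. ip y z \<in> I}" using MI_ip(1) by (auto simp: submod_ideal_iff)
  then show ?thesis unfolding subspace_def by (simp add: M.ip_add ip_scaleR I_add I_scaleR)
qed

lemma MI_zero: "0 \<in> MI" and MI_minus: "z \<in> MI \<Longrightarrow> - z \<in> MI"
  and MI_add: "z \<in> MI \<Longrightarrow> z' \<in> MI \<Longrightarrow> z + z' \<in> MI"
  by (simp_all add: subspace_0 subspace_neg subspace_add subspace_MI)

lemma in_qcoset_iff: "n \<in> qcoset MI m \<longleftrightarrow> n - m \<in> MI"
  unfolding qcoset_def image_iff by (metis add_diff_cancel_left' diff_add_cancel add.commute)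

lemma qcoset_eq: assumes "n \<in> qcoset MI m" shows "qcoset MI m = qcoset MI n"
proof -
  have nm: "n - m \<in> MI" using assms in_qcoset_iff by simp
  have "x - m \<in> MI \<longleftrightarrow> x - n \<in> MI" for x
    using MI_add[OF nm, of "x - n"] MI_add[OF MI_minus[OF nm], of "x - m"] by auto
  then show ?thesis by (auto simp: in_qcoset_iff)
qed

lemma self_in_qcoset: "m \<in> qcoset MI m"
  by (simp add: in_qcoset_iff MI_zero)

lemma qcoset_I_iff: "qcoset I a = qcoset I b \<longleftrightarrow> a - b \<in> I"
proof
  assume eq: "qcoset I a = qcoset I b"
  have "a + 0 \<in> qcoset I a" unfolding qcoset_def by (rule imageI) simp
  then have "a \<in> qcoset I b" unfolding eq by simp
  then obtain y where "a = b + y" "y \<in> I" unfolding qcoset_def by blast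
  then show "a - b \<in> I" by simp
next
  have "qcoset I a \<subseteq> qcoset I b" if "a - b \<in> I" for a b
  proof
    fix x assume "x \<in> qcoset I a"
    then obtain y where "x = a + y" "y \<in> I" unfolding qcoset_def by blast
    then have "x = b + ((a - b) + y)" "(a - b) + y \<in> I" using that I_add by auto
    then show "x \<in> qcoset I b" unfolding qcoset_def by blast
  qed
  moreover have "b - a \<in> I" if "a - b \<in> I" using I_minus[OF that] by simp
  ultimately show "a - b \<in> I \<Longrightarrow> qcoset I a = qcoset I b" by blast
qed

text \<open>\<open>quot_ip\<close> picks representatives by \<open>SOME\<close>; other
  representatives differ by elements of \<open>MI\<close>, which change the inner product by
  elements of \<open>I\<close>.\<close>

lemma quot_ip_qcoset: "quot_ip ip I (qcoset MI m) (qcoset MI m') = qcoset I (ip m m')"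
proof -
  define x y where "x = (SOME x. x \<in> qcoset MI m)" and "y = (SOME x. x \<in> qcoset MI m')"
  have x: "x - m \<in> MI" and y: "y - m' \<in> MI"
    unfolding x_def y_def in_qcoset_iff[symmetric] by (rule someI, rule self_in_qcoset)+
  have "ip x y - ip m m' = ip (x - m) y + ip m (y - m')" by (simp add: M.ip_diff M.ip_diff_left)
  also have "\<dots> \<in> I" by (intro I_add MI_ip x y)
  finally show ?thesis unfolding quot_ip_def x_def[symmetric] y_def[symmetric] qcoset_I_iff .
qed

text \<open>Supplies \<open>genX\<close> and \<open>genY\<close>. Vectors of \<open>l2(I)\<close>
  are limits of truncations, whose entries are limits of \<open>eu k * a\<close>.\<close>

lemma E_generated:
  assumes G: "closure (span {act g a | g a. g \<in> G}) = UNIV"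
    and zero: "0 \<in> Z" and add: "\<And>x y. x \<in> Z \<Longrightarrow> y \<in> Z \<Longrightarrow> x + y \<in> Z"
    and lim: "\<And>f x. (\<And>n. f n \<in> Z) \<Longrightarrow> x \<in> E \<Longrightarrow> (\<lambda>n. ipnorm sip (f n - x)) \<longlonglongrightarrow> 0 \<Longrightarrow> x \<in> Z"
    and gZ: "\<And>g a. g \<in> G \<Longrightarrow> (act g a, 0) \<in> Z"
    and sZ: "\<And>c k a. (0, single c (eu k * a)) \<in> Z"
    and p: "p \<in> E"
  shows "p \<in> Z"
proof -
  have nM: "ipnorm sip ((m, 0) - (m', 0)) = norm (m - m')" for m m'
    using norm_eq_ipnorm[of "m - m'"] L2_zero by (simp add: ipnorm_def sum_ip_def)
  have n2: "ipnorm sip ((0::'m, x) - (0, y)) = ipnorm (l2_ip st) (x - y)" for x y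
    by (simp add: ipnorm_def sum_ip_def)
  have E0: "(m, 0) \<in> E" for m using L2_zero by simp
  have MZ: "(m, 0) \<in> Z" for m
  proof -
    \<comment> \<open>\<open>Z\<close> is only additive; asking for all real multiples yields a
      subspace.\<close>
    let ?W = "{m. \<forall>r. (r *\<^sub>R m, 0) \<in> Z}"
    have "subspace ?W"
      unfolding subspace_def using zero add[of "(_, 0)" "(_, 0)"]
      by (auto simp: zero_prod_def scaleR_add_right)
    moreover have "closed ?W"
      unfolding closed_sequential_limits
    proof (intro allI impI CollectI, elim conjE)
      fix f l and r :: real assume f: "\<forall>n. f n \<in> ?W" "f \<longlonglongrightarrow> l"
      have "(\<lambda>n. r *\<^sub>R f n) \<longlonglongrightarrow> r *\<^sub>R l" by (intro tendsto_intros f)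
      then have "(\<lambda>n. ipnorm sip ((r *\<^sub>R f n, 0) - (r *\<^sub>R l, 0))) \<longlonglongrightarrow> 0"
        unfolding nM by (simp add: LIM_zero tendsto_norm_zero)
      from lim[OF _ E0 this] f(1) show "(r *\<^sub>R l, 0) \<in> Z" by blast
    qed
    moreover have "{act g a | g a. g \<in> G} \<subseteq> ?W" using gZ by (auto simp: act_scaleR)
    ultimately have "closure (span {act g a | g a. g \<in> G}) \<subseteq> ?W"
      by (intro closure_minimal span_minimal)
    from subsetD[OF this[unfolded G] UNIV_I, of m] have "(1 *\<^sub>R m, 0) \<in> Z" by blast
    then show ?thesis by simp
  qed
  have SZ: "(0, single c a) \<in> Z" if a: "a \<in> I" for c a
  proof (rule lim[of "\<lambda>k. (0, single c (eu k * a))"])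
    have "ipnorm sip ((0, single c (eu k * a)) - (0, single c a)) = norm (eu k * a - a)" for k
    proof -
      have "single c (eu k * a) - single c a = single c (eu k * a - a)" unfolding single_def by auto
      moreover have "eu k * a - a \<in> I" using a by (intro I_diff I_mult_left)
      ultimately show ?thesis unfolding n2 by (simp add: ipnorm_def single_L2(2) cstar_identity del: st_diff)
    qed
    then show "(\<lambda>k. ipnorm sip ((0, single c (eu k * a)) - (0, single c a))) \<longlonglongrightarrow> 0"
      using eu_left[OF a] by (simp add: LIM_zero tendsto_norm_zero)
  qed (use sZ single_L2[OF a] in auto)
  have LZ: "(0, x) \<in> Z" if x: "x \<in> L2" for x
  proof -
    define y where "y n = (\<lambda>k. if k < n then x k else 0)" for n
    have yZ: "(0, y n) \<in> Z" for n
    proof (induction n)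
      case 0
      then show ?case using zero by (simp add: y_def zero_prod_def zero_fun_def)
    next
      case (Suc n)
      have "y (Suc n) = y n + single n (x n)" unfolding y_def single_def by auto
      then have "(0::'m, y (Suc n)) = (0, y n) + (0, single n (x n))" by simp
      moreover have "x n \<in> I" using x unfolding l2_def by simp
      ultimately show ?case using add[OF Suc SZ[of "x n" n]] by argo
    qed
    have s: "summable (\<lambda>k. st (x k) * x k)" using x unfolding l2_def by simp
    have "l2_ip st (y n - x) (y n - x) = l2_ip st x x - (\<Sum>k<n. st (x k) * x k)" for n
    proof -
      have "(\<lambda>k. if k < n then st (x k) * x k else 0) sums (\<Sum>k<n. st (x k) * x k)"
        using sums_If_finite_set[of "{..<n}" "\<lambda>k. st (x k) * x k"] by simp
      then have "(\<lambda>k. st (x k) * x k - (if k < n then st (x k) * x k else 0)) sums (l2_ip st x x - (\<Sum>k<n. st (x k) * x k))"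
        unfolding l2_ip_def using summable_sums[OF s] by (intro sums_diff)
      moreover have "(\<lambda>k. st (x k) * x k - (if k < n then st (x k) * x k else 0)) = (\<lambda>k. st ((y n - x) k) * (y n - x) k)"
        unfolding y_def by auto
      ultimately show ?thesis unfolding l2_ip_def by (simp add: sums_iff)
    qed
    moreover have "(\<lambda>n. sqrt (norm (l2_ip st x x - (\<Sum>k<n. st (x k) * x k)))) \<longlonglongrightarrow> sqrt (norm (l2_ip st x x - l2_ip st x x))"
      unfolding l2_ip_def by (intro tendsto_intros summable_LIMSEQ[OF s])
    ultimately have "(\<lambda>n. ipnorm (l2_ip st) (y n - x)) \<longlonglongrightarrow> 0" unfolding ipnorm_def by simp
    then have "(\<lambda>n. ipnorm sip ((0::'m, y n) - (0, x))) \<longlonglongrightarrow> 0" unfolding n2 .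
    from lim[OF yZ _ this] show ?thesis using x by simp
  qed
  have "p = (fst p, 0) + (0, snd p)" by simp
  then show ?thesis using add[OF MZ[of "fst p"] LZ[of "snd p"]] p by (metis mem_Times_iff)
qed

lemma fst_ip_ideal: assumes "p \<in> E" "sip p p \<in> I" shows "ip (fst p) m \<in> I"
proof -
  have "sip (m, 0) p \<in> I" by (rule ip_ideal[OF assms]) (use L2_zero in simp)
  moreover have "sip (m, 0) p = ip m (fst p)" using assms by (auto simp: sum_ip_def)
  ultimately show ?thesis using I_st[of "ip m (fst p)"] by (simp add: M.ip_sym)
qed

lemma fst_tendsto_ip:
  assumes "\<And>n. f n \<in> E" "p \<in> E" "(\<lambda>n. ipnorm sip (f n - p)) \<longlonglongrightarrow> 0"
  shows "(\<lambda>n. ip (fst (f n)) m) \<longlonglongrightarrow> ip (fst p) m"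
proof (rule M.tendsto_ip)
  show "(\<lambda>n. ipnorm ip (fst (f n) - fst p)) \<longlonglongrightarrow> 0"
    by (rule Lim_null_comparison[OF _ assms(3)])
       (use E_norm_bounds(1)[OF E.diff_X[OF assms(1,2)]] in \<open>auto simp: norm_eq_ipnorm intro!: always_eventually\<close>)
qed auto

text \<open>Even positions hold what the generator step cuts off, odd positions generate
  \<open>l2(I)\<close>. All of them have inner square in \<open>I\<close>, as targets must.\<close>

definition tgt :: "(nat \<Rightarrow> 'm) \<Rightarrow> nat \<Rightarrow> 'm \<times> (nat \<Rightarrow> 'a)" where
  "tgt g i = (case prod_decode (i div 2) of (j, k) \<Rightarrow>
     if even i then sact (g j, 0) (eu k) else (0, single j (eu k)))"

lemma tgt_even: "tgt g (2 * prod_encode (j, k)) = sact (g j, 0) (eu k)"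
  and tgt_odd: "tgt g (Suc (2 * prod_encode (j, k))) = (0, single j (eu k))"
  unfolding tgt_def by simp_all

lemma sact_single: "sact (0, single c b) a = (0, single c (b * a))"
  unfolding sact_def single_def using M.act_diff_left[of 0 0 a] by auto

lemma blk_zero: "(m, 0) \<in> blk 0"
  using L2_zero by (simp add: blk_def)

lemma tgt_blk: "\<exists>b. tgt g i \<in> blk b" and tgt_ideal: "sip (tgt g i) (tgt g i) \<in> I"
proof -
  obtain j k where jk: "prod_decode (i div 2) = (j, k)" by fastforce
  have "tgt g i \<in> blk (Suc (fst (prod_decode j))) \<and> sip (tgt g i) (tgt g i) \<in> I"
  proof (cases "even i")
    case True
    then have t: "tgt g i = sact (g j, 0) (eu k)" unfolding tgt_def by (simp add: jk)
    have "sip (tgt g i) (tgt g i) \<in> I"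
      unfolding t using E.act_X[of "(g j, 0)"] L2_zero by (simp add: E.ip_act I_mult_left eu_I)
    then show ?thesis unfolding t using Xb_mono[OF Xb_act[OF blk_zero]] by blast
  next
    case False
    then have t: "tgt g i = (0, single j (eu k))" unfolding tgt_def by (simp add: jk)
    show ?thesis unfolding t using single_L2[OF eu_I, of j k] l2_ip_I
      by (auto simp: blk_def sum_ip_def single_def I_mult_left eu_I)
  qed
  then show "\<exists>b. tgt g i \<in> blk b" "sip (tgt g i) (tgt g i) \<in> I" by auto
qed

end

section \<open>Lifting from cosets to vectors\<close>

locale lifting_problem =
  M: hilbert_with_ideal cs st I cmM actM ipM + N: hilbert_with_ideal cs st I cmN actN ipN
  for cs :: "complex \<Rightarrow> 'a::{real_normed_algebra,banach} \<Rightarrow> 'a" and st :: "'a \<Rightarrow> 'a" and I :: "'a set"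
    and cmM :: "complex \<Rightarrow> 'm::{real_normed_vector,banach} \<Rightarrow> 'm" and actM ipM
    and cmN :: "complex \<Rightarrow> 'n::{real_normed_vector,banach} \<Rightarrow> 'n" and actN ipN +
  fixes \<phi> :: "'m set \<Rightarrow> 'n set"
  assumes phi: "unitary_op (quot_carrier (submod_ideal actM I)) (quot_ip ipM I)
                    (quot_carrier (submod_ideal actN I)) (quot_ip ipN I) \<phi>"
begin

text \<open>A choice of representatives for \<phi> would in general respect neither sums nor the
  action; the relation does, by \<open>matches_iff\<close>.\<close>

definition matches :: "'m \<Rightarrow> 'n \<Rightarrow> bool" where "matches m n \<longleftrightarrow> n \<in> \<phi> (qcoset M.MI m)"

lemma qcoset_carrier: "qcoset M.MI m \<in> quot_carrier M.MI" "qcoset N.MI n \<in> quot_carrier N.MI"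
  unfolding quot_carrier_def by (rule rangeI)+

lemma phi_carrier: "\<phi> (qcoset M.MI m) \<in> quot_carrier N.MI"
  using bspec[OF conjunct1[OF phi[unfolded unitary_op_def]] qcoset_carrier(1)] .

lemma phi_eq: assumes "matches m n" shows "\<phi> (qcoset M.MI m) = qcoset N.MI n"
proof -
  obtain n' where "\<phi> (qcoset M.MI m) = qcoset N.MI n'" using phi_carrier[of m] unfolding quot_carrier_def by (rule rangeE)
  then show ?thesis using N.qcoset_eq[of n n'] assms unfolding matches_def by simp
qed

lemma matches_total: "\<exists>n. matches m n"
proof -
  obtain n where "\<phi> (qcoset M.MI m) = qcoset N.MI n" using phi_carrier[of m] unfolding quot_carrier_def by (rule rangeE)
  then have "matches m n" unfolding matches_def using N.self_in_qcoset by simp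
  then show ?thesis by (rule exI)
qed

lemma phi_adjoint:
  obtains V where "\<And>n. V (qcoset N.MI n) \<in> quot_carrier M.MI"
    "\<And>m n. quot_ip ipN I (\<phi> (qcoset M.MI m)) (qcoset N.MI n) = quot_ip ipM I (qcoset M.MI m) (V (qcoset N.MI n))"
    "\<And>m. V (\<phi> (qcoset M.MI m)) = qcoset M.MI m" "\<And>n. \<phi> (V (qcoset N.MI n)) = qcoset N.MI n"
proof -
  obtain V where V: "(\<forall>y\<in>quot_carrier N.MI. V y \<in> quot_carrier M.MI) \<and>
    (\<forall>x\<in>quot_carrier M.MI. \<forall>y\<in>quot_carrier N.MI. quot_ip ipN I (\<phi> x) y = quot_ip ipM I x (V y)) \<and>
    (\<forall>x\<in>quot_carrier M.MI. V (\<phi> x) = x) \<and> (\<forall>y\<in>quot_carrier N.MI. \<phi> (V y) = y)"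
    using conjunct2[OF phi[unfolded unitary_op_def]] by (rule exE)
  show ?thesis by (rule that[of V]) (use V qcoset_carrier in simp_all)
qed

lemma matches_surj: "\<exists>m. matches m n"
proof -
  obtain V where V: "\<And>n. V (qcoset N.MI n) \<in> quot_carrier M.MI" "\<And>n. \<phi> (V (qcoset N.MI n)) = qcoset N.MI n"
    using phi_adjoint by metis
  obtain m where "V (qcoset N.MI n) = qcoset M.MI m" using V(1)[of n] unfolding quot_carrier_def by (rule rangeE)
  then have "matches m n" unfolding matches_def using V(2)[of n] N.self_in_qcoset by simp
  then show ?thesis by (rule exI)
qed

lemma matches_ip: assumes "matches m n" "matches m' n'" shows "ipM m m' - ipN n n' \<in> I"
proof -
  obtain V where V: "\<And>m n. quot_ip ipN I (\<phi> (qcoset M.MI m)) (qcoset N.MI n) = quot_ip ipM I (qcoset M.MI m) (V (qcoset N.MI n))"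
    "\<And>m. V (\<phi> (qcoset M.MI m)) = qcoset M.MI m" using phi_adjoint by metis
  have "quot_ip ipN I (qcoset N.MI n) (qcoset N.MI n') = quot_ip ipM I (qcoset M.MI m) (qcoset M.MI m')"
    using V(1)[of m n'] V(2)[of m'] unfolding phi_eq[OF assms(1)] phi_eq[OF assms(2)] by simp
  then have "qcoset I (ipM m m') = qcoset I (ipN n n')"
    unfolding M.quot_ip_qcoset N.quot_ip_qcoset by simp
  then show ?thesis unfolding M.qcoset_I_iff .
qed

text \<open>If \<open>n0\<close> matches \<open>m\<close>, test \<open>n\<close> against a partner
  of \<open>n - n0\<close>: then \<open>ipN (n - n0) (n - n0)\<close> lies in \<open>I\<close>.
  Since \<open>unitary_op\<close> says nothing about linearity, this description by inner products
  is the source of additivity, module linearity and closedness of \<open>matches\<close>.\<close>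

lemma matches_iff: "matches m n \<longleftrightarrow> (\<forall>m' n'. matches m' n' \<longrightarrow> ipM m m' - ipN n n' \<in> I)"
proof
  show "matches m n \<Longrightarrow> \<forall>m' n'. matches m' n' \<longrightarrow> ipM m m' - ipN n n' \<in> I" using matches_ip by blast
  assume *: "\<forall>m' n'. matches m' n' \<longrightarrow> ipM m m' - ipN n n' \<in> I"
  obtain n0 where n0: "matches m n0" using matches_total by blast
  obtain m' where m': "matches m' (n - n0)" using matches_surj by blast
  have "(ipM m m' - ipN n0 (n - n0)) - (ipM m m' - ipN n (n - n0)) \<in> I"
    using M.I_diff[OF matches_ip[OF n0 m']] * m' by blast
  then have "ipN (n - n0) (n - n0) \<in> I" by (simp add: N.M.ip_diff_left)
  then have "n \<in> qcoset N.MI n0" by (simp add: N.in_qcoset_iff N.submod_ideal_iff)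
  then show "matches m n" using phi_eq[OF n0] unfolding matches_def by simp
qed

lemma matches_submod: assumes "matches m n" shows "m \<in> M.MI \<longleftrightarrow> n \<in> N.MI"
proof -
  have d: "ipM m m - ipN n n \<in> I" by (rule matches_ip[OF assms assms])
  show ?thesis unfolding M.submod_ideal_iff N.submod_ideal_iff
    using M.I_add[OF d, of "ipN n n"] M.I_diff[OF _ d, of "ipM m m"] by auto
qed

definition coh :: "'m \<times> (nat \<Rightarrow> 'a) \<Rightarrow> 'n \<times> (nat \<Rightarrow> 'a) \<Rightarrow> bool" where
  "coh p q \<longleftrightarrow> p \<in> M.E \<and> q \<in> N.E \<and> matches (fst p) (fst q)"

sublocale back_and_forth cs st I M.E M.sact M.sip M.blk M.emb N.E N.sact N.sip N.blk N.emb coh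
proof
  fix x x' y y' a
  assume c: "coh x y"
  then have xy: "x \<in> M.E" "y \<in> N.E" "snd x \<in> M.L2" "snd y \<in> M.L2" "matches (fst x) (fst y)"
    unfolding coh_def by auto
  show "x \<in> M.E \<and> y \<in> N.E" using xy by blast
  show "coh (M.sact x a) (N.sact y a)"
  proof -
    have "matches (actM (fst x) a) (actN (fst y) a)"
      unfolding matches_iff[of "actM (fst x) a"]
    proof (intro allI impI)
      fix m' n' assume "matches m' n'"
      then have "st a * (ipM (fst x) m' - ipN (fst y) n') \<in> I" using xy matches_ip by (intro M.I_mult_left)
      then show "ipM (actM (fst x) a) m' - ipN (actN (fst y) a) n' \<in> I"
        by (simp add: M.M.ip_act_left N.M.ip_act_left right_diff_distrib)
    qed
    then show ?thesis unfolding coh_def using M.E.act_X[OF xy(1)] N.E.act_X[OF xy(2)]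
      by (simp add: M.sact_def N.sact_def)
  qed
  assume "coh x' y'"
  then have xy': "x' \<in> M.E" "y' \<in> N.E" "snd x' \<in> M.L2" "snd y' \<in> M.L2" "matches (fst x') (fst y')"
    unfolding coh_def by auto
  have "(ipM (fst x) (fst x') - ipN (fst y) (fst y')) + (l2_ip st (snd x) (snd x') - l2_ip st (snd y) (snd y')) \<in> I"
    using xy xy' by (intro M.I_add M.I_diff[of "l2_ip _ _ _"] M.l2_ip_I matches_ip)
  then show "M.sip x x' - N.sip y y' \<in> I" unfolding sum_ip_def by (simp add: algebra_simps)
  show "coh (x + x') (y + y')"
  proof -
    have "matches (fst x + fst x') (fst y + fst y')"
      unfolding matches_iff[of "fst x + fst x'"]
    proof (intro allI impI)
      fix m' n' assume "matches m' n'"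
      then have "(ipM (fst x) m' - ipN (fst y) n') + (ipM (fst x') m' - ipN (fst y') n') \<in> I"
        using xy xy' matches_ip by (intro M.I_add)
      then show "ipM (fst x + fst x') m' - ipN (fst y + fst y') n' \<in> I"
        by (simp add: M.M.ip_add_left N.M.ip_add_left algebra_simps)
    qed
    then show ?thesis unfolding coh_def using M.E.add_X[OF xy(1) xy'(1)] N.E.add_X[OF xy(2) xy'(2)] by simp
  qed
next
  fix x y assume "x \<in> M.E" "y \<in> N.E" "M.sip x x \<in> I" "N.sip y y \<in> I"
  then show "coh x y" unfolding coh_def matches_iff[of "fst x"]
    using M.fst_ip_ideal[of x] N.fst_ip_ideal[of y] M.I_diff by blast
next
  fix f g x y
  assume fg: "\<And>n. coh (f n) (g n)" and x: "x \<in> M.E" and y: "y \<in> N.E"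
    and l: "(\<lambda>n. ipnorm M.sip (f n - x)) \<longlonglongrightarrow> 0" "(\<lambda>n. ipnorm N.sip (g n - y)) \<longlonglongrightarrow> 0"
  have f: "f n \<in> M.E" "g n \<in> N.E" "matches (fst (f n)) (fst (g n))" for n using fg[of n] unfolding coh_def by auto
  have "matches (fst x) (fst y)"
    unfolding matches_iff[of "fst x"]
  proof (intro allI impI)
    fix m' n' assume k: "matches m' n'"
    show "ipM (fst x) m' - ipN (fst y) n' \<in> I"
    proof (rule M.I_limit)
      show "ipM (fst (f n)) m' - ipN (fst (g n)) n' \<in> I" for n by (rule matches_ip[OF f(3) k])
      show "(\<lambda>n. ipM (fst (f n)) m' - ipN (fst (g n)) n') \<longlonglongrightarrow> ipM (fst x) m' - ipN (fst y) n'"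
        by (intro tendsto_diff M.fst_tendsto_ip[OF f(1) x l(1)] N.fst_tendsto_ip[OF f(2) y l(2)])
    qed
  qed
  then show "coh x y" unfolding coh_def using x y by blast
qed

lemma coherent_generators:
  assumes "countably_generated actM" "countably_generated actN"
  obtains g :: "nat \<Rightarrow> 'm" and h :: "nat \<Rightarrow> 'n" where "\<forall>j. matches (g j) (h j)"
    "closure (span {actM x a | x a. x \<in> range g}) = UNIV" "closure (span {actN y a | y a. y \<in> range h}) = UNIV"
proof -
  have mono: "closure (span {act x a | x a. x \<in> R}) \<subseteq> closure (span {act x a | x a. x \<in> R'})"
    if "R \<subseteq> R'" for act :: "'z::real_normed_vector \<Rightarrow> 'a \<Rightarrow> 'z" and R R'
    using that by (intro closure_mono span_mono Collect_mono) blast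
  have enum: "\<exists>f::nat \<Rightarrow> 'z. closure (span {act x a | x a. x \<in> range f}) = UNIV"
    if cg: "countably_generated act" for act :: "'z::real_normed_vector \<Rightarrow> 'a \<Rightarrow> 'z"
  proof -
    obtain G where G: "countable G" "closure (span {act x a | x a. x \<in> G}) = UNIV"
      using cg unfolding countably_generated_def by blast
    \<comment> \<open>Inserting 0 makes the set nonempty, so that \<open>from_nat_into\<close>
      enumerates it even if \<open>G\<close> is empty.\<close>
    have r: "range (from_nat_into (insert 0 G)) = insert 0 G" using G(1) by (intro range_from_nat_into) auto
    have "closure (span {act x a | x a. x \<in> G}) \<subseteq> closure (span {act x a | x a. x \<in> insert 0 G})"
      by (rule mono) blast
    then show ?thesis using G(2) r by (intro exI[of _ "from_nat_into (insert 0 G)"]) auto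
  qed
  obtain f where f: "closure (span {actM x a | x a. x \<in> range (f :: nat \<Rightarrow> 'm)}) = UNIV" using enum[OF assms(1)] by blast
  obtain f' where f': "closure (span {actN x a | x a. x \<in> range (f' :: nat \<Rightarrow> 'n)}) = UNIV" using enum[OF assms(2)] by blast
  obtain p where p: "\<And>m. matches m (p m)" using matches_total by metis
  obtain q where q: "\<And>n. matches (q n) n" using matches_surj by metis
  \<comment> \<open>Even positions carry the generators of \<open>M\<close> with chosen partners,
    odd positions those of \<open>N\<close>, so that each family generates its module.\<close>
  define g where "g j = (if even j then f (j div 2) else q (f' (j div 2)))" for j
  define h where "h j = (if even j then p (f (j div 2)) else f' (j div 2))" for j
  have "f j = g (2 * j)" "f' j = h (Suc (2 * j))" for j unfolding g_def h_def by auto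
  then have sub: "range f \<subseteq> range g" "range f' \<subseteq> range h" by blast+
  have "closure (span {actM x a | x a. x \<in> range f}) \<subseteq> closure (span {actM x a | x a. x \<in> range g})"
    "closure (span {actN x a | x a. x \<in> range f'}) \<subseteq> closure (span {actN x a | x a. x \<in> range h})"
    by (rule mono[OF sub(1)], rule mono[OF sub(2)])
  then have "closure (span {actM x a | x a. x \<in> range g}) = UNIV" "closure (span {actN y a | y a. y \<in> range h}) = UNIV"
    unfolding f f' by auto
  moreover have "\<forall>j. matches (g j) (h j)" unfolding g_def h_def using p q by simp
  ultimately show ?thesis using that by blast
qed

lemma unitary_lift:
  assumes "countably_generated actM" "countably_generated actN"
  obtains U where "unitary_op M.E M.sip N.E N.sip U" "\<And>p. p \<in> M.E \<Longrightarrow> coh p (U p)"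
proof -
  obtain g :: "nat \<Rightarrow> 'm" and h :: "nat \<Rightarrow> 'n" where matches: "\<forall>j. matches (g j) (h j)"
    and g: "closure (span {actM x a | x a. x \<in> range g}) = UNIV" and h: "closure (span {actN y a | y a. y \<in> range h}) = UNIV"
    by (rule coherent_generators[OF assms])
  interpret back_and_forth_generated cs st I M.E M.sact M.sip M.blk M.emb N.E N.sact N.sip N.blk N.emb coh
    "M.tgt g" "\<lambda>j. (g j, 0)" "N.tgt h" "\<lambda>j. (h j, 0)"
  proof
    show "\<exists>b. M.tgt g j \<in> M.blk b" "M.sip (M.tgt g j) (M.tgt g j) \<in> I"
      "\<exists>b. N.tgt h j \<in> N.blk b" "N.sip (N.tgt h j) (N.tgt h j) \<in> I"
      "(g j, 0) \<in> M.blk 0" "(h j, 0) \<in> N.blk 0" for j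
      by (rule M.tgt_blk M.tgt_ideal N.tgt_blk N.tgt_ideal M.blk_zero N.blk_zero)+
    show "coh (g j, 0) (h j, 0)" for j using matches M.L2_zero unfolding coh_def by simp
    show "\<exists>i. M.tgt g i = M.sact (g j, 0) (M.eu k)" "\<exists>i. N.tgt h i = N.sact (h j, 0) (M.eu k)" for j k
      using M.tgt_even N.tgt_even by blast+
  next
    fix Z x
    assume Z: "0 \<in> Z" "\<And>x y. x \<in> Z \<Longrightarrow> y \<in> Z \<Longrightarrow> x + y \<in> Z"
      "\<And>f x. (\<And>n. f n \<in> Z) \<Longrightarrow> x \<in> M.E \<Longrightarrow> (\<lambda>n. ipnorm M.sip (f n - x)) \<longlonglongrightarrow> 0 \<Longrightarrow> x \<in> Z"
      "\<And>j a. M.sact (M.tgt g j) a \<in> Z" "\<And>j a. M.sact (g j, 0) a \<in> Z" "x \<in> M.E"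
    show "x \<in> Z"
    proof (rule M.E_generated[OF g])
      show "0 \<in> Z" "x \<in> M.E" by (rule Z)+
      show "x + y \<in> Z" if "x \<in> Z" "y \<in> Z" for x y by (rule Z(2)[OF that])
      show "x \<in> Z" if "\<And>n. f n \<in> Z" "x \<in> M.E" "(\<lambda>n. ipnorm M.sip (f n - x)) \<longlonglongrightarrow> 0" for f x
        by (rule Z(3)[OF that])
      show "(actM x a, 0) \<in> Z" if "x \<in> range g" for x a
        using that Z(5) by (auto simp: M.sact_def zero_fun_def)
      show "(0, single c (M.eu k * a)) \<in> Z" for c k a
        using Z(4)[of "Suc (2 * prod_encode (c, k))" a] unfolding M.tgt_odd M.sact_single .
    qed
  next
    fix Z x
    assume Z: "0 \<in> Z" "\<And>x y. x \<in> Z \<Longrightarrow> y \<in> Z \<Longrightarrow> x + y \<in> Z"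
      "\<And>f x. (\<And>n. f n \<in> Z) \<Longrightarrow> x \<in> N.E \<Longrightarrow> (\<lambda>n. ipnorm N.sip (f n - x)) \<longlonglongrightarrow> 0 \<Longrightarrow> x \<in> Z"
      "\<And>j a. N.sact (N.tgt h j) a \<in> Z" "\<And>j a. N.sact (h j, 0) a \<in> Z" "x \<in> N.E"
    show "x \<in> Z"
    proof (rule N.E_generated[OF h])
      show "0 \<in> Z" "x \<in> N.E" by (rule Z)+
      show "x + y \<in> Z" if "x \<in> Z" "y \<in> Z" for x y by (rule Z(2)[OF that])
      show "x \<in> Z" if "\<And>n. f n \<in> Z" "x \<in> N.E" "(\<lambda>n. ipnorm N.sip (f n - x)) \<longlonglongrightarrow> 0" for f x
        by (rule Z(3)[OF that])
      show "(actN x a, 0) \<in> Z" if "x \<in> range h" for x a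
        using that Z(5) by (auto simp: N.sact_def zero_fun_def)
      show "(0, single c (M.eu k * a)) \<in> Z" for c k a
        using Z(4)[of "Suc (2 * prod_encode (c, k))" a] unfolding N.tgt_odd N.sact_single .
    qed
  qed
  show ?thesis using coherent_unitary that by blast
qed

end

theorem theorem1p2:
  fixes cs :: "complex \<Rightarrow> 'a::{real_normed_algebra,banach} \<Rightarrow> 'a"
    and st :: "'a \<Rightarrow> 'a"
    and I :: "'a set"
    and cmM :: "complex \<Rightarrow> 'm::{real_normed_vector,banach} \<Rightarrow> 'm"
    and actM :: "'m \<Rightarrow> 'a \<Rightarrow> 'm" and ipM :: "'m \<Rightarrow> 'm \<Rightarrow> 'a"
    and cmN :: "complex \<Rightarrow> 'n::{real_normed_vector,banach} \<Rightarrow> 'n"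
    and actN :: "'n \<Rightarrow> 'a \<Rightarrow> 'n" and ipN :: "'n \<Rightarrow> 'n \<Rightarrow> 'a"
    and \<phi> :: "'m set \<Rightarrow> 'n set"
  assumes "cstar_alg cs st"
    and "closed_ideal cs I"
    and "sigma_unital st I"
    and "hilbert_module cs st cmM actM ipM"
    and "hilbert_module cs st cmN actN ipN"
    and "countably_generated actM"
    and "countably_generated actN"
    and "unitary_op (quot_carrier (submod_ideal actM I)) (quot_ip ipM I)
                    (quot_carrier (submod_ideal actN I)) (quot_ip ipN I) \<phi>"
  shows "\<exists>\<Phi> :: 'm \<times> (nat \<Rightarrow> 'a) \<Rightarrow> 'n \<times> (nat \<Rightarrow> 'a).
           unitary_op (UNIV \<times> l2 st I) (sum_ip ipM st) (UNIV \<times> l2 st I) (sum_ip ipN st) \<Phi> \<and>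
           \<Phi> ` (submod_ideal actM I \<times> l2 st I) = submod_ideal actN I \<times> l2 st I \<and>
           (\<forall>m. \<forall>x\<in>l2 st I. fst (\<Phi> (m, x)) \<in> \<phi> (qcoset (submod_ideal actM I) m))"
proof -
  interpret lifting_problem cs st I cmM actM ipM cmN actN ipN \<phi>
    by unfold_locales (use assms in auto)
  obtain U where U: "unitary_op M.E M.sip N.E N.sip U" and co: "\<And>p. p \<in> M.E \<Longrightarrow> coh p (U p)"
    using unitary_lift[OF assms(6,7)] by blast
  have UE: "U p \<in> N.E" if "p \<in> M.E" for p using co[OF that] unfolding coh_def by blast
  \<comment> \<open>An equivalence, so that together with surjectivity of \<open>U\<close> it gives
    both inclusions of the image equality below.\<close>
  have sub: "fst p \<in> M.MI \<longleftrightarrow> fst (U p) \<in> N.MI" if "p \<in> M.E" for p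
    using co[OF that] matches_submod unfolding coh_def by blast
  have "U ` (M.MI \<times> M.L2) = N.MI \<times> M.L2"
  proof (intro equalityI subsetI)
    fix q assume "q \<in> U ` (M.MI \<times> M.L2)"
    then obtain p where p: "p \<in> M.MI \<times> M.L2" "q = U p" by blast
    then have "p \<in> M.E" "fst p \<in> M.MI" by auto
    then show "q \<in> N.MI \<times> M.L2" using sub UE p(2) by (auto simp: mem_Times_iff)
  next
    fix q assume q: "q \<in> N.MI \<times> M.L2"
    then have "q \<in> N.E" by auto
    then obtain p where p: "p \<in> M.E" "U p = q" using U unfolding unitary_op_def by metis
    then have "p \<in> M.MI \<times> M.L2" using sub[OF p(1)] q by (auto simp: mem_Times_iff)
    then show "q \<in> U ` (M.MI \<times> M.L2)" using p(2) by blast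
  qed
  moreover have "fst (U (m, x)) \<in> \<phi> (qcoset M.MI m)" if "x \<in> M.L2" for m x
    using co[of "(m, x)"] that unfolding coh_def matches_def by simp
  ultimately show ?thesis using U by blast
qed

end
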